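(* Let $p\in(0,1)$ and $\alpha=2p-1$. Let $\{m_n:n\in\mathbb{N}\}$ be a sequence of positive integers with $1\le m_n\le n$ for each $n\in\mathbb{N}$, $\lim_{n\to\infty}m_n=+\infty$, and, with $\gamma_n:=m_n/n$, $\lim_{n\to\infty}\gamma_n=\gamma\in[0,1]$. Let $\{T_n\}$ be the elephant random walk in the triangular array setting (defined in the context). (i) If $\alpha\in(-1,1/2)$ then $$\frac{\gamma_nT_n}{\sqrt{m_n}}\stackrel{\text{d}}{\to}N\left(0,\frac{\{\gamma+\alpha(1-\gamma)\}^2}{1-2\alpha}+\gamma(1-\gamma)\right)\quad\text{as }n\to\infty.$$ (ii) If $\alpha=1/2$ then $$\frac{\gamma_nT_n}{\sqrt{m_n\log m_n}}\stackrel{\text{d}}{\to}N\left(0,\frac{(1+\gamma)^2}{4}\right)\quad\text{as }n\to\infty.$$ (iii) If $\alpha\in(1/2,1)$ then $$\lim_{n\to\infty}\frac{\gamma_nT_n}{(m_n)^{\alpha}}=\{\gamma+\alpha(1-\gamma)\}M\quad\text{a.s. and in }L^2,$$ where $M$ is the random variable such that $W_n/n^{\alpha}\to M$ a.s. and in $L^2$. Moreover, $$\frac{\gamma_nT_n-M\cdot\{\gamma_n+\alpha(1-\gamma_n)\}\cdot(m_n)^{\alpha}}{\sqrt{m_n}}\stackrel{\text{d}}{\to}N\left(0,\frac{\{\gamma+\alpha(1-\gamma)\}^2}{2\alpha-1}+\gamma(1-\gamma)\right)\quad\text{as }n\to\infty.$$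
   Context: Elephant random walk (ERW). Let $p\in(0,1)$, $s\in[0,1]$, $\alpha=2p-1$. Let $X_1=+1$ with probability $s$ and $X_1=-1$ with probability $1-s$. Let $\{U_n:n\ge1\}$ be independent random variables, independent of $X_1$, with $U_n$ uniform on $\{1,\dots,n\}$, and for $n\in\mathbb{N}=\{1,2,\dots\}$ let $X_{n+1}=+X_{U_n}$ with probability $p$ and $X_{n+1}=-X_{U_n}$ with probability $1-p$ (the sign choices being independent of each other and of everything else). Put $W_n=\sum_{k=1}^nX_k$. It is known that for $\alpha\in(1/2,1)$ there is a random variable $M$ with $W_n/n^\alpha\to M$ a.s. and in $L^2$. Triangular array setting. Given $\{m_n\}$ with $1\le m_n\le n$, for each $n$ and $1\le k\le n$ let $Y^{(n)}_k=X_k$ for $1\le k\le m_n$ and $Y^{(n)}_k=X^{(n)}_k$ for $m_n<k\le n$, where for $m_n<k\le n$, $X^{(n)}_k=+X_{U_{k,n}}$ with probability $p$ and $X^{(n)}_k=-X_{U_{k,n}}$ with probability $1-p$. Here $\mathcal{U}_n=\{U_{k,n}:m_n<k\le n\}$ is an i.i.d. collection of uniform random variables on $\{1,\dots,m_n\}$, and the collections $\mathcal{U}_n$, $n\in\mathbb{N}$, are independent (of each other and of $\{X_i\}$); the sign choices are again independent of each other and of everything else. Define $T_n:=\sum_{k=1}^nY^{(n)}_k$. $N(0,\sigma^2)$ is the centered normal law with variance $\sigma^2$; $N(0,0)$ is interpreted as the point mass at $0$. *)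

theory Defs
  imports "HOL-Probability.Probability"
begin

text \<open>The independent sources of randomness: the first step, the remembered times and the sign
  choices of the walk, and the remembered times and the sign choices of the triangular array.\<close>

datatype erw_source =
    First_Step
  | Walk_Time nat
  | Walk_Sign nat
  | Array_Time nat nat
  | Array_Sign nat nat

definition random_sign :: "'a measure \<Rightarrow> real \<Rightarrow> ('a \<Rightarrow> real) \<Rightarrow> bool" where
  "random_sign P q Z \<longleftrightarrow>
     Z \<in> borel_measurable P \<and>
     (\<forall>\<omega>\<in>space P. Z \<omega> \<in> {1, -1}) \<and>
     \<P>(\<omega> in P. Z \<omega> = 1) = q \<and> \<P>(\<omega> in P. Z \<omega> = -1) = 1 - q"

definition uniform_upto :: "'a measure \<Rightarrow> nat \<Rightarrow> ('a \<Rightarrow> nat) \<Rightarrow> bool" where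
  "uniform_upto P N Z \<longleftrightarrow>
     Z \<in> measurable P (count_space UNIV) \<and>
     (\<forall>\<omega>\<in>space P. Z \<omega> \<in> {1..N}) \<and>
     (\<forall>j\<in>{1..N}. \<P>(\<omega> in P. Z \<omega> = j) = 1 / real N)"

text \<open>The sign choices are made explicit: \<open>\<epsilon> n\<close> (resp. \<open>\<eta> n k\<close>) is the factor \<open>1\<close> or \<open>-1\<close>, with
  probabilities \<open>p\<close> and \<open>1 - p\<close>, that multiplies the remembered step. The variable \<open>V n k\<close> is
  the time remembered by entry \<open>k\<close> of row \<open>n\<close>. Only the indices \<open>n \<ge> 1\<close> of \<open>X\<close>, \<open>U\<close>, \<open>\<epsilon>\<close>
  and \<open>m n < k \<le> n\<close> of \<open>V\<close>, \<open>\<eta>\<close> are constrained. The times are embedded into the reals in the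
  independence assumption, since the library wants a family with a single value type.\<close>

locale erw_triangular_array = prob_space P
  for P :: "'a measure" +
  fixes p s :: real
    and X :: "nat \<Rightarrow> 'a \<Rightarrow> real"
    and U :: "nat \<Rightarrow> 'a \<Rightarrow> nat"
    and \<epsilon> :: "nat \<Rightarrow> 'a \<Rightarrow> real"
    and m :: "nat \<Rightarrow> nat"
    and V :: "nat \<Rightarrow> nat \<Rightarrow> 'a \<Rightarrow> nat"
    and \<eta> :: "nat \<Rightarrow> nat \<Rightarrow> 'a \<Rightarrow> real"
  assumes first_step: "random_sign P s (X 1)"
    and walk_time: "\<And>n. n \<ge> 1 \<Longrightarrow> uniform_upto P n (U n)"
    and walk_sign: "\<And>n. n \<ge> 1 \<Longrightarrow> random_sign P p (\<epsilon> n)"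
    and walk_step: "\<And>n \<omega>. n \<ge> 1 \<Longrightarrow> \<omega> \<in> space P \<Longrightarrow> X (n + 1) \<omega> = \<epsilon> n \<omega> * X (U n \<omega>) \<omega>"
    and array_time: "\<And>n k. m n < k \<Longrightarrow> k \<le> n \<Longrightarrow> uniform_upto P (m n) (V n k)"
    and array_sign: "\<And>n k. m n < k \<Longrightarrow> k \<le> n \<Longrightarrow> random_sign P p (\<eta> n k)"
    and sources_indep:
      "indep_vars (\<lambda>_. borel)
         (\<lambda>i. case i of
              First_Step \<Rightarrow> X 1
            | Walk_Time n \<Rightarrow> (\<lambda>\<omega>. real (U n \<omega>))
            | Walk_Sign n \<Rightarrow> \<epsilon> n
            | Array_Time n k \<Rightarrow> (\<lambda>\<omega>. real (V n k \<omega>))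
            | Array_Sign n k \<Rightarrow> \<eta> n k)
         ({First_Step} \<union> {Walk_Time n | n. n \<ge> 1} \<union> {Walk_Sign n | n. n \<ge> 1}
          \<union> {Array_Time n k | n k. m n < k \<and> k \<le> n}
          \<union> {Array_Sign n k | n k. m n < k \<and> k \<le> n})"

definition erw_W :: "(nat \<Rightarrow> 'a \<Rightarrow> real) \<Rightarrow> nat \<Rightarrow> 'a \<Rightarrow> real" where
  "erw_W X n \<omega> = (\<Sum>k=1..n. X k \<omega>)"

definition erw_Y ::
  "(nat \<Rightarrow> 'a \<Rightarrow> real) \<Rightarrow> (nat \<Rightarrow> nat) \<Rightarrow> (nat \<Rightarrow> nat \<Rightarrow> 'a \<Rightarrow> nat) \<Rightarrow> (nat \<Rightarrow> nat \<Rightarrow> 'a \<Rightarrow> real)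
    \<Rightarrow> nat \<Rightarrow> nat \<Rightarrow> 'a \<Rightarrow> real" where
  "erw_Y X m V \<eta> n k \<omega> = (if k \<le> m n then X k \<omega> else \<eta> n k \<omega> * X (V n k \<omega>) \<omega>)"

definition erw_T ::
  "(nat \<Rightarrow> 'a \<Rightarrow> real) \<Rightarrow> (nat \<Rightarrow> nat) \<Rightarrow> (nat \<Rightarrow> nat \<Rightarrow> 'a \<Rightarrow> nat) \<Rightarrow> (nat \<Rightarrow> nat \<Rightarrow> 'a \<Rightarrow> real)
    \<Rightarrow> nat \<Rightarrow> 'a \<Rightarrow> real" where
  "erw_T X m V \<eta> n \<omega> = (\<Sum>k=1..n. erw_Y X m V \<eta> n k \<omega>)"

text \<open>The second argument of \<^const>\<open>normal_density\<close> below is the standard deviation, whereas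
  \<open>centered_normal\<close> takes the variance.\<close>

definition centered_normal :: "real \<Rightarrow> real measure" where
  "centered_normal v =
     (if v = 0 then return borel 0 else density lborel (normal_density 0 (sqrt v)))"

definition conv_in_law :: "'a measure \<Rightarrow> (nat \<Rightarrow> 'a \<Rightarrow> real) \<Rightarrow> real measure \<Rightarrow> bool" where
  "conv_in_law P Z \<mu> \<longleftrightarrow> weak_conv_m (\<lambda>n. distr P borel (Z n)) \<mu>"

definition conv_as :: "'a measure \<Rightarrow> (nat \<Rightarrow> 'a \<Rightarrow> real) \<Rightarrow> ('a \<Rightarrow> real) \<Rightarrow> bool" where
  "conv_as P Z L \<longleftrightarrow> (AE \<omega> in P. (\<lambda>n. Z n \<omega>) \<longlonglongrightarrow> L \<omega>)"

definition square_integrable :: "'a measure \<Rightarrow> ('a \<Rightarrow> real) \<Rightarrow> bool" where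
  "square_integrable P Z \<longleftrightarrow> Z \<in> borel_measurable P \<and> integrable P (\<lambda>\<omega>. (Z \<omega>)\<^sup>2)"

definition conv_L2 :: "'a measure \<Rightarrow> (nat \<Rightarrow> 'a \<Rightarrow> real) \<Rightarrow> ('a \<Rightarrow> real) \<Rightarrow> bool" where
  "conv_L2 P Z L \<longleftrightarrow>
     (\<forall>n. square_integrable P (Z n)) \<and> square_integrable P L \<and>
     (\<lambda>n. \<integral>\<omega>. (Z n \<omega> - L \<omega>)\<^sup>2 \<partial>P) \<longlonglongrightarrow> 0"

end

theory Submission
  imports Defs "HOL-Real_Asymp.Real_Asymp"
begin

text \<open>
  Write \<open>W\<close> for the walk, \<open>m\<close> for \<open>m n\<close>, \<open>g = m / n\<close>, and let \<open>S\<close> be the sum over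
  \<open>m < k \<le> n\<close> of the array steps minus their conditional mean \<open>\<alpha> * W m / m\<close> given the walk. Then
  \<open>g * T = (g + \<alpha> * (1 - g)) * W m + g * S\<close> (\<open>erw_T_decomp\<close>). The first term carries the
  fluctuation of the walk itself; given the walk, \<open>S\<close> is a sum of \<open>n - m\<close> independent
  centered variables of variance \<open>1 - (\<alpha> * W m / m)\<^sup>2\<close>, which is close to \<open>1\<close>, so that
  \<open>g * S / sqrt m\<close> is asymptotically normal with variance \<open>\<gamma> * (1 - \<gamma>)\<close> and asymptotically
  independent of the walk.

  Both parts rest on one computation. A step that is a randomly signed copy of a uniformly chosen
  earlier step has conditional mean \<open>x = \<alpha> * W k / k\<close> and takes the values \<open>1\<close>, \<open>-1\<close>, so its
  conditional characteristic function is \<open>cos \<theta> + \<i> * x * sin \<theta>\<close>. Up to an error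
  \<open>\<theta>\<^sup>2 * x\<^sup>2 + 2 * \<bar>\<theta>\<bar> ^ 3\<close> this is \<open>exp (\<i> * \<theta> * x) * exp (- \<theta>\<^sup>2 / 2)\<close>
  (\<open>biased_cos_approx\<close>). The phase \<open>\<theta> * x\<close> is linear in \<open>W k\<close> and is absorbed into the weight
  given to \<open>W k\<close>; the remaining factor is deterministic. Hence the
  characteristic functions can be compared step by step, and the errors are added up
  (\<open>walk_char\<close>). The random conditional variance disappears because the expectation of \<open>x\<^sup>2\<close>
  tends to \<open>0\<close> for every \<open>\<alpha>\<close> strictly between \<open>-1\<close> and \<open>1\<close> (\<open>msq_ratio_tendsto_0\<close>).

  The weights must satisfy \<open>d k = d (k + 1) * (1 + \<alpha> / k)\<close> up to a small error, and multiples of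
  \<open>k powr (- \<alpha>)\<close> do, with relative error of order \<open>1 / k\<^sup>2\<close>. For \<open>\<alpha> \<le> 1/2\<close> the squares of these weights have a divergent sum: starting the
  comparison at time \<open>1\<close> shows that \<open>W m / m powr \<alpha>\<close>, divided by the root of that sum, is
  asymptotically standard normal (\<open>walk_clt_le_half\<close>). The sum is of order \<open>m powr (1 - 2 * \<alpha>)\<close>, or
  \<open>ln m\<close> at \<open>\<alpha> = 1/2\<close>, which produces the two normalizations. For \<open>\<alpha> > 1/2\<close> the sum converges:
  starting at time \<open>m\<close> and running to infinity compares \<open>W m\<close> with the limit variable \<open>M\<close>, and the
  variance of the difference is the tail of the convergent series
  (\<open>walk_remainder_char_bound\<close>, \<open>walk_clt_gt_half\<close>).

  For the almost sure and mean-square convergence the same conditional computation with a real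
  exponent gives the sub-Gaussian bound \<open>exp (n * l\<^sup>2 / 2)\<close> for the moment generating function of \<open>S\<close>
  (\<open>array_mgf_le\<close>). Its tail estimate is summable in \<open>n\<close>, so the Borel--Cantelli lemma applies
  to the rows (\<open>array_fluctuation_as\<close>), and it bounds the second moment of \<open>S\<close> by a multiple of \<open>n\<close>.
\<close>

section \<open>Elementary estimates\<close>

lemma cmod_iexp_diff_le: "cmod (iexp a - iexp b) \<le> \<bar>a - b\<bar>"
proof -
  have "iexp a - iexp b = iexp b * (iexp (a - b) - 1)"
    by (simp add: algebra_simps exp_add[symmetric])
  then have "cmod (iexp a - iexp b) = cmod (iexp (a - b) - 1)"
    by (simp add: norm_mult)
  also have "\<dots> \<le> \<bar>a - b\<bar>"
    using iexp_approx1[of "a - b" 0] by simp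
  finally show ?thesis .
qed

lemma exp_minus_taylor1:
  fixes u :: real
  assumes "0 \<le> u"
  shows "0 \<le> exp (-u) - 1 + u" "exp (-u) - 1 + u \<le> u" "exp (-u) - 1 + u \<le> u\<^sup>2"
proof -
  show "0 \<le> exp (-u) - 1 + u" using exp_ge_add_one_self[of "-u"] by simp
  show "exp (-u) - 1 + u \<le> u" using assms by simp
  have "1 / (1 + u) = 1 - u + u\<^sup>2 / (1 + u)"
    using assms by (simp add: field_simps power2_eq_square)
  moreover have "u\<^sup>2 / (1 + u) \<le> u\<^sup>2"
    using assms by (simp add: field_simps power2_eq_square)
  moreover have "exp (-u) \<le> 1 / (1 + u)"
    using exp_ge_add_one_self[of u] assms by (simp add: exp_minus field_simps)
  ultimately show "exp (-u) - 1 + u \<le> u\<^sup>2" by linarith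
qed

lemma cosh_iexp: "cosh (\<i> * complex_of_real \<theta>) = complex_of_real (cos \<theta>)"
  "sinh (\<i> * complex_of_real \<theta>) = \<i> * complex_of_real (sin \<theta>)"
  by (auto simp: complex_eq_iff cosh_def sinh_def Re_exp Im_exp)

text \<open>The Euclidean norm of \<open>(cos \<theta>, x * sin \<theta>)\<close>; used to telescope powers of this number.\<close>

lemma cmod_biased_cos_le:
  fixes x :: real
  assumes "\<bar>x\<bar> \<le> 1"
  shows "cmod (cosh (\<i> * of_real \<theta>) + of_real x * sinh (\<i> * of_real \<theta>)) \<le> 1"
proof -
  have "x\<^sup>2 \<le> 1" using assms by (simp add: abs_square_le_1)
  then have "(cos \<theta>)\<^sup>2 + (x * sin \<theta>)\<^sup>2 \<le> (cos \<theta>)\<^sup>2 + (sin \<theta>)\<^sup>2"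
    unfolding power_mult_distrib by (intro add_left_mono mult_left_le_one_le) auto
  then show ?thesis
    unfolding cosh_iexp by (simp add: cmod_def)
qed

text \<open>The left-hand term is the characteristic function at \<open>\<theta>\<close> of a sign with mean \<open>x\<close>. Its variance is
  \<open>1 - x\<^sup>2\<close>, but it is compared with a normal law of mean \<open>x\<close> and variance \<open>1\<close>: the discrepancy
  is the term \<open>\<theta>\<^sup>2 * x\<^sup>2\<close>, and in exchange the Gaussian factor does not depend on \<open>x\<close>. Everything else is
  a third-order Taylor remainder.\<close>

lemma biased_cos_approx:
  fixes x \<theta> :: real
  assumes x: "\<bar>x\<bar> \<le> 1"
  shows "cmod (cosh (\<i> * of_real \<theta>) + of_real x * sinh (\<i> * of_real \<theta>)
           - iexp (\<theta> * x) * of_real (exp (- \<theta>\<^sup>2 / 2))) \<le> \<theta>\<^sup>2 * x\<^sup>2 + 2 * \<bar>\<theta>\<bar> ^ 3"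
proof -
  define u where "u = \<theta>\<^sup>2 / 2"
  have u: "0 \<le> u" by (simp add: u_def)
  have eu: "exp (- \<theta>\<^sup>2 / 2) = exp (- u)" by (simp add: u_def)
  have t3: "\<theta>\<^sup>2 * \<bar>\<theta>\<bar> = \<bar>\<theta>\<bar> ^ 3" by (simp add: power3_eq_cube power2_eq_square)
  have A: "cmod (iexp \<theta> - (1 + \<i> * \<theta> - of_real u)) \<le> \<bar>\<theta>\<bar> ^ 3 / 6"
    using iexp_approx1[of \<theta> 2]
    by (simp add: eval_nat_numeral u_def power_mult_distrib algebra_simps fact_numeral)
  have c: "\<bar>cos \<theta> - 1 + u\<bar> \<le> \<bar>\<theta>\<bar> ^ 3 / 6"
  proof -
    have "cos \<theta> - 1 + u = Re (iexp \<theta> - (1 + \<i> * \<theta> - of_real u))" by (simp add: Re_exp)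
    then show ?thesis
      using order_trans[OF abs_Re_le_cmod A] by (simp only:)
  qed
  have s: "\<bar>sin \<theta> - \<theta>\<bar> \<le> \<bar>\<theta>\<bar> ^ 3 / 6"
    using abs_Im_le_cmod[of "iexp \<theta> - (1 + \<i> * \<theta> - of_real u)"] A by (simp add: Im_exp)
  have B: "cmod (iexp (\<theta> * x) - (1 + \<i> * of_real (\<theta> * x))) \<le> (\<theta> * x)\<^sup>2 / 2"
    using iexp_approx1[of "\<theta> * x" 1] by (simp add: eval_nat_numeral algebra_simps)
  \<comment> \<open>A cubic bound for all \<open>\<theta>\<close>: of second order in \<open>u\<close> near \<open>0\<close>, linear in \<open>u\<close> far away.\<close>
  have e: "\<bar>exp (-u) - 1 + u\<bar> \<le> \<bar>\<theta>\<bar> ^ 3 / 2"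
  proof (cases "\<bar>\<theta>\<bar> \<le> 1")
    case True
    have "u\<^sup>2 = \<bar>\<theta>\<bar> ^ 3 * \<bar>\<theta>\<bar> / 4"
      by (simp add: u_def power2_eq_square power3_eq_cube)
    also have "\<dots> \<le> \<bar>\<theta>\<bar> ^ 3 * 1 / 4"
      using True by (intro divide_right_mono mult_left_mono) auto
    finally show ?thesis
      using exp_minus_taylor1[OF u] zero_le_power[of "\<bar>\<theta>\<bar>" 3] by linarith
  next
    case False
    have "u = \<bar>\<theta>\<bar>\<^sup>2 * 1 / 2" by (simp add: u_def)
    also have "\<dots> \<le> \<bar>\<theta>\<bar>\<^sup>2 * \<bar>\<theta>\<bar> / 2"
      using False by (intro divide_right_mono mult_left_mono) auto
    finally have "u \<le> \<bar>\<theta>\<bar> ^ 3 / 2" using t3 by simp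
    then show ?thesis
      using exp_minus_taylor1[OF u] by (simp only: abs_of_nonneg)
  qed
  have e1: "\<bar>exp (-u) - 1\<bar> \<le> u" "exp (-u) \<le> 1"
    using exp_minus_taylor1[OF u] u by auto
  let ?D = "cosh (\<i> * of_real \<theta>) + of_real x * sinh (\<i> * of_real \<theta>)
           - iexp (\<theta> * x) * of_real (exp (- \<theta>\<^sup>2 / 2))"
  have alg: "C + x' * (\<i> * S) - E * G = (C - 1 + u') + \<i> * (x' * (S - t))
      - (E - (1 + \<i> * (t * x'))) * G - (G - 1 + u') - \<i> * (t * x' * (G - 1))"
    for C x' S E G u' t :: complex
    by (simp add: algebra_simps)
  have "?D = of_real (cos \<theta> - 1 + u) + \<i> * of_real (x * (sin \<theta> - \<theta>))
      - (iexp (\<theta> * x) - (1 + \<i> * of_real (\<theta> * x))) * of_real (exp (-u))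
      - of_real (exp (-u) - 1 + u) - \<i> * of_real (\<theta> * x * (exp (-u) - 1))"
    using alg[of "of_real (cos \<theta>)" "of_real x" "of_real (sin \<theta>)" "iexp (\<theta> * x)" "of_real (exp (- u))"
        "of_real u" "of_real \<theta>"]
    by (simp only: cosh_iexp eu of_real_add of_real_diff of_real_mult of_real_1)
  then have "cmod ?D \<le> cmod (of_real (cos \<theta> - 1 + u)) + cmod (\<i> * of_real (x * (sin \<theta> - \<theta>)))
      + cmod ((iexp (\<theta> * x) - (1 + \<i> * of_real (\<theta> * x))) * of_real (exp (-u)))
      + cmod (of_real (exp (-u) - 1 + u)) + cmod (\<i> * of_real (\<theta> * x * (exp (-u) - 1)))"
    by (simp only:) (intro norm_triangle_le_diff norm_triangle_le add_mono order_refl)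
  also have "\<dots> \<le> \<bar>\<theta>\<bar> ^ 3 / 6 + 1 * (\<bar>\<theta>\<bar> ^ 3 / 6) + (\<theta> * x)\<^sup>2 / 2 * 1 + \<bar>\<theta>\<bar> ^ 3 / 2 + \<bar>\<theta>\<bar> * 1 * u"
  proof (intro add_mono)
    have "\<bar>x\<bar> * \<bar>sin \<theta> - \<theta>\<bar> \<le> 1 * (\<bar>\<theta>\<bar> ^ 3 / 6)"
      using x s by (intro mult_mono) auto
    then show "cmod (\<i> * of_real (x * (sin \<theta> - \<theta>))) \<le> 1 * (\<bar>\<theta>\<bar> ^ 3 / 6)"
      by (simp only: norm_mult norm_of_real abs_mult norm_ii mult_1_left)
    have "\<bar>\<theta>\<bar> * \<bar>x\<bar> * \<bar>exp (-u) - 1\<bar> \<le> \<bar>\<theta>\<bar> * 1 * u"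
      using x e1 by (intro mult_mono) auto
    then show "cmod (\<i> * of_real (\<theta> * x * (exp (-u) - 1))) \<le> \<bar>\<theta>\<bar> * 1 * u"
      by (simp only: norm_mult norm_of_real abs_mult norm_ii mult_1_left)
    show "cmod ((iexp (\<theta> * x) - (1 + \<i> * of_real (\<theta> * x))) * of_real (exp (-u))) \<le> (\<theta> * x)\<^sup>2 / 2 * 1"
      unfolding norm_mult[of "_ - _"] norm_of_real abs_exp_cancel
      by (rule mult_mono[OF B e1(2)]) auto
  qed (use c e in \<open>simp_all only: norm_of_real\<close>)
  also have "\<dots> \<le> \<theta>\<^sup>2 * x\<^sup>2 + 2 * \<bar>\<theta>\<bar> ^ 3"
  proof -
    have "\<bar>\<theta>\<bar> * 1 * u = \<bar>\<theta>\<bar> ^ 3 / 2" using t3 by (simp add: u_def mult.commute)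
    moreover have "0 \<le> \<theta>\<^sup>2 * x\<^sup>2" "0 \<le> \<bar>\<theta>\<bar> ^ 3" by simp_all
    ultimately show ?thesis unfolding power_mult_distrib by linarith
  qed
  finally show ?thesis .
qed

text \<open>Hoeffding's lemma for a sign with mean \<open>x\<close>. Centered, such a sign takes two values at distance
  \<open>2\<close>, which after substituting \<open>q = (1 + x) / 2\<close> for the probability of \<open>1\<close> is the library's
  estimate at \<open>2 * l\<close>.\<close>

lemma biased_cosh_le:
  fixes x l :: real
  assumes x: "\<bar>x\<bar> \<le> 1"
  shows "exp (- l * x) * (cosh l + x * sinh l) \<le> exp (l\<^sup>2 / 2)"
proof -
  have *: "exp (- l * x) * (cosh l + x * sinh l) \<le> exp (l\<^sup>2 / 2)"
    if x: "\<bar>x\<bar> \<le> 1" and l: "l \<ge> 0" for x l :: real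
  proof -
    define q where "q = (1 + x) / 2"
    have q: "0 \<le> q" using x by (simp add: q_def)
    have pos: "0 < 1 + q * (exp (2 * l) - 1)"
      using q l by (intro add_pos_nonneg mult_nonneg_nonneg) auto
    have "cosh l + x * sinh l = exp (- l) * (1 + q * (exp l * exp l - 1))"
      by (simp add: cosh_def sinh_def q_def exp_minus field_simps)
    also have "exp l * exp l = exp (2 * l)"
      by (simp add: exp_add[symmetric])
    also have "exp (- l) * (1 + q * (exp (2 * l) - 1)) = exp (- l) * exp (ln (1 + q * (exp (2 * l) - 1)))"
      using pos by simp
    finally have "exp (- l * x) * (cosh l + x * sinh l)
        = exp (- l * x + (- l + ln (1 + q * (exp (2 * l) - 1))))" (is "_ = exp ?L")
      by (simp only: exp_add)
    also have "?L = - (2 * l) * q + ln (1 + q * (exp (2 * l) - 1))"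
      by (simp add: q_def field_simps)
    also have "exp \<dots> \<le> exp ((2 * l)\<^sup>2 / 8)"
      using Hoeffdings_lemma_aux[of "2 * l" q] q l by (intro exp_mono) auto
    finally show ?thesis by (simp add: power_mult_distrib)
  qed
  show ?thesis
    using *[OF x, of l] *[of "-x" "-l"] x by (cases "l \<ge> 0") auto
qed

lemma powr_Bernoulli:
  fixes x \<rho> :: real
  assumes x: "0 \<le> x" and \<rho>: "1 \<le> \<rho>"
  shows "1 + \<rho> * x \<le> (1 + x) powr \<rho>"
proof -
  have "(1 + 0) powr \<rho> - \<rho> * 0 \<le> (1 + x) powr \<rho> - \<rho> * x"
  proof (rule DERIV_nonneg_imp_nondecreasing[OF x])
    fix y :: real assume y: "0 \<le> y"
    have "((\<lambda>x. (1 + x) powr \<rho> - \<rho> * x) has_real_derivative \<rho> * ((1 + y) powr (\<rho> - 1) - 1)) (at y)"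
      using y by (auto intro!: derivative_eq_intros simp: algebra_simps)
    moreover have "0 \<le> \<rho> * ((1 + y) powr (\<rho> - 1) - 1)"
      using \<rho> y by (intro mult_nonneg_nonneg) (auto simp: ge_one_powr_ge_zero)
    ultimately show "\<exists>z. ((\<lambda>x. (1 + x) powr \<rho> - \<rho> * x) has_real_derivative z) (at y) \<and> 0 \<le> z"
      by blast
  qed
  then show ?thesis by simp
qed

text \<open>Second-order Taylor bound, obtained from monotonicity: the derivative of the left-hand difference
  is at most \<open>2 * y\<close> in absolute value, because \<open>(1 + y) powr (a - 1)\<close> lies between \<open>(1 + y) powr (-2)\<close> and \<open>1\<close>.\<close>

lemma powr_taylor2:
  fixes x a :: real
  assumes x: "0 \<le> x" and a: "\<bar>a\<bar> \<le> 1"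
  shows "\<bar>(1 + x) powr a - 1 - a * x\<bar> \<le> x\<^sup>2"
proof -
  have D: "\<bar>a * ((1 + y) powr (a - 1) - 1)\<bar> \<le> 2 * y" if y: "0 \<le> y" for y
  proof -
    have "(1 + y) powr (a - 1) \<le> (1 + y) powr 0"
      using a y by (intro powr_mono) auto
    moreover have "1 - 2 * y \<le> (1 + y) powr (-2)"
    proof -
      have "(1 - 2 * y) * (1 + y)\<^sup>2 \<le> 1"
        using y by (simp add: power2_eq_square algebra_simps)
      then show ?thesis
        using y by (simp add: powr_minus_divide pos_le_divide_eq)
    qed
    moreover have "(1 + y) powr (-2) \<le> (1 + y) powr (a - 1)"
      using a y by (intro powr_mono) auto
    ultimately have "\<bar>(1 + y) powr (a - 1) - 1\<bar> \<le> 2 * y"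
      using y by simp
    then have "\<bar>a\<bar> * \<bar>(1 + y) powr (a - 1) - 1\<bar> \<le> 1 * (2 * y)"
      using a by (intro mult_mono) auto
    then show ?thesis by (simp add: abs_mult)
  qed
  have "0\<^sup>2 + c * ((1 + 0) powr a - 1 - a * 0) \<le> x\<^sup>2 + c * ((1 + x) powr a - 1 - a * x)"
    if c: "c \<in> {1, -1}" for c
  proof (rule DERIV_nonneg_imp_nondecreasing[OF x])
    fix y :: real assume y: "0 \<le> y"
    have "((\<lambda>x. x\<^sup>2 + c * ((1 + x) powr a - 1 - a * x)) has_real_derivative
        2 * y + c * (a * ((1 + y) powr (a - 1) - 1))) (at y)"
      using y by (auto intro!: derivative_eq_intros simp: algebra_simps)
    moreover have "0 \<le> 2 * y + c * (a * ((1 + y) powr (a - 1) - 1))"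
      using D[OF y] c by auto
    ultimately show "\<exists>z. ((\<lambda>x. x\<^sup>2 + c * ((1 + x) powr a - 1 - a * x)) has_real_derivative z) (at y) \<and> 0 \<le> z"
      by blast
  qed
  from this[of 1] this[of "-1"] show ?thesis by (simp add: abs_le_iff)
qed

text \<open>A function of a sign is affine in it. This turns a statement about the conditional mean of a
  step into one about all its exponential moments, real or imaginary.\<close>

lemma exp_sign:
  fixes z :: "'b::{real_normed_field, banach}"
  assumes "y \<in> {1, -1}"
  shows "exp (z * of_real y) = cosh z + of_real y * sinh z"
  using assms by (auto simp: cosh_plus_sinh cosh_minus_sinh)

section \<open>Sums of powers\<close>

text \<open>The Stolz--Cesaro theorem: past some index, \<open>a - L * b\<close> varies by at most a small multiple of the
  variation of \<open>b\<close>, hence is small compared with \<open>b\<close>.\<close>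

lemma stolz_cesaro:
  fixes a b :: "nat \<Rightarrow> real"
  assumes b: "filterlim b at_top sequentially"
    and inc: "\<forall>\<^sub>F n in sequentially. b n < b (Suc n)"
    and lim: "(\<lambda>n. (a (Suc n) - a n) / (b (Suc n) - b n)) \<longlonglongrightarrow> L"
  shows "(\<lambda>n. a n / b n) \<longlonglongrightarrow> L"
proof (rule tendstoI)
  fix e :: real assume e: "e > 0"
  define c where "c n = a n - L * b n" for n
  have "\<forall>\<^sub>F n in sequentially. \<bar>(a (Suc n) - a n) / (b (Suc n) - b n) - L\<bar> < e / 3"
    using tendstoD[OF lim, of "e / 3"] e by (simp add: dist_real_def)
  then have "\<forall>\<^sub>F n in sequentially. \<bar>c (Suc n) - c n\<bar> \<le> e / 3 * (b (Suc n) - b n)"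
    using inc
  proof eventually_elim
    case (elim n)
    have "c (Suc n) - c n = ((a (Suc n) - a n) / (b (Suc n) - b n) - L) * (b (Suc n) - b n)"
      using elim by (simp add: c_def field_simps)
    then show ?case
      using elim by (simp add: abs_mult mult_right_mono less_imp_le)
  qed
  then obtain N where N: "\<And>n. n \<ge> N \<Longrightarrow> \<bar>c (Suc n) - c n\<bar> \<le> e / 3 * (b (Suc n) - b n)"
    by (auto simp: eventually_sequentially)
  have cN: "\<bar>c n - c N\<bar> \<le> e / 3 * (b n - b N)" if "n \<ge> N" for n
    using that
  proof (induction n rule: dec_induct)
    case (step n)
    have "\<bar>c (Suc n) - c N\<bar> \<le> \<bar>c (Suc n) - c n\<bar> + \<bar>c n - c N\<bar>" by simp
    then show ?case using step.IH N[OF step.hyps(1)] by (simp add: algebra_simps)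
  qed simp
  have "\<forall>\<^sub>F n in sequentially. b n > 0 \<and> b n > 3 * \<bar>c N\<bar> / e \<and> b n > \<bar>b N\<bar>"
    using b by (simp add: filterlim_at_top_dense eventually_conj_iff)
  then show "\<forall>\<^sub>F n in sequentially. dist (a n / b n) L < e"
    using eventually_ge_at_top[of N]
  proof eventually_elim
    case (elim n)
    have "a n / b n - L = c n / b n" using elim by (simp add: c_def field_simps)
    moreover have "\<bar>c n\<bar> < e * b n"
    proof -
      have "\<bar>c n\<bar> \<le> \<bar>c N\<bar> + e / 3 * (b n - b N)" using cN[of n] elim by linarith
      also have "e / 3 * (b n - b N) \<le> e / 3 * (2 * b n)"
        using elim e by (intro mult_left_mono) auto
      also have "\<bar>c N\<bar> < e / 3 * b n"
        using elim e by (simp add: field_simps)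
      finally show ?thesis by simp
    qed
    ultimately show ?case using elim by (simp add: dist_real_def field_simps)
  qed
qed

lemma powr_neg_diff_bounds:
  fixes x \<delta> :: real
  assumes x: "x > 0" and \<delta>: "\<delta> > 0"
  shows "\<delta> * (x + 1) powr (- \<delta> - 1) \<le> x powr (- \<delta>) - (x + 1) powr (- \<delta>)"
    and "x powr (- \<delta>) - (x + 1) powr (- \<delta>) \<le> \<delta> * x powr (- \<delta> - 1)"
proof -
  have "\<exists>z. x < z \<and> z < x + 1
      \<and> (x + 1) powr (- \<delta>) - x powr (- \<delta>) = (x + 1 - x) * (- \<delta> * z powr (- \<delta> - 1))"
    by (rule MVT2) (use x in \<open>auto intro!: derivative_eq_intros\<close>)
  then obtain z where z: "x < z" "z < x + 1"
      "(x + 1) powr (- \<delta>) - x powr (- \<delta>) = (x + 1 - x) * (- \<delta> * z powr (- \<delta> - 1))"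
    by blast
  have "\<delta> * (x + 1) powr (- \<delta> - 1) \<le> \<delta> * z powr (- \<delta> - 1)"
    using \<delta> x z by (intro mult_left_mono powr_mono2') auto
  then show "\<delta> * (x + 1) powr (- \<delta> - 1) \<le> x powr (- \<delta>) - (x + 1) powr (- \<delta>)"
    using z(3) by simp
  have "\<delta> * z powr (- \<delta> - 1) \<le> \<delta> * x powr (- \<delta> - 1)"
    using \<delta> x z by (intro mult_left_mono powr_mono2') auto
  then show "x powr (- \<delta>) - (x + 1) powr (- \<delta>) \<le> \<delta> * x powr (- \<delta> - 1)"
    using z(3) by simp
qed

lemma sum_powr_tail_bounds:
  fixes \<delta> :: real
  assumes k: "k \<ge> 1" and kN: "k \<le> N" and \<delta>: "\<delta> > 0"
  shows "(\<Sum>j=k..<N. real (Suc j) powr (- \<delta> - 1)) \<le> (real k powr (- \<delta>) - real N powr (- \<delta>)) / \<delta>"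
    and "(real (Suc k) powr (- \<delta>) - real (Suc N) powr (- \<delta>)) / \<delta> \<le> (\<Sum>j=k..<N. real (Suc j) powr (- \<delta> - 1))"
  using kN
proof (induction N rule: dec_induct)
  case (step N)
  {
    case 1
    show ?case
      using powr_neg_diff_bounds(1)[of "real N" \<delta>] step k \<delta> by (simp add: field_simps)
  next
    case 2
    show ?case
      using powr_neg_diff_bounds(2)[of "real (Suc N)" \<delta>] step k \<delta> by (simp add: field_simps)
  }
qed auto

section \<open>Convergence in law and square-integrability\<close>

text \<open>The point mass in the degenerate case \<open>v = 0\<close> obeys the same formula; it occurs in the limit laws,
  for instance when \<open>\<alpha> = 0\<close> and \<open>\<gamma> = 0\<close>.\<close>

lemma char_centered_normal:
  assumes "0 \<le> v"
  shows "real_distribution (centered_normal v)" "char (centered_normal v) t = of_real (exp (- (v * t\<^sup>2) / 2))"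
proof -
  have "real_distribution (centered_normal v) \<and> char (centered_normal v) t = of_real (exp (- (v * t\<^sup>2) / 2))"
  proof (cases "v = 0")
    case True
    have "real_distribution (return borel (0::real))"
      by (auto simp: real_distribution_def real_distribution_axioms_def prob_space_return)
    moreover have "char (return borel 0) t = 1"
      unfolding char_def by (subst integral_return) auto
    ultimately show ?thesis using True by (simp add: centered_normal_def)
  next
    case False
    then have v: "sqrt v > 0" using assms by simp
    interpret N: prob_space "density lborel (normal_density 0 (sqrt v))"
      by (rule prob_space_normal_density[OF v])
    let ?N = "density lborel (normal_density 0 (sqrt v))"
    have "distributed ?N lborel (\<lambda>x. x) (normal_density 0 (sqrt v))"
      by (auto simp: distributed_def distr_id2)
    then have "distributed ?N lborel (\<lambda>x. (x - 0) / sqrt v) std_normal_density"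
      using N.normal_standard_normal_convert[OF v, of "\<lambda>x. x" 0] by blast
    then have d: "distr ?N lborel (\<lambda>x. x / sqrt v) = std_normal_distribution"
      by (simp add: distributed_def)
    have "char ?N t = (\<integral>x. iexp ((t * sqrt v) * (x / sqrt v)) \<partial>?N)"
      unfolding char_def using v by simp
    also have "\<dots> = (\<integral>x. iexp ((t * sqrt v) * x) \<partial>distr ?N lborel (\<lambda>x. x / sqrt v))"
      by (subst integral_distr) auto
    also have "\<dots> = char std_normal_distribution (t * sqrt v)"
      unfolding d char_def ..
    also have "\<dots> = of_real (exp (- (v * t\<^sup>2) / 2))"
      unfolding char_std_normal_distribution using assms by (simp add: power_mult_distrib mult.commute)
    finally have "char ?N t = of_real (exp (- (v * t\<^sup>2) / 2))" .
    moreover have "real_distribution ?N"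
      using N.prob_space_axioms by (auto simp: real_distribution_def real_distribution_axioms_def)
    ultimately show ?thesis using False by (simp add: centered_normal_def)
  qed
  then show "real_distribution (centered_normal v)" "char (centered_normal v) t = of_real (exp (- (v * t\<^sup>2) / 2))"
    by auto
qed

lemma (in prob_space) conv_in_law_normalI:
  assumes Z: "\<And>n. Z n \<in> borel_measurable M" and v: "0 \<le> v"
    and lim: "\<And>t. (\<lambda>n. \<integral>\<omega>. iexp (t * Z n \<omega>) \<partial>M) \<longlonglongrightarrow> of_real (exp (- (v * t\<^sup>2) / 2))"
  shows "conv_in_law M Z (centered_normal v)"
  unfolding conv_in_law_def
proof (rule levy_continuity)
  show "real_distribution (distr M borel (Z n))" for n
    using Z prob_space_distr[OF Z] by (auto simp: real_distribution_def real_distribution_axioms_def)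
  have "char (distr M borel (Z n)) t = (\<integral>\<omega>. iexp (t * Z n \<omega>) \<partial>M)" for n t
    unfolding char_def using Z by (subst integral_distr) auto
  then show "(\<lambda>n. char (distr M borel (Z n)) t) \<longlonglongrightarrow> char (centered_normal v) t" for t
    using lim by (simp add: char_centered_normal(2)[OF v])
qed (rule char_centered_normal(1)[OF v])

lemma square_integrable_add:
  assumes "square_integrable P f" "square_integrable P g"
  shows "square_integrable P (\<lambda>\<omega>. f \<omega> + g \<omega>)"
proof -
  have [measurable]: "f \<in> borel_measurable P" "g \<in> borel_measurable P"
    and i: "integrable P (\<lambda>\<omega>. (f \<omega>)\<^sup>2)" "integrable P (\<lambda>\<omega>. (g \<omega>)\<^sup>2)"
    using assms by (auto simp: square_integrable_def)
  have "integrable P (\<lambda>\<omega>. (f \<omega> + g \<omega>)\<^sup>2)"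
  proof (rule Bochner_Integration.integrable_bound)
    show "integrable P (\<lambda>\<omega>. 2 * (f \<omega>)\<^sup>2 + 2 * (g \<omega>)\<^sup>2)" using i by auto
    have "(a + b)\<^sup>2 \<le> 2 * a\<^sup>2 + 2 * b\<^sup>2" for a b :: real
      using sum_squares_bound[of a b] by (simp add: power2_sum)
    then show "AE \<omega> in P. norm ((f \<omega> + g \<omega>)\<^sup>2) \<le> norm (2 * (f \<omega>)\<^sup>2 + 2 * (g \<omega>)\<^sup>2)"
      by (auto intro!: AE_I2 order_trans[OF _ abs_ge_self])
  qed measurable
  then show ?thesis by (simp add: square_integrable_def)
qed

lemma square_integrable_mult:
  assumes "square_integrable P f"
  shows "square_integrable P (\<lambda>\<omega>. c * f \<omega>)"
  using assms by (auto simp: square_integrable_def power_mult_distrib)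

lemma integral_lincomb3:
  fixes f g h :: "'a \<Rightarrow> real"
  assumes "integrable P f" "integrable P g" "integrable P h"
  shows "(\<integral>\<omega>. 3 * (a * f \<omega> + b * g \<omega> + c * h \<omega>) \<partial>P)
    = 3 * (a * (\<integral>\<omega>. f \<omega> \<partial>P) + b * (\<integral>\<omega>. g \<omega> \<partial>P) + c * (\<integral>\<omega>. h \<omega> \<partial>P))"
  using assms by simp

section \<open>Functions of disjoint sets of sources\<close>

text \<open>The locale of the definitions together with the standing hypotheses of the theorem that do not
  concern limits.\<close>

locale elephant_array = erw_triangular_array P p s X U \<epsilon> m V \<eta>
  for P :: "'a measure" and p s X U \<epsilon> m V \<eta> +
  fixes \<alpha> :: real
  assumes p: "p \<in> {0<..<1}"
    and alpha: "\<alpha> = 2 * p - 1"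
    and m_bounds: "\<And>n. n \<ge> 1 \<Longrightarrow> 1 \<le> m n \<and> m n \<le> n"
begin

lemma abs_alpha_less_1: "\<bar>\<alpha>\<bar> < 1"
  using p unfolding alpha by auto

definition source :: "erw_source \<Rightarrow> 'a \<Rightarrow> real" where
  "source i = (case i of
      First_Step \<Rightarrow> X 1
    | Walk_Time n \<Rightarrow> (\<lambda>\<omega>. real (U n \<omega>))
    | Walk_Sign n \<Rightarrow> \<epsilon> n
    | Array_Time n k \<Rightarrow> (\<lambda>\<omega>. real (V n k \<omega>))
    | Array_Sign n k \<Rightarrow> \<eta> n k)"

definition sources :: "erw_source set" where
  "sources = {First_Step} \<union> {Walk_Time n | n. n \<ge> 1} \<union> {Walk_Sign n | n. n \<ge> 1}
     \<union> {Array_Time n k | n k. m n < k \<and> k \<le> n}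
     \<union> {Array_Sign n k | n k. m n < k \<and> k \<le> n}"

lemma indep_sources: "indep_vars (\<lambda>_. borel) source sources"
  using sources_indep unfolding source_def[abs_def] sources_def .

text \<open>The sigma-algebra generated by the sources in \<open>A\<close>. Measurability with respect to it
  expresses that a quantity depends on these sources only.\<close>

definition info :: "erw_source set \<Rightarrow> 'a measure" where
  "info A = sigma (space P) (\<Union>i\<in>A. {source i -` B \<inter> space P | B. B \<in> sets borel})"

lemma space_info [simp]: "space (info A) = space P"
  unfolding info_def by (rule space_measure_of) auto

lemma sets_info:
  "sets (info A) = sigma_sets (space P) (\<Union>i\<in>A. {source i -` B \<inter> space P | B. B \<in> sets borel})"
  unfolding info_def by (rule sets_measure_of) auto

lemma measurable_info_source: "i \<in> A \<Longrightarrow> source i \<in> borel_measurable (info A)"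
  by (rule measurableI) (auto simp: sets_info intro!: sigma_sets.Basic)

lemma measurable_info_mono:
  assumes "A \<subseteq> B" "f \<in> measurable (info A) N"
  shows "f \<in> measurable (info B) N"
proof -
  have "sets (info A) \<subseteq> sets (info B)"
    unfolding sets_info by (rule sigma_sets_subseteq) (use assms(1) in blast)
  then show ?thesis
    using assms(2) by (auto simp: measurable_def)
qed

lemma source_measurable: "i \<in> sources \<Longrightarrow> source i \<in> borel_measurable P"
  using indep_sources by (simp add: indep_vars_def)

lemma measurable_info_P:
  assumes "A \<subseteq> sources" "f \<in> measurable (info A) N"
  shows "f \<in> measurable P N"
proof -
  have "sets (info A) \<subseteq> sets P"
    unfolding sets_info
    by (rule sets.sigma_sets_subset)
       (use assms(1) in \<open>auto intro!: measurable_sets[OF source_measurable]\<close>)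
  then show ?thesis
    using assms(2) by (auto simp: measurable_def)
qed

text \<open>Grouping: families of independent sources indexed by disjoint sets generate independent
  sigma-algebras.\<close>

lemma expectation_mult_info:
  fixes f g :: "'a \<Rightarrow> 'b::{real_normed_field, banach, second_countable_topology}"
  assumes A: "A \<subseteq> sources" and B: "B \<subseteq> sources" and AB: "A \<inter> B = {}"
    and f: "f \<in> borel_measurable (info A)" "integrable P f"
    and g: "g \<in> borel_measurable (info B)" "integrable P g"
  shows "(\<integral>\<omega>. f \<omega> * g \<omega> \<partial>P) = (\<integral>\<omega>. f \<omega> \<partial>P) * (\<integral>\<omega>. g \<omega> \<partial>P)"
proof -
  let ?E = "\<lambda>i. {source i -` B \<inter> space P | B. B \<in> sets borel}"
  have ind: "indep_sets ?E sources"
    using indep_sources unfolding indep_vars_def2 by blast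
  have "indep_sets (\<lambda>b. sigma_sets (space P) (\<Union>i\<in>case_bool A B b. ?E i)) UNIV"
  proof (rule indep_sets_collect_sigma)
    show "indep_sets ?E (\<Union>j\<in>UNIV. case_bool A B j)"
      by (rule indep_sets_mono_index[OF _ ind]) (use A B in \<open>auto split: bool.splits\<close>)
    show "Int_stable (?E i)" for i
      unfolding Int_stable_def
    proof (safe)
      fix S T :: "real set" assume "S \<in> sets borel" "T \<in> sets borel"
      then show "\<exists>W. source i -` S \<inter> space P \<inter> (source i -` T \<inter> space P) = source i -` W \<inter> space P \<and> W \<in> sets borel"
        by (intro exI[of _ "S \<inter> T"]) auto
    qed
    show "disjoint_family_on (case_bool A B) UNIV"
      using AB by (auto simp: disjoint_family_on_def split: bool.splits)
  qed
  then have *: "indep_set (sets (info A)) (sets (info B))"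
    unfolding indep_set_def sets_info by (rule indep_sets_mono_sets) (auto split: bool.splits)
  have "indep_var borel f borel g"
    unfolding indep_var_eq
  proof (intro conjI)
    show "random_variable borel f" "random_variable borel g"
      using f g by auto
    have "sigma_sets (space P) {h -` C \<inter> space P | C. C \<in> sets borel} \<subseteq> sets (info D)"
      if "h \<in> borel_measurable (info D)" for h :: "'a \<Rightarrow> 'b" and D
      using sets.sigma_sets_subset[of "{h -` C \<inter> space P | C. C \<in> sets borel}" "info D"]
        measurable_sets[OF that] by auto
    from this[OF f(1)] this[OF g(1)] *
    show "indep_set (sigma_sets (space P) {f -` A \<inter> space P |A. A \<in> sets borel})
           (sigma_sets (space P) {g -` A \<inter> space P |A. A \<in> sets borel})"
      unfolding indep_sets2_eq by blast
  qed
  from indep_var_lebesgue_integral[OF this f(2) g(2)] show ?thesis .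
qed

lemma X_values:
  assumes "k \<ge> 1" "\<omega> \<in> space P"
  shows "X k \<omega> \<in> {1, -1}"
  using assms(1)
proof (induction k rule: less_induct)
  case (less k)
  show ?case
  proof (cases "k = 1")
    case True
    then show ?thesis using first_step assms(2) by (auto simp: random_sign_def)
  next
    case False
    then obtain n where n: "k = n + 1" "n \<ge> 1"
      using less.prems by (intro that[of "k - 1"]) auto
    have U: "U n \<omega> \<in> {1..n}" and e: "\<epsilon> n \<omega> \<in> {1, -1}"
      using walk_time[OF n(2)] walk_sign[OF n(2)] assms(2)
      by (auto simp: uniform_upto_def random_sign_def)
    have "X (U n \<omega>) \<omega> \<in> {1, -1}"
      by (rule less.IH) (use U n in auto)
    then show ?thesis
      using e walk_step[OF n(2) assms(2)] n(1) by auto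
  qed
qed

lemma abs_X: "k \<ge> 1 \<Longrightarrow> \<omega> \<in> space P \<Longrightarrow> \<bar>X k \<omega>\<bar> = 1"
  using X_values[of k \<omega>] by auto

lemma abs_W_le:
  assumes "\<omega> \<in> space P"
  shows "\<bar>erw_W X n \<omega>\<bar> \<le> n"
proof -
  have "\<bar>erw_W X n \<omega>\<bar> \<le> (\<Sum>k=1..n. \<bar>X k \<omega>\<bar>)"
    unfolding erw_W_def by (rule sum_abs)
  also have "\<dots> = (\<Sum>k=1..n. 1)"
    by (rule sum.cong) (auto simp: abs_X assms)
  finally show ?thesis by simp
qed

lemma integral_random_sign:
  assumes "random_sign P p E"
  shows "(\<integral>\<omega>. E \<omega> \<partial>P) = \<alpha>" "integrable P E"
proof -
  have [measurable]: "E \<in> borel_measurable P" and E: "\<And>\<omega>. \<omega> \<in> space P \<Longrightarrow> E \<omega> \<in> {1, -1}"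
    and q: "\<P>(\<omega> in P. E \<omega> = 1) = p"
    using assms by (auto simp: random_sign_def)
  have "(\<integral>\<omega>. E \<omega> \<partial>P) = (\<integral>\<omega>. 2 * indicator {\<omega>\<in>space P. E \<omega> = 1} \<omega> - 1 \<partial>P)"
    by (rule Bochner_Integration.integral_cong) (use E in \<open>auto simp: indicator_def\<close>)
  also have "\<dots> = 2 * p - 1"
    by (subst Bochner_Integration.integral_diff) (auto simp: prob_space q less_top[symmetric])
  finally show "(\<integral>\<omega>. E \<omega> \<partial>P) = \<alpha>" by (simp add: alpha)
  show "integrable P E"
    by (rule integrable_const_bound[where B=1]) (use E in fastforce)+
qed

text \<open>Conditional mean of a recalled step, in the form tested against a bounded \<open>Z\<close>. Splitting by the
  recalled time \<open>k\<close>, the product of the sign with the indicator of \<open>R = k\<close> has mean \<open>\<alpha> / N\<close> and is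
  independent of \<open>Z * X k\<close>. The lemma serves the steps of the walk and those of the array alike, and the
  value type is left open to cover the real and the complex case.\<close>

lemma expectation_recall:
  fixes Z :: "'a \<Rightarrow> 'b::{real_normed_field, banach, second_countable_topology}"
  assumes A: "A \<subseteq> sources" and i: "i \<in> sources - A" and j: "j \<in> sources - A" and ij: "i \<noteq> j"
    and R: "source i = (\<lambda>\<omega>. real (R \<omega>))" "uniform_upto P N R"
    and E: "source j = E" "random_sign P p E"
    and N: "N \<ge> 1"
    and x: "\<And>k. k \<in> {1..N} \<Longrightarrow> X k \<in> borel_measurable (info A)"
    and Z: "Z \<in> borel_measurable (info A)" "\<And>\<omega>. \<omega> \<in> space P \<Longrightarrow> norm (Z \<omega>) \<le> B"
  shows "(\<integral>\<omega>. Z \<omega> * of_real (E \<omega> * X (R \<omega>) \<omega>) \<partial>P) = (\<integral>\<omega>. Z \<omega> * of_real (\<alpha> * erw_W X N \<omega> / N) \<partial>P)"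
proof -
  have Rv: "R \<omega> \<in> {1..N}" and Ev: "E \<omega> \<in> {1, -1}" if "\<omega> \<in> space P" for \<omega>
    using R(2) E(2) that by (auto simp: uniform_upto_def random_sign_def)
  have RP: "\<P>(\<omega> in P. R \<omega> = k) = 1 / N" if "k \<in> {1..N}" for k
    using R(2) that by (auto simp: uniform_upto_def)
  have [measurable]: "Z \<in> borel_measurable P"
    using measurable_info_P[OF A Z(1)] .
  have xP [measurable (raw)]: "X k \<in> borel_measurable P" if "k \<in> {1..N}" for k
    using measurable_info_P[OF A x[OF that]] .
  have srcE: "E \<in> borel_measurable (info {i, j})" "E \<in> borel_measurable (info {j})"
    using measurable_info_source[of j] E(1) by auto
  \<comment> \<open>Compared as reals, because the sources are real-valued.\<close>
  define I where "I k \<omega> = (if real (R \<omega>) = real k then 1 else 0 :: real)" for k :: nat and \<omega>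
  have srcR': "(\<lambda>\<omega>. real (R \<omega>)) \<in> borel_measurable (info {i, j})"
      "(\<lambda>\<omega>. real (R \<omega>)) \<in> borel_measurable (info {i})"
    using measurable_info_source[of i] R(1) by auto
  have srcR: "I k \<in> borel_measurable (info {i, j})" "I k \<in> borel_measurable (info {i})" for k
    unfolding I_def using srcR'[measurable] by measurable
  have ij': "{i, j} \<subseteq> sources" "{i} \<subseteq> sources" "{j} \<subseteq> sources" "{i} \<inter> {j} = {}" "A \<inter> {i, j} = {}"
    using i j ij by auto
  have [measurable]: "E \<in> borel_measurable P" "I k \<in> borel_measurable P" for k
    using srcE srcR measurable_info_P ij' by blast+
  have [measurable]: "R \<in> measurable P (count_space UNIV)"
    using R(2) by (simp add: uniform_upto_def)
  have I_int: "integrable P (I k)" for k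
    by (rule integrable_const_bound[where B=1]) (auto simp: I_def)
  have ZX_int: "integrable P (\<lambda>\<omega>. Z \<omega> * of_real (X k \<omega>))" if "k \<in> {1..N}" for k
  proof (rule integrable_const_bound[where B=B])
    show "AE \<omega> in P. norm (Z \<omega> * of_real (X k \<omega>)) \<le> B"
      using Z(2) abs_X that by (intro AE_I2) (auto simp: norm_mult)
  qed (use that in measurable)
  have EI_int: "integrable P (\<lambda>\<omega>. E \<omega> * I k \<omega>)" for k
    by (rule integrable_const_bound[where B=1])
       (use Ev in \<open>fastforce simp: I_def norm_mult intro!: AE_I2\<close>)+
  have EI: "(\<integral>\<omega>. E \<omega> * I k \<omega> \<partial>P) = \<alpha> / N" if "k \<in> {1..N}" for k
  proof -
    have "(\<integral>\<omega>. I k \<omega> \<partial>P) = (\<integral>\<omega>. indicator {\<omega>\<in>space P. R \<omega> = k} \<omega> \<partial>P)"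
      by (rule Bochner_Integration.integral_cong) (auto simp: I_def indicator_def)
    also have "\<dots> = 1 / N"
      using RP[OF that] by simp
    finally have "(\<integral>\<omega>. I k \<omega> \<partial>P) = 1 / N" .
    moreover have "(\<integral>\<omega>. I k \<omega> * E \<omega> \<partial>P) = (\<integral>\<omega>. I k \<omega> \<partial>P) * (\<integral>\<omega>. E \<omega> \<partial>P)"
      by (rule expectation_mult_info[of "{i}" "{j}"])
         (use ij' srcE srcR I_int integral_random_sign[OF E(2)] in auto)
    ultimately show ?thesis
      using integral_random_sign[OF E(2)] by (simp add: mult.commute)
  qed
  have ZXEI: "(\<integral>\<omega>. Z \<omega> * of_real (X k \<omega>) * of_real (E \<omega> * I k \<omega>) \<partial>P)
       = (\<integral>\<omega>. Z \<omega> * of_real (X k \<omega>) \<partial>P) * of_real (\<alpha> / N)" if "k \<in> {1..N}" for k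
  proof -
    have "(\<integral>\<omega>. Z \<omega> * of_real (X k \<omega>) * of_real (E \<omega> * I k \<omega>) \<partial>P)
       = (\<integral>\<omega>. Z \<omega> * of_real (X k \<omega>) \<partial>P) * (\<integral>\<omega>. of_real (E \<omega> * I k \<omega>) \<partial>P)"
      (is "_ = _ * ?e")
    proof (rule expectation_mult_info[of A "{i, j}"])
      show "(\<lambda>\<omega>. Z \<omega> * of_real (X k \<omega>)) \<in> borel_measurable (info A)"
        using Z(1) x[OF that] by measurable
      show "(\<lambda>\<omega>. of_real (E \<omega> * I k \<omega>) :: 'b) \<in> borel_measurable (info {i, j})"
        using srcE(1) srcR(1) by measurable
    qed (use A ij' ZX_int[OF that] integrable_of_real[OF EI_int] in auto)
    also have "?e = of_real (\<alpha> / N)"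
      by (simp only: integral_of_real[OF EI_int, of k] EI[OF that])
    finally show ?thesis .
  qed
  have prod_int: "integrable P (\<lambda>\<omega>. Z \<omega> * of_real (X k \<omega>) * of_real (E \<omega> * I k \<omega>))" if "k \<in> {1..N}" for k
  proof (rule integrable_const_bound[where B=B])
    have "norm (Z \<omega> * of_real (X k \<omega>) * of_real (E \<omega> * I k \<omega>)) \<le> B" if w: "\<omega> \<in> space P" for \<omega>
    proof -
      have "\<bar>E \<omega>\<bar> = 1" "\<bar>I k \<omega>\<bar> \<le> 1" using Ev[OF w] by (auto simp: I_def)
      then have "norm (Z \<omega>) * (\<bar>E \<omega>\<bar> * \<bar>I k \<omega>\<bar>) \<le> norm (Z \<omega>)"
        by (simp add: mult_left_le)
      with Z(2)[OF w] show ?thesis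
        using abs_X[of k \<omega>] \<open>k \<in> {1..N}\<close> w by (simp add: norm_mult abs_mult)
    qed
    then show "AE \<omega> in P. norm (Z \<omega> * of_real (X k \<omega>) * of_real (E \<omega> * I k \<omega>)) \<le> B" by (auto intro!: AE_I2)
  qed (use that in measurable)
  have "(\<integral>\<omega>. Z \<omega> * of_real (E \<omega> * X (R \<omega>) \<omega>) \<partial>P)
      = (\<integral>\<omega>. (\<Sum>k=1..N. Z \<omega> * of_real (X k \<omega>) * of_real (E \<omega> * I k \<omega>)) \<partial>P)"
  proof (rule Bochner_Integration.integral_cong)
    fix \<omega> assume w: "\<omega> \<in> space P"
    have "(\<Sum>k=1..N. Z \<omega> * of_real (X k \<omega>) * of_real (E \<omega> * I k \<omega>))
       = (\<Sum>k=1..N. if R \<omega> = k then Z \<omega> * of_real (X k \<omega>) * of_real (E \<omega>) else 0)"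
      by (rule sum.cong) (auto simp: I_def)
    also have "\<dots> = Z \<omega> * of_real (E \<omega> * X (R \<omega>) \<omega>)"
      using Rv[OF w] by (subst sum.delta') (auto simp: mult_ac)
    finally show "Z \<omega> * of_real (E \<omega> * X (R \<omega>) \<omega>) = (\<Sum>k=1..N. Z \<omega> * of_real (X k \<omega>) * of_real (E \<omega> * I k \<omega>))" ..
  qed simp
  also have "\<dots> = (\<Sum>k=1..N. (\<integral>\<omega>. Z \<omega> * of_real (X k \<omega>) \<partial>P) * of_real (\<alpha> / N))"
    by (subst Bochner_Integration.integral_sum[OF prod_int], assumption)
       (rule sum.cong[OF refl ZXEI])
  also have "\<dots> = (\<Sum>k=1..N. (\<integral>\<omega>. Z \<omega> * of_real (X k \<omega>) * of_real (\<alpha> / N) \<partial>P))"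
    by simp
  also have "\<dots> = (\<integral>\<omega>. (\<Sum>k=1..N. Z \<omega> * of_real (X k \<omega>) * of_real (\<alpha> / N)) \<partial>P)"
    by (rule Bochner_Integration.integral_sum[symmetric], rule integrable_mult_left, rule ZX_int)
  also have "\<dots> = (\<integral>\<omega>. Z \<omega> * of_real (\<alpha> * erw_W X N \<omega> / N) \<partial>P)"
    unfolding erw_W_def
    by (rule Bochner_Integration.integral_cong)
       (auto simp: sum_distrib_left sum_distrib_right sum_divide_distrib mult_ac)
  finally show ?thesis .
qed

lemma expectation_recall_exp:
  fixes Z :: "'a \<Rightarrow> 'b::{real_normed_field, banach, second_countable_topology}"
  assumes A: "A \<subseteq> sources" and i: "i \<in> sources - A" and j: "j \<in> sources - A" and ij: "i \<noteq> j"
    and R: "source i = (\<lambda>\<omega>. real (R \<omega>))" "uniform_upto P N R"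
    and E: "source j = E" "random_sign P p E"
    and N: "N \<ge> 1"
    and x: "\<And>k. k \<in> {1..N} \<Longrightarrow> X k \<in> borel_measurable (info A)"
    and Z: "Z \<in> borel_measurable (info A)" "\<And>\<omega>. \<omega> \<in> space P \<Longrightarrow> norm (Z \<omega>) \<le> B"
  shows "(\<integral>\<omega>. Z \<omega> * exp (z * of_real (E \<omega> * X (R \<omega>) \<omega>)) \<partial>P)
       = (\<integral>\<omega>. Z \<omega> * (cosh z + of_real (\<alpha> * erw_W X N \<omega> / N) * sinh z) \<partial>P)"
proof -
  have Rv: "R \<omega> \<in> {1..N}" and Ev: "E \<omega> \<in> {1, -1}" if "\<omega> \<in> space P" for \<omega>
    using R(2) E(2) that by (auto simp: uniform_upto_def random_sign_def)
  have y: "E \<omega> * X (R \<omega>) \<omega> \<in> {1, -1}" if "\<omega> \<in> space P" for \<omega>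
    using Ev[OF that] X_values[of "R \<omega>" \<omega>] Rv[OF that] that by auto
  have [measurable]: "Z \<in> borel_measurable P"
    using measurable_info_P[OF A Z(1)] .
  have [measurable (raw)]: "X k \<in> borel_measurable P" if "k \<in> {1..N}" for k
    using measurable_info_P[OF A x[OF that]] .
  have [measurable]: "erw_W X N \<in> borel_measurable P"
    unfolding erw_W_def[abs_def] by measurable
  have [measurable]: "E \<in> borel_measurable P" "R \<in> measurable P (count_space UNIV)"
    using E(2) R(2) by (auto simp: random_sign_def uniform_upto_def)
  have "(\<lambda>\<omega>. \<Sum>k=1..N. if R \<omega> = k then X k \<omega> else 0) \<in> borel_measurable P"
    by measurable
  also have "(\<lambda>\<omega>. \<Sum>k=1..N. if R \<omega> = k then X k \<omega> else 0) \<in> borel_measurable P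
      \<longleftrightarrow> (\<lambda>\<omega>. X (R \<omega>) \<omega>) \<in> borel_measurable P"
    by (rule measurable_cong) (use Rv in \<open>subst sum.delta', auto\<close>)
  finally have [measurable]: "(\<lambda>\<omega>. X (R \<omega>) \<omega>) \<in> borel_measurable P" .
  have int1: "integrable P (\<lambda>\<omega>. Z \<omega> * cosh z)"
    by (rule integrable_mult_left, rule integrable_const_bound[where B=B]) (use Z(2) in \<open>auto intro!: AE_I2\<close>)
  have int2: "integrable P (\<lambda>\<omega>. Z \<omega> * of_real (E \<omega> * X (R \<omega>) \<omega>))"
  proof (rule integrable_const_bound[where B=B])
    have "norm (Z \<omega> * of_real (E \<omega> * X (R \<omega>) \<omega>)) \<le> B" if "\<omega> \<in> space P" for \<omega>
      using Ev[OF that] abs_X[of "R \<omega>" \<omega>] Rv[OF that] Z(2)[OF that] that by (auto simp: norm_mult)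
    then show "AE \<omega> in P. norm (Z \<omega> * of_real (E \<omega> * X (R \<omega>) \<omega>)) \<le> B" by (auto intro!: AE_I2)
  qed measurable
  have int3: "integrable P (\<lambda>\<omega>. Z \<omega> * of_real (\<alpha> * erw_W X N \<omega> / N))"
  proof (rule integrable_const_bound[where B="B * 1"])
    have "norm (Z \<omega> * of_real (\<alpha> * erw_W X N \<omega> / N)) \<le> B * 1" if "\<omega> \<in> space P" for \<omega>
      unfolding norm_mult
    proof (rule mult_mono)
      have "\<bar>\<alpha> * erw_W X N \<omega>\<bar> \<le> 1 * real N"
        unfolding abs_mult using abs_alpha_less_1 abs_W_le[OF that, of N] by (intro mult_mono) auto
      then show "norm (of_real (\<alpha> * erw_W X N \<omega> / real N) :: 'b) \<le> 1"
        using N by (simp only: norm_of_real) (auto simp: abs_mult field_simps)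
      show "0 \<le> B" using norm_ge_zero Z(2)[OF that] by (rule order_trans)
    qed (use Z(2)[OF that] in auto)
    then show "AE \<omega> in P. norm (Z \<omega> * of_real (\<alpha> * erw_W X N \<omega> / N)) \<le> B * 1" by (auto intro!: AE_I2)
  qed measurable
  have "(\<integral>\<omega>. Z \<omega> * exp (z * of_real (E \<omega> * X (R \<omega>) \<omega>)) \<partial>P)
      = (\<integral>\<omega>. Z \<omega> * cosh z + Z \<omega> * of_real (E \<omega> * X (R \<omega>) \<omega>) * sinh z \<partial>P)"
    by (rule Bochner_Integration.integral_cong)
       (use y in \<open>simp_all only: exp_sign distrib_left mult.assoc\<close>)
  also have "\<dots> = (\<integral>\<omega>. Z \<omega> * cosh z \<partial>P) + (\<integral>\<omega>. Z \<omega> * of_real (E \<omega> * X (R \<omega>) \<omega>) \<partial>P) * sinh z"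
    by (subst Bochner_Integration.integral_add) (use int1 int2 in simp_all)
  also have "(\<integral>\<omega>. Z \<omega> * of_real (E \<omega> * X (R \<omega>) \<omega>) \<partial>P) = (\<integral>\<omega>. Z \<omega> * of_real (\<alpha> * erw_W X N \<omega> / N) \<partial>P)"
    by (rule expectation_recall) fact+
  also have "(\<integral>\<omega>. Z \<omega> * cosh z \<partial>P) + (\<integral>\<omega>. Z \<omega> * of_real (\<alpha> * erw_W X N \<omega> / N) \<partial>P) * sinh z
     = (\<integral>\<omega>. Z \<omega> * cosh z + Z \<omega> * of_real (\<alpha> * erw_W X N \<omega> / N) * sinh z \<partial>P)"
  proof -
    have i: "integrable P (\<lambda>\<omega>. Z \<omega> * of_real (\<alpha> * erw_W X N \<omega> / N) * sinh z)"
      using int3 by (rule integrable_mult_left)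
    have "(\<integral>\<omega>. Z \<omega> * of_real (\<alpha> * erw_W X N \<omega> / N) * sinh z \<partial>P)
        = (\<integral>\<omega>. Z \<omega> * of_real (\<alpha> * erw_W X N \<omega> / N) \<partial>P) * sinh z"
      by (rule integral_mult_left_zero)
    then show ?thesis
      by (simp only: Bochner_Integration.integral_add[OF int1 i])
  qed
  also have "\<dots> = (\<integral>\<omega>. Z \<omega> * (cosh z + of_real (\<alpha> * erw_W X N \<omega> / N) * sinh z) \<partial>P)"
    by (simp only: distrib_left mult.assoc)
  finally show ?thesis .
qed

section \<open>The sources of the walk and of a row\<close>

definition walk_sources :: "nat \<Rightarrow> erw_source set" where
  "walk_sources n = {First_Step} \<union> {Walk_Time k | k. 1 \<le> k \<and> k < n} \<union> {Walk_Sign k | k. 1 \<le> k \<and> k < n}"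

definition all_walk_sources :: "erw_source set" where
  "all_walk_sources = (\<Union>n. walk_sources n)"

text \<open>The full walk, not only its first \<open>m n\<close> steps, is included, because the limit \<open>M\<close> of the walk depends
  on all of them and occurs in the test variables.\<close>

definition row_sources :: "nat \<Rightarrow> nat \<Rightarrow> erw_source set" where
  "row_sources n k = all_walk_sources \<union> {Array_Time n j | j. m n < j \<and> j \<le> k} \<union> {Array_Sign n j | j. m n < j \<and> j \<le> k}"

lemma walk_sources_subset: "walk_sources n \<subseteq> sources"
  by (auto simp: walk_sources_def sources_def)

lemma all_walk_sources_subset: "all_walk_sources \<subseteq> sources"
  using walk_sources_subset by (auto simp: all_walk_sources_def)

lemma walk_sources_subset_all: "walk_sources n \<subseteq> all_walk_sources"
  by (auto simp: all_walk_sources_def)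

lemma row_sources_subset: "k \<le> n \<Longrightarrow> row_sources n k \<subseteq> sources"
  using all_walk_sources_subset by (auto simp: row_sources_def sources_def)

lemma walk_sources_mono: "i \<le> j \<Longrightarrow> walk_sources i \<subseteq> walk_sources j"
  by (auto simp: walk_sources_def)

lemma measurable_X_recall:
  assumes sp: "space Q = space P" and R: "(\<lambda>\<omega>. real (R \<omega>)) \<in> borel_measurable Q"
    and U: "uniform_upto P N R" and x: "\<And>k. k \<in> {1..N} \<Longrightarrow> X k \<in> borel_measurable Q"
  shows "(\<lambda>\<omega>. X (R \<omega>) \<omega>) \<in> borel_measurable Q"
proof -
  note R[measurable] x[measurable (raw)]
  have "(\<lambda>\<omega>. \<Sum>k=1..N. if real (R \<omega>) = real k then X k \<omega> else 0) \<in> borel_measurable Q"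
    by measurable
  also have "(\<lambda>\<omega>. \<Sum>k=1..N. if real (R \<omega>) = real k then X k \<omega> else 0) \<in> borel_measurable Q
      \<longleftrightarrow> (\<lambda>\<omega>. X (R \<omega>) \<omega>) \<in> borel_measurable Q"
    by (rule measurable_cong) (use U in \<open>auto simp: sp uniform_upto_def sum.delta'\<close>)
  finally show ?thesis .
qed

lemma measurable_X_info: "k \<ge> 1 \<Longrightarrow> k \<le> n \<Longrightarrow> X k \<in> borel_measurable (info (walk_sources n))"
proof (induction k rule: less_induct)
  case (less k)
  show ?case
  proof (cases "k = 1")
    case True
    then show ?thesis
      using measurable_info_source[of First_Step "walk_sources n"] by (simp add: source_def walk_sources_def)
  next
    case False
    then obtain j where j: "k = j + 1" "j \<ge> 1"
      using less.prems by (intro that[of "k - 1"]) auto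
    let ?Q = "info (walk_sources n)"
    have [measurable]: "\<epsilon> j \<in> borel_measurable ?Q" and R: "(\<lambda>\<omega>. real (U j \<omega>)) \<in> borel_measurable ?Q"
      using measurable_info_source[of "Walk_Sign j" "walk_sources n"]
        measurable_info_source[of "Walk_Time j" "walk_sources n"] j less.prems
      by (auto simp: source_def walk_sources_def)
    have [measurable]: "(\<lambda>\<omega>. X (U j \<omega>) \<omega>) \<in> borel_measurable ?Q"
      by (rule measurable_X_recall[OF _ R walk_time[OF j(2)]]) (use less j in auto)
    have "(\<lambda>\<omega>. \<epsilon> j \<omega> * X (U j \<omega>) \<omega>) \<in> borel_measurable ?Q" by measurable
    also have "?this \<longleftrightarrow> X k \<in> borel_measurable ?Q"
      by (rule measurable_cong) (use walk_step[OF j(2)] j in auto)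
    finally show ?thesis .
  qed
qed

lemma measurable_W_info: "k \<le> n \<Longrightarrow> erw_W X k \<in> borel_measurable (info (walk_sources n))"
  unfolding erw_W_def[abs_def] by (auto intro!: borel_measurable_sum measurable_X_info)

lemma measurable_W_info_all: "erw_W X k \<in> borel_measurable (info all_walk_sources)"
  using measurable_info_mono[OF walk_sources_subset_all measurable_W_info[OF order_refl]] .

lemma measurable_X_info_all: "k \<ge> 1 \<Longrightarrow> X k \<in> borel_measurable (info all_walk_sources)"
  using measurable_info_mono[OF walk_sources_subset_all measurable_X_info[OF _ order_refl]] .

lemma measurable_W [measurable]: "erw_W X k \<in> borel_measurable P"
  using measurable_info_P[OF walk_sources_subset measurable_W_info[OF order_refl]] .

lemma measurable_X [measurable (raw)]: "k \<ge> 1 \<Longrightarrow> X k \<in> borel_measurable P"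
  using measurable_info_P[OF walk_sources_subset measurable_X_info[OF _ order_refl]] .

lemma integrable_W_square: "integrable P (\<lambda>\<omega>. (erw_W X k \<omega>)\<^sup>2)"
proof (rule integrable_const_bound[where B="real k ^ 2"])
  show "AE \<omega> in P. norm ((erw_W X k \<omega>)\<^sup>2) \<le> real k ^ 2"
    using abs_W_le[of _ k] by (auto intro!: AE_I2 simp: abs_le_square_iff[symmetric])
qed measurable

lemma expectation_walk_step_exp:
  fixes Z :: "'a \<Rightarrow> 'b::{real_normed_field, banach, second_countable_topology}"
  assumes k: "k \<ge> 1"
    and Z: "Z \<in> borel_measurable (info (walk_sources k))" "\<And>\<omega>. \<omega> \<in> space P \<Longrightarrow> norm (Z \<omega>) \<le> B"
  shows "(\<integral>\<omega>. Z \<omega> * exp (z * of_real (X (Suc k) \<omega>)) \<partial>P)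
       = (\<integral>\<omega>. Z \<omega> * (cosh z + of_real (\<alpha> * erw_W X k \<omega> / k) * sinh z) \<partial>P)"
proof -
  have "(\<integral>\<omega>. Z \<omega> * exp (z * of_real (X (Suc k) \<omega>)) \<partial>P)
      = (\<integral>\<omega>. Z \<omega> * exp (z * of_real (\<epsilon> k \<omega> * X (U k \<omega>) \<omega>)) \<partial>P)"
    by (rule Bochner_Integration.integral_cong) (use walk_step[OF k] in auto)
  also have "\<dots> = (\<integral>\<omega>. Z \<omega> * (cosh z + of_real (\<alpha> * erw_W X k \<omega> / k) * sinh z) \<partial>P)"
    by (rule expectation_recall_exp[where A="walk_sources k" and i="Walk_Time k" and j="Walk_Sign k"])
       (use k Z walk_time walk_sign measurable_X_info walk_sources_subset in
         \<open>auto simp: source_def walk_sources_def sources_def\<close>)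
  finally show ?thesis .
qed

section \<open>The mean square of the walk\<close>

definition second_moment :: "nat \<Rightarrow> real" where
  "second_moment k = (\<integral>\<omega>. (erw_W X k \<omega>)\<^sup>2 \<partial>P)"

lemma second_moment_nonneg: "0 \<le> second_moment k"
  by (simp add: second_moment_def)

lemma second_moment_Suc:
  assumes k: "k \<ge> 1"
  shows "second_moment (Suc k) = 1 + (1 + 2 * \<alpha> / k) * second_moment k"
proof -
  let ?W = "erw_W X k"
  have WX: "(\<integral>\<omega>. ?W \<omega> * X (Suc k) \<omega> \<partial>P) = \<alpha> / k * second_moment k"
  proof -
    have "(\<integral>\<omega>. ?W \<omega> * X (Suc k) \<omega> \<partial>P) = (\<integral>\<omega>. ?W \<omega> * of_real (\<epsilon> k \<omega> * X (U k \<omega>) \<omega>) \<partial>P)"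
      by (rule Bochner_Integration.integral_cong) (use walk_step[OF k] in auto)
    also have "\<dots> = (\<integral>\<omega>. ?W \<omega> * of_real (\<alpha> * ?W \<omega> / k) \<partial>P)"
      by (rule expectation_recall[where A="walk_sources k" and i="Walk_Time k" and j="Walk_Sign k" and B="real k"])
         (use k walk_time walk_sign measurable_X_info measurable_W_info abs_W_le walk_sources_subset in
         \<open>auto simp: source_def walk_sources_def sources_def\<close>)
    also have "\<dots> = (\<integral>\<omega>. \<alpha> / k * (?W \<omega>)\<^sup>2 \<partial>P)"
      by (simp add: power2_eq_square mult_ac)
    finally show ?thesis by (simp add: second_moment_def)
  qed
  have int: "integrable P (\<lambda>\<omega>. ?W \<omega> * X (Suc k) \<omega>)"
  proof (rule integrable_const_bound[where B="real k"])
    show "AE \<omega> in P. norm (?W \<omega> * X (Suc k) \<omega>) \<le> real k"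
      using abs_W_le[of _ k] abs_X[of "Suc k"] by (auto intro!: AE_I2 simp: abs_mult)
  qed simp
  have "second_moment (Suc k) = (\<integral>\<omega>. (?W \<omega>)\<^sup>2 + 2 * (?W \<omega> * X (Suc k) \<omega>) + 1 \<partial>P)"
    unfolding second_moment_def
  proof (rule Bochner_Integration.integral_cong)
    fix \<omega> assume "\<omega> \<in> space P"
    then have "(X (Suc k) \<omega>)\<^sup>2 = 1" using X_values[of "Suc k" \<omega>] by auto
    then show "(erw_W X (Suc k) \<omega>)\<^sup>2 = (?W \<omega>)\<^sup>2 + 2 * (?W \<omega> * X (Suc k) \<omega>) + 1"
      by (simp add: erw_W_def power2_sum)
  qed simp
  also have "\<dots> = second_moment k + 2 * (\<alpha> / k * second_moment k) + 1"
    using int integrable_W_square[of k] by (simp add: WX second_moment_def prob_space)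
  finally show ?thesis by (simp add: algebra_simps)
qed

lemma second_moment_1: "second_moment 1 = 1"
proof -
  have "second_moment 1 = (\<integral>\<omega>. 1 \<partial>P)"
    unfolding second_moment_def
    by (rule Bochner_Integration.integral_cong) (use X_values[of 1] in \<open>auto simp: erw_W_def power2_eq_1_iff\<close>)
  then show ?thesis by (simp add: prob_space)
qed

text \<open>The recursion \<open>second_moment_Suc\<close> has solutions of order \<open>k\<close>, \<open>k * ln k\<close> or \<open>k powr (2 * \<alpha>)\<close>.
  The exponent \<open>1 + \<bar>\<alpha>\<bar>\<close> dominates all of them and stays below \<open>2\<close>, so that the mean square
  of \<open>W k / k\<close> tends to \<open>0\<close>; with this exponent the induction closes by Bernoulli's inequality.\<close>

lemma second_moment_le:
  assumes k: "k \<ge> 1"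
  shows "second_moment k \<le> real k powr (1 + \<bar>\<alpha>\<bar>) / (1 - \<bar>\<alpha>\<bar>)"
  using k
proof (induction k rule: dec_induct)
  case base
  then show ?case using abs_alpha_less_1 second_moment_1 by (simp add: field_simps)
next
  case (step k)
  define C where "C = 1 / (1 - \<bar>\<alpha>\<bar>)"
  define \<rho> where "\<rho> = 1 + \<bar>\<alpha>\<bar>"
  have k: "real k \<ge> 1" using step by simp
  have C: "C > 0" "C * (1 - \<bar>\<alpha>\<bar>) = 1"
    using abs_alpha_less_1 by (auto simp: C_def)
  have IH: "second_moment k \<le> C * real k powr \<rho>" using step.IH by (simp add: C_def \<rho>_def)
  have "second_moment (Suc k) = 1 + (1 + 2 * \<alpha> / k) * second_moment k"
    using step by (intro second_moment_Suc) auto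
  also have "\<dots> \<le> 1 + (1 + 2 * \<bar>\<alpha>\<bar> / k) * (C * real k powr \<rho>)"
    using IH second_moment_nonneg[of k] k by (intro add_left_mono mult_mono) (auto intro!: divide_right_mono)
  also have "\<dots> \<le> C * (1 - \<bar>\<alpha>\<bar>) * real k powr \<bar>\<alpha>\<bar> + (1 + 2 * \<bar>\<alpha>\<bar> / k) * (C * real k powr \<rho>)"
    using C k by (simp add: ge_one_powr_ge_zero)
  also have "real k powr \<bar>\<alpha>\<bar> = real k powr \<rho> / k"
    using k by (simp add: \<rho>_def powr_add)
  also have "C * (1 - \<bar>\<alpha>\<bar>) * (real k powr \<rho> / k) + (1 + 2 * \<bar>\<alpha>\<bar> / k) * (C * real k powr \<rho>)
      = C * (real k powr \<rho> * (1 + \<rho> / k))"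
    using k by (simp add: \<rho>_def field_simps)
  also have "\<dots> \<le> C * (real k powr \<rho> * (1 + 1 / k) powr \<rho>)"
    using C k powr_Bernoulli[of "1 / k" \<rho>] by (intro mult_left_mono) (auto simp: \<rho>_def)
  also have "real k powr \<rho> * (1 + 1 / k) powr \<rho> = (real k * (1 + 1 / k)) powr \<rho>"
    using k by (simp add: powr_mult)
  also have "real k * (1 + 1 / k) = real (Suc k)"
    using k by (simp add: field_simps)
  finally show ?case by (simp add: C_def \<rho>_def)
qed

text \<open>Mean square of \<open>W k / k\<close>, which bounds that of the conditional mean \<open>\<alpha> * W k / k\<close> of the next step.\<close>

definition msq_ratio :: "nat \<Rightarrow> real" where "msq_ratio k = second_moment k / (real k)\<^sup>2"

lemma msq_ratio_nonneg: "0 \<le> msq_ratio k"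
  by (simp add: msq_ratio_def second_moment_nonneg)

lemma msq_ratio_le:
  assumes "k \<ge> 1"
  shows "msq_ratio k \<le> real k powr (\<bar>\<alpha>\<bar> - 1) / (1 - \<bar>\<alpha>\<bar>)"
proof -
  have "msq_ratio k \<le> real k powr (1 + \<bar>\<alpha>\<bar>) / (1 - \<bar>\<alpha>\<bar>) / (real k)\<^sup>2"
    unfolding msq_ratio_def by (intro divide_right_mono second_moment_le assms) simp
  also have "\<dots> = real k powr (\<bar>\<alpha>\<bar> - 1) / (1 - \<bar>\<alpha>\<bar>)"
    using assms by (simp add: powr_add powr_diff power2_eq_square)
  finally show ?thesis .
qed

lemma msq_ratio_bound_tendsto_0: "(\<lambda>k. real k powr (\<bar>\<alpha>\<bar> - 1) / (1 - \<bar>\<alpha>\<bar>)) \<longlonglongrightarrow> 0"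
proof -
  have "((\<lambda>k. real k powr (\<bar>\<alpha>\<bar> - 1)) \<longlongrightarrow> 0) sequentially"
    using abs_alpha_less_1 by (intro tendsto_neg_powr filterlim_real_sequentially) auto
  from tendsto_divide[OF this tendsto_const, of "1 - \<bar>\<alpha>\<bar>"] show ?thesis
    using abs_alpha_less_1 by simp
qed

lemma msq_ratio_tendsto_0: "msq_ratio \<longlonglongrightarrow> 0"
  by (rule tendsto_sandwich[OF _ _ tendsto_const msq_ratio_bound_tendsto_0])
     (auto simp: msq_ratio_nonneg intro!: eventually_sequentiallyI msq_ratio_le)

section \<open>Characteristic functions along the walk\<close>

lemma abs_bias_le: "\<omega> \<in> space P \<Longrightarrow> k \<ge> 1 \<Longrightarrow> \<bar>\<alpha> * erw_W X k \<omega> / k\<bar> \<le> 1"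
  using abs_W_le[of \<omega> k] abs_alpha_less_1 mult_mono[of "\<bar>\<alpha>\<bar>" 1 "\<bar>erw_W X k \<omega>\<bar>" k]
  by (simp add: abs_mult)

lemma bias_square_le: "(\<alpha> * erw_W X k \<omega> / k)\<^sup>2 \<le> (erw_W X k \<omega>)\<^sup>2 / (real k)\<^sup>2"
proof -
  have "\<alpha>\<^sup>2 \<le> 1" using abs_alpha_less_1 by (simp add: abs_square_le_1)
  then have "\<alpha>\<^sup>2 * (erw_W X k \<omega>)\<^sup>2 \<le> (erw_W X k \<omega>)\<^sup>2" by (simp add: mult_left_le_one_le)
  then show ?thesis by (simp add: power_mult_distrib power_divide divide_right_mono)
qed

text \<open>One step of the comparison. The step \<open>k + 1\<close> contributes the factor \<open>exp (- b\<^sup>2 / 2)\<close>, and its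
  conditional mean changes the weight of \<open>W k\<close> from \<open>b\<close> to \<open>b * (1 + \<alpha> / k)\<close>. The last error term is
  the price for using another weight \<open>a\<close>, estimated by \<open>\<bar>W k\<bar> \<le> k\<close>.\<close>

lemma walk_char_step:
  assumes k: "k \<ge> 1"
    and Z: "Z \<in> borel_measurable (info (walk_sources k))" "\<And>\<omega>. \<omega> \<in> space P \<Longrightarrow> cmod (Z \<omega>) \<le> 1"
  shows "cmod ((\<integral>\<omega>. Z \<omega> * iexp (b * erw_W X (Suc k) \<omega>) \<partial>P)
            - (\<integral>\<omega>. Z \<omega> * iexp (a * erw_W X k \<omega>) \<partial>P) * of_real (exp (- b\<^sup>2 / 2)))
        \<le> b\<^sup>2 * msq_ratio k + 2 * \<bar>b\<bar> ^ 3 + \<bar>a - b * (1 + \<alpha> / k)\<bar> * k"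
proof -
  let ?W = "erw_W X k"
  let ?x = "\<lambda>\<omega>. \<alpha> * ?W \<omega> / k"
  let ?h = "\<lambda>\<omega>. cosh (\<i> * of_real b) + of_real (?x \<omega>) * sinh (\<i> * of_real b) :: complex"
  have [measurable]: "Z \<in> borel_measurable P"
    using measurable_info_P[OF walk_sources_subset Z(1)] .
  have Wi [measurable]: "?W \<in> borel_measurable (info (walk_sources k))"
    by (rule measurable_W_info) simp
  have "(\<integral>\<omega>. Z \<omega> * iexp (b * erw_W X (Suc k) \<omega>) \<partial>P)
      = (\<integral>\<omega>. (Z \<omega> * iexp (b * ?W \<omega>)) * exp (\<i> * of_real b * of_real (X (Suc k) \<omega>)) \<partial>P)"
    by (rule Bochner_Integration.integral_cong)
       (auto simp: erw_W_def exp_add[symmetric] algebra_simps)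
  also have "\<dots> = (\<integral>\<omega>. (Z \<omega> * iexp (b * ?W \<omega>)) * ?h \<omega> \<partial>P)"
  proof (rule expectation_walk_step_exp[OF k, where B=1])
    show "(\<lambda>\<omega>. Z \<omega> * iexp (b * ?W \<omega>)) \<in> borel_measurable (info (walk_sources k))"
      using Z(1) by measurable
  qed (use Z(2) in \<open>simp add: norm_mult\<close>)
  finally have 1: "(\<integral>\<omega>. Z \<omega> * iexp (b * erw_W X (Suc k) \<omega>) \<partial>P) = (\<integral>\<omega>. (Z \<omega> * iexp (b * ?W \<omega>)) * ?h \<omega> \<partial>P)" .
  have h: "cmod (?h \<omega>) \<le> 1" if "\<omega> \<in> space P" for \<omega>
    using abs_bias_le[OF that k] by (intro cmod_biased_cos_le) auto
  have int1: "integrable P (\<lambda>\<omega>. (Z \<omega> * iexp (b * ?W \<omega>)) * ?h \<omega>)"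
  proof (rule integrable_const_bound[where B=1])
    show "AE \<omega> in P. cmod ((Z \<omega> * iexp (b * ?W \<omega>)) * ?h \<omega>) \<le> 1"
      using h Z(2) by (intro AE_I2) (auto simp: norm_mult intro!: mult_le_one)
  qed measurable
  have int2: "integrable P (\<lambda>\<omega>. Z \<omega> * iexp (a * ?W \<omega>))"
    by (rule integrable_const_bound[where B=1]) (use Z(2) in \<open>auto intro!: AE_I2 simp: norm_mult\<close>)
  let ?g = "\<lambda>\<omega>. Z \<omega> * iexp (b * ?W \<omega>) * ?h \<omega> - Z \<omega> * iexp (a * ?W \<omega>) * of_real (exp (- b\<^sup>2 / 2))"
  have bnd: "cmod (?g \<omega>) \<le> b\<^sup>2 / (real k)\<^sup>2 * (?W \<omega>)\<^sup>2 + (2 * \<bar>b\<bar> ^ 3 + \<bar>a - b * (1 + \<alpha> / k)\<bar> * k)"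
    if w: "\<omega> \<in> space P" for \<omega>
  proof -
    have eq: "?g \<omega> = Z \<omega> * (iexp (b * ?W \<omega>) * (?h \<omega> - iexp (b * ?x \<omega>) * of_real (exp (- b\<^sup>2 / 2)))
       + (iexp (b * ?W \<omega> + b * ?x \<omega>) - iexp (a * ?W \<omega>)) * of_real (exp (- b\<^sup>2 / 2)))"
      by (simp add: algebra_simps exp_add)
    have "cmod (?g \<omega>) \<le> 1 * cmod (iexp (b * ?W \<omega>) * (?h \<omega> - iexp (b * ?x \<omega>) * of_real (exp (- b\<^sup>2 / 2)))
       + (iexp (b * ?W \<omega> + b * ?x \<omega>) - iexp (a * ?W \<omega>)) * of_real (exp (- b\<^sup>2 / 2)))"
      unfolding eq norm_mult[of "Z \<omega>"] using Z(2)[OF w] by (intro mult_right_mono) auto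
    also have "\<dots> \<le> cmod (?h \<omega> - iexp (b * ?x \<omega>) * of_real (exp (- b\<^sup>2 / 2)))
       + cmod (iexp (b * ?W \<omega> + b * ?x \<omega>) - iexp (a * ?W \<omega>)) * 1"
      unfolding mult_1_left
      by (rule norm_triangle_le, unfold norm_mult, intro add_mono mult_left_mono) auto
    also have "\<dots> \<le> (b\<^sup>2 * (?x \<omega>)\<^sup>2 + 2 * \<bar>b\<bar> ^ 3) + \<bar>(b * ?W \<omega> + b * ?x \<omega>) - a * ?W \<omega>\<bar> * 1"
      by (intro add_mono mult_right_mono biased_cos_approx cmod_iexp_diff_le abs_bias_le w k) simp
    also have "\<bar>(b * ?W \<omega> + b * ?x \<omega>) - a * ?W \<omega>\<bar> = \<bar>a - b * (1 + \<alpha> / k)\<bar> * \<bar>?W \<omega>\<bar>"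
      by (subst abs_mult[symmetric], subst abs_minus_commute) (simp add: algebra_simps)
    also have "b\<^sup>2 * (?x \<omega>)\<^sup>2 + 2 * \<bar>b\<bar> ^ 3 + \<bar>a - b * (1 + \<alpha> / k)\<bar> * \<bar>?W \<omega>\<bar> * 1
        \<le> b\<^sup>2 * ((?W \<omega>)\<^sup>2 / (real k)\<^sup>2) + 2 * \<bar>b\<bar> ^ 3 + \<bar>a - b * (1 + \<alpha> / k)\<bar> * k * 1"
      by (intro add_mono mult_left_mono mult_right_mono bias_square_le abs_W_le w) auto
    finally show ?thesis by simp
  qed
  have int2': "integrable P (\<lambda>\<omega>. Z \<omega> * iexp (a * ?W \<omega>) * of_real (exp (- b\<^sup>2 / 2)))"
    using int2 by (rule integrable_mult_left)
  have eq: "(\<integral>\<omega>. Z \<omega> * iexp (b * erw_W X (Suc k) \<omega>) \<partial>P)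
            - (\<integral>\<omega>. Z \<omega> * iexp (a * ?W \<omega>) \<partial>P) * of_real (exp (- b\<^sup>2 / 2)) = (\<integral>\<omega>. ?g \<omega> \<partial>P)"
    unfolding 1 Bochner_Integration.integral_diff[OF int1 int2'] integral_mult_left_zero ..
  have "cmod (\<integral>\<omega>. ?g \<omega> \<partial>P)
      \<le> (\<integral>\<omega>. b\<^sup>2 / (real k)\<^sup>2 * (?W \<omega>)\<^sup>2 + (2 * \<bar>b\<bar> ^ 3 + \<bar>a - b * (1 + \<alpha> / k)\<bar> * k) \<partial>P)"
  proof (rule order_trans[OF integral_norm_bound integral_mono])
    show "integrable P (\<lambda>\<omega>. cmod (?g \<omega>))"
      by (intro integrable_norm Bochner_Integration.integrable_diff int1 int2')
    show "integrable P (\<lambda>\<omega>. b\<^sup>2 / (real k)\<^sup>2 * (?W \<omega>)\<^sup>2 + (2 * \<bar>b\<bar> ^ 3 + \<bar>a - b * (1 + \<alpha> / k)\<bar> * k))"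
      using integrable_W_square[of k] by auto
  qed (rule bnd)
  moreover have "(\<integral>\<omega>. b\<^sup>2 / (real k)\<^sup>2 * (?W \<omega>)\<^sup>2 + (2 * \<bar>b\<bar> ^ 3 + \<bar>a - b * (1 + \<alpha> / k)\<bar> * k) \<partial>P)
      = b\<^sup>2 * msq_ratio k + 2 * \<bar>b\<bar> ^ 3 + \<bar>a - b * (1 + \<alpha> / k)\<bar> * k"
    using integrable_W_square[of k] by (simp add: prob_space msq_ratio_def second_moment_def)
  ultimately show ?thesis
    unfolding eq by linarith
qed

text \<open>The variable \<open>Z\<close> may depend on the walk up to time \<open>k\<close>. It is \<open>1\<close> for the limit theorem
  of the walk started at time \<open>1\<close>, and carries \<open>W k\<close> itself when \<open>W k\<close> is compared with the limit of
  the walk.\<close>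

lemma walk_char:
  assumes k: "k \<ge> 1" and kN: "k \<le> N"
    and Z: "Z \<in> borel_measurable (info (walk_sources k))" "\<And>\<omega>. \<omega> \<in> space P \<Longrightarrow> cmod (Z \<omega>) \<le> 1"
  shows "cmod ((\<integral>\<omega>. Z \<omega> * iexp (d N * erw_W X N \<omega>) \<partial>P)
            - (\<integral>\<omega>. Z \<omega> * iexp (d k * erw_W X k \<omega>) \<partial>P) * of_real (exp (- (\<Sum>j=k..<N. (d (Suc j))\<^sup>2) / 2)))
        \<le> (\<Sum>j=k..<N. (d (Suc j))\<^sup>2 * msq_ratio j + 2 * \<bar>d (Suc j)\<bar> ^ 3 + \<bar>d j - d (Suc j) * (1 + \<alpha> / j)\<bar> * j)"
  using kN
proof (induction N rule: dec_induct)
  case base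
  then show ?case by simp
next
  case (step N)
  let ?D = "\<lambda>N. (\<integral>\<omega>. Z \<omega> * iexp (d N * erw_W X N \<omega>) \<partial>P)"
  let ?b = "d (Suc N)"
  let ?e = "\<lambda>j. (d (Suc j))\<^sup>2 * msq_ratio j + 2 * \<bar>d (Suc j)\<bar> ^ 3 + \<bar>d j - d (Suc j) * (1 + \<alpha> / j)\<bar> * j"
  let ?G = "\<lambda>N. complex_of_real (exp (- (\<Sum>j=k..<N. (d (Suc j))\<^sup>2) / 2))"
  have Zm: "Z \<in> borel_measurable (info (walk_sources N))"
    by (rule measurable_info_mono[OF walk_sources_mono[OF step.hyps(1)] Z(1)])
  have 1: "cmod (?D (Suc N) - ?D N * of_real (exp (- ?b\<^sup>2 / 2))) \<le> ?e N"
    by (rule walk_char_step[OF order_trans[OF k step.hyps(1)] Zm Z(2)])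
  have 2: "cmod ((?D N - ?D k * ?G N) * of_real (exp (- ?b\<^sup>2 / 2))) \<le> (\<Sum>j=k..<N. ?e j) * 1"
    unfolding norm_mult by (intro mult_mono step.IH sum_nonneg) (auto simp: msq_ratio_nonneg)
  have G: "?G (Suc N) = ?G N * of_real (exp (- ?b\<^sup>2 / 2))"
    unfolding of_real_mult[symmetric] exp_add[symmetric] sum.atLeastLessThan_Suc[OF step.hyps(1)]
    by (simp add: add_divide_distrib)
  have alg: "x - z * (g * e) = (x - y * e) + (y - z * g) * e" for x y z g e :: complex
    by (simp add: algebra_simps)
  have "cmod (?D (Suc N) - ?D k * ?G (Suc N)) \<le> ?e N + (\<Sum>j=k..<N. ?e j) * 1"
    unfolding G alg[of "?D (Suc N)" "?D k" "?G N" _ "?D N"] by (rule norm_triangle_mono[OF 1 2])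
  then show ?case
    unfolding sum.atLeastLessThan_Suc[OF step.hyps(1), of ?e] by linarith
qed

text \<open>The powers \<open>j powr (- \<alpha>)\<close> solve the recursion \<open>d j = d (j + 1) * (1 + \<alpha> / j)\<close> up to a relative error
  of order \<open>1 / j\<^sup>2\<close>. They replace the exact solution, a quotient of Gamma functions.\<close>

lemma power_weight_defect:
  assumes "j \<ge> 1"
  shows "\<bar>real j powr (- \<alpha>) - real (Suc j) powr (- \<alpha>) * (1 + \<alpha> / j)\<bar> * j \<le> 2 * real (Suc j) powr (- \<alpha> - 1)"
proof -
  have j: "real j \<ge> 1" using assms by simp
  have "real j powr (- \<alpha>) = real (Suc j) powr (- \<alpha>) * (1 + 1 / j) powr \<alpha>"
  proof -
    have "1 + 1 / real j = real (Suc j) / real j" using j by (simp add: field_simps)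
    then show ?thesis
      using j by (simp add: powr_divide powr_minus_divide)
  qed
  then have "\<bar>real j powr (- \<alpha>) - real (Suc j) powr (- \<alpha>) * (1 + \<alpha> / j)\<bar>
      = real (Suc j) powr (- \<alpha>) * \<bar>(1 + 1 / j) powr \<alpha> - 1 - \<alpha> * (1 / j)\<bar>"
    by (subst abs_of_nonneg[of "real (Suc j) powr (- \<alpha>)", symmetric], simp, subst abs_mult[symmetric])
       (simp add: algebra_simps)
  also have "\<dots> \<le> real (Suc j) powr (- \<alpha>) * (1 / j)\<^sup>2"
    using abs_alpha_less_1 by (intro mult_left_mono powr_taylor2) auto
  finally have "\<bar>real j powr (- \<alpha>) - real (Suc j) powr (- \<alpha>) * (1 + \<alpha> / j)\<bar> * j
      \<le> real (Suc j) powr (- \<alpha>) * (1 / j)\<^sup>2 * j"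
    using j by (intro mult_right_mono) auto
  also have "\<dots> = real (Suc j) powr (- \<alpha>) * (1 / j)"
    using j by (simp add: power2_eq_square)
  also have "\<dots> \<le> real (Suc j) powr (- \<alpha>) * (2 / Suc j)"
    using j by (intro mult_left_mono) (auto simp: field_simps)
  also have "\<dots> = 2 * real (Suc j) powr (- \<alpha> - 1)"
    by (simp add: powr_diff)
  finally show ?thesis .
qed

lemma walk_char_power:
  assumes k: "k \<ge> 1" and kN: "k \<le> N"
    and Z: "Z \<in> borel_measurable (info (walk_sources k))" "\<And>\<omega>. \<omega> \<in> space P \<Longrightarrow> cmod (Z \<omega>) \<le> 1"
  shows "cmod ((\<integral>\<omega>. Z \<omega> * iexp (\<kappa> * real N powr (- \<alpha>) * erw_W X N \<omega>) \<partial>P)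
            - (\<integral>\<omega>. Z \<omega> * iexp (\<kappa> * real k powr (- \<alpha>) * erw_W X k \<omega>) \<partial>P)
              * of_real (exp (- (\<kappa>\<^sup>2 * (\<Sum>j=k..<N. real (Suc j) powr (- 2 * \<alpha>))) / 2)))
        \<le> (\<Sum>j=k..<N. \<kappa>\<^sup>2 * (real (Suc j) powr (- 2 * \<alpha>) * msq_ratio j)
             + 2 * \<bar>\<kappa>\<bar> ^ 3 * (real (Suc j) powr (- 2 * \<alpha>) * real (Suc j) powr (- \<alpha>))
             + 2 * \<bar>\<kappa>\<bar> * real (Suc j) powr (- \<alpha> - 1))"
proof -
  let ?d = "\<lambda>j. \<kappa> * real j powr (- \<alpha>)"
  have sq: "(real (Suc j) powr (- \<alpha>))\<^sup>2 = real (Suc j) powr (- 2 * \<alpha>)" for j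
    by (simp add: power2_eq_square powr_add[symmetric])
  have d2: "(?d (Suc j))\<^sup>2 = \<kappa>\<^sup>2 * real (Suc j) powr (- 2 * \<alpha>)" for j
    by (simp only: power_mult_distrib sq)
  have d3: "\<bar>?d (Suc j)\<bar> ^ 3 = \<bar>\<kappa>\<bar> ^ 3 * (real (Suc j) powr (- 2 * \<alpha>) * real (Suc j) powr (- \<alpha>))" for j
    unfolding sq[symmetric] by (simp add: abs_mult power3_eq_cube power2_eq_square)
  have s: "(\<Sum>j=k..<N. (?d (Suc j))\<^sup>2) = \<kappa>\<^sup>2 * (\<Sum>j=k..<N. real (Suc j) powr (- 2 * \<alpha>))"
    unfolding d2 sum_distrib_left ..
  show ?thesis
  proof (rule order_trans[OF walk_char[OF k kN Z, of ?d, unfolded s] sum_mono])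
    fix j assume "j \<in> {k..<N}"
    then have j: "j \<ge> 1" using k by auto
    have "\<bar>?d j - ?d (Suc j) * (1 + \<alpha> / j)\<bar> * j
       = \<bar>\<kappa>\<bar> * (\<bar>real j powr (- \<alpha>) - real (Suc j) powr (- \<alpha>) * (1 + \<alpha> / j)\<bar> * j)"
      unfolding mult.assoc right_diff_distrib[symmetric] abs_mult ..
    also have "\<dots> \<le> \<bar>\<kappa>\<bar> * (2 * real (Suc j) powr (- \<alpha> - 1))"
      by (intro mult_left_mono power_weight_defect j) simp
    finally show "(?d (Suc j))\<^sup>2 * msq_ratio j + 2 * \<bar>?d (Suc j)\<bar> ^ 3 + \<bar>?d j - ?d (Suc j) * (1 + \<alpha> / j)\<bar> * j
      \<le> \<kappa>\<^sup>2 * (real (Suc j) powr (- 2 * \<alpha>) * msq_ratio j)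
             + 2 * \<bar>\<kappa>\<bar> ^ 3 * (real (Suc j) powr (- 2 * \<alpha>) * real (Suc j) powr (- \<alpha>))
             + 2 * \<bar>\<kappa>\<bar> * real (Suc j) powr (- \<alpha> - 1)"
      unfolding d2 d3 by simp
  qed
qed

section \<open>The walk at and below the critical memory\<close>

text \<open>Sum of the squared weights, that is, the variance accumulated up to time \<open>n\<close>.\<close>

definition weight_sum :: "nat \<Rightarrow> real" where
  "weight_sum n = (\<Sum>j<n. real (Suc j) powr (- 2 * \<alpha>))"

lemma weight_sum_Suc: "weight_sum (Suc n) = weight_sum n + real (Suc n) powr (- 2 * \<alpha>)"
  by (simp add: weight_sum_def)

lemma weight_sum_less: "weight_sum n < weight_sum (Suc n)"
  by (simp add: weight_sum_Suc)

lemma weight_sum_nonneg: "0 \<le> weight_sum n"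
  by (auto simp: weight_sum_def intro!: sum_nonneg)

lemma weight_sum_mono: "i \<le> j \<Longrightarrow> weight_sum i \<le> weight_sum j"
  using lift_Suc_mono_le[of weight_sum i j] weight_sum_less by (simp add: less_imp_le)

lemma weight_sum_ge_1: "n \<ge> 1 \<Longrightarrow> 1 \<le> weight_sum n"
  using weight_sum_mono[of 1 n] by (simp add: weight_sum_def)

lemma weight_sum_asymp_less_half:
  assumes "\<alpha> < 1/2"
  shows "(\<lambda>n. weight_sum n / real n powr (1 - 2 * \<alpha>)) \<longlonglongrightarrow> 1 / (1 - 2 * \<alpha>)"
proof (rule stolz_cesaro)
  define \<beta> where "\<beta> = 1 - 2 * \<alpha>"
  have b: "\<beta> > 0" "- 2 * \<alpha> = \<beta> - 1" using assms by (auto simp: \<beta>_def)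
  show "filterlim (\<lambda>n. real n powr (1 - 2 * \<alpha>)) at_top sequentially"
    using b(1) unfolding \<beta>_def[symmetric] by real_asymp
  show "\<forall>\<^sub>F n in sequentially. real n powr (1 - 2 * \<alpha>) < real (Suc n) powr (1 - 2 * \<alpha>)"
    using b(1) unfolding \<beta>_def[symmetric] by (intro always_eventually) (auto intro!: powr_less_mono2)
  have "(\<lambda>n. real (Suc n) powr (\<beta> - 1) / (real (Suc n) powr \<beta> - real n powr \<beta>)) \<longlonglongrightarrow> inverse \<beta>"
    using b(1) by real_asymp
  then show "(\<lambda>n. (weight_sum (Suc n) - weight_sum n) / (real (Suc n) powr (1 - 2 * \<alpha>) - real n powr (1 - 2 * \<alpha>)))
      \<longlonglongrightarrow> 1 / (1 - 2 * \<alpha>)"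
    unfolding weight_sum_Suc b(2) unfolding \<beta>_def[symmetric] by (simp add: inverse_eq_divide)
qed

lemma weight_sum_asymp_half:
  assumes "\<alpha> = 1/2"
  shows "(\<lambda>n. weight_sum n / ln (real n)) \<longlonglongrightarrow> 1"
proof (rule stolz_cesaro)
  show "filterlim (\<lambda>n. ln (real n)) at_top sequentially" by real_asymp
  show "\<forall>\<^sub>F n in sequentially. ln (real n) < ln (real (Suc n))"
    using eventually_gt_at_top[of 0] by eventually_elim simp
  have w: "real (Suc n) powr (- 2 * \<alpha>) = 1 / real (Suc n)" for n
  proof -
    have "- 2 * \<alpha> = -1" using assms by simp
    then show ?thesis by (simp only:) (simp add: powr_minus_divide)
  qed
  have "(\<lambda>n. 1 / real (Suc n) / (ln (real (Suc n)) - ln (real n))) \<longlonglongrightarrow> 1"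
    by real_asymp
  then show "(\<lambda>n. (weight_sum (Suc n) - weight_sum n) / (ln (real (Suc n)) - ln (real n))) \<longlonglongrightarrow> 1"
    unfolding weight_sum_Suc w by simp
qed

lemma weight_sum_at_top:
  assumes "\<alpha> \<le> 1/2"
  shows "filterlim weight_sum at_top sequentially"
proof -
  have "filterlim (\<lambda>n. ln (real n)) at_top sequentially" by real_asymp
  moreover have "\<forall>\<^sub>F n in sequentially. ln (real n) \<le> weight_sum n"
    using eventually_gt_at_top[of 0]
  proof eventually_elim
    case (elim n)
    have "ln (real n) \<le> ln (real n + 1)"
      using elim by simp
    also have "\<dots> \<le> harm n"
      by (rule ln_le_harm)
    also have "harm n = (\<Sum>j<n. 1 / real (Suc j))"
      by (simp add: harm_def sum.atLeast1_atMost_eq inverse_eq_divide)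
    also have "\<dots> \<le> weight_sum n"
      unfolding weight_sum_def
    proof (rule sum_mono)
      fix j
      have "real (Suc j) powr (-1) \<le> real (Suc j) powr (- 2 * \<alpha>)"
        using assms by (intro powr_mono) auto
      then show "1 / real (Suc j) \<le> real (Suc j) powr (- 2 * \<alpha>)"
        by (simp add: powr_minus_divide)
    qed
    finally show ?case .
  qed
  ultimately show ?thesis by (rule filterlim_at_top_mono)
qed

text \<open>The first limit says that no single weight contributes a positive fraction of the variance (the
  Lindeberg condition in this setting); the second controls the weight defects.\<close>

lemma weight_sum_ratio_tendsto_0:
  assumes "\<alpha> \<le> 1/2"
  shows "(\<lambda>n. real n powr (- 2 * \<alpha>) / weight_sum n) \<longlonglongrightarrow> 0"
    and "(\<lambda>n. real n powr (2 * \<alpha> - 2) * weight_sum n) \<longlonglongrightarrow> 0"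
proof -
  consider "\<alpha> < 1/2" | "\<alpha> = 1/2" using assms by linarith
  then have "(\<lambda>n. real n powr (- 2 * \<alpha>) / weight_sum n) \<longlonglongrightarrow> 0 \<and> (\<lambda>n. real n powr (2 * \<alpha> - 2) * weight_sum n) \<longlonglongrightarrow> 0"
  proof cases
    case 1
    have ev: "\<forall>\<^sub>F n::nat in sequentially. n > 0" by (rule eventually_gt_at_top)
    have l: "(\<lambda>n. 1 / real n) \<longlonglongrightarrow> 0" by real_asymp
    have "(\<lambda>n. 1 / real n / (weight_sum n / real n powr (1 - 2 * \<alpha>))) \<longlonglongrightarrow> 0 / (1 / (1 - 2 * \<alpha>))"
      using 1 by (intro tendsto_divide l weight_sum_asymp_less_half) auto
    moreover have "\<forall>\<^sub>F n in sequentially. 1 / real n / (weight_sum n / real n powr (1 - 2 * \<alpha>)) = real n powr (- 2 * \<alpha>) / weight_sum n"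
      using ev by eventually_elim (simp add: powr_diff powr_minus_divide)
    moreover have "(\<lambda>n. 1 / real n * (weight_sum n / real n powr (1 - 2 * \<alpha>))) \<longlonglongrightarrow> 0 * (1 / (1 - 2 * \<alpha>))"
      using 1 by (intro tendsto_mult l weight_sum_asymp_less_half) auto
    moreover have "\<forall>\<^sub>F n in sequentially. 1 / real n * (weight_sum n / real n powr (1 - 2 * \<alpha>)) = real n powr (2 * \<alpha> - 2) * weight_sum n"
      using ev by eventually_elim (simp add: powr_diff power2_eq_square)
    ultimately show ?thesis by (auto simp: tendsto_cong)
  next
    case 2
    have ev: "\<forall>\<^sub>F n::nat in sequentially. n > 1" by (rule eventually_gt_at_top)
    have l: "(\<lambda>n. 1 / (real n * ln (real n))) \<longlonglongrightarrow> 0" "(\<lambda>n. ln (real n) / real n) \<longlonglongrightarrow> 0"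
      by real_asymp+
    have a1: "(\<lambda>n. 1 / (real n * ln (real n)) / (weight_sum n / ln (real n))) \<longlonglongrightarrow> 0 / 1"
      using 2 by (intro tendsto_divide l weight_sum_asymp_half) auto
    have e1: "\<forall>\<^sub>F n in sequentially. 1 / (real n * ln (real n)) / (weight_sum n / ln (real n)) = real n powr (- 2 * \<alpha>) / weight_sum n"
      using ev by eventually_elim (simp add: 2 powr_minus_divide)
    have a2: "(\<lambda>n. ln (real n) / real n * (weight_sum n / ln (real n))) \<longlonglongrightarrow> 0 * 1"
      using 2 by (intro tendsto_mult l weight_sum_asymp_half) auto
    have e2: "\<forall>\<^sub>F n in sequentially. ln (real n) / real n * (weight_sum n / ln (real n)) = real n powr (2 * \<alpha> - 2) * weight_sum n"
      using ev by eventually_elim (simp add: 2 powr_minus_divide)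
    show ?thesis
      using Lim_transform_eventually[OF a1 e1] Lim_transform_eventually[OF a2 e2] by simp
  qed
  then show "(\<lambda>n. real n powr (- 2 * \<alpha>) / weight_sum n) \<longlonglongrightarrow> 0" "(\<lambda>n. real n powr (2 * \<alpha> - 2) * weight_sum n) \<longlonglongrightarrow> 0"
    by auto
qed

text \<open>The three error sums of \<open>walk_char_power\<close>, normalized by the variance. Each follows from
  \<open>stolz_cesaro\<close>: the ratio of the increments is \<open>msq_ratio\<close>, respectively the relative size of the last weight,
  respectively bounded by a multiple of the root of \<open>n powr (2 * \<alpha> - 2) * weight_sum n\<close>.\<close>

lemma walk_error_limits:
  assumes "\<alpha> \<le> 1/2"
  shows "(\<lambda>n. (\<Sum>j<n. real (Suc j) powr (- 2 * \<alpha>) * msq_ratio j) / weight_sum n) \<longlonglongrightarrow> 0"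
    and "(\<lambda>n. (\<Sum>j<n. real (Suc j) powr (- 2 * \<alpha>) * (real (Suc j) powr (- \<alpha>) / sqrt (weight_sum (Suc j)))) / weight_sum n) \<longlonglongrightarrow> 0"
    and "(\<lambda>n. (\<Sum>j<n. real (Suc j) powr (- \<alpha> - 1)) / sqrt (weight_sum n)) \<longlonglongrightarrow> 0"
proof -
  have w: "real (Suc n) powr (- 2 * \<alpha>) > 0" for n by simp
  note top = weight_sum_at_top[OF assms]
  show "(\<lambda>n. (\<Sum>j<n. real (Suc j) powr (- 2 * \<alpha>) * msq_ratio j) / weight_sum n) \<longlonglongrightarrow> 0"
    by (rule stolz_cesaro[OF top]) (use msq_ratio_tendsto_0 in \<open>simp_all add: weight_sum_Suc\<close>)
  have "(\<lambda>n. sqrt (real (Suc n) powr (- 2 * \<alpha>) / weight_sum (Suc n))) \<longlonglongrightarrow> sqrt 0"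
    using LIMSEQ_Suc[OF weight_sum_ratio_tendsto_0(1)[OF assms]] by (rule tendsto_real_sqrt)
  moreover have "sqrt (real (Suc n) powr (- 2 * \<alpha>) / weight_sum (Suc n)) = real (Suc n) powr (- \<alpha>) / sqrt (weight_sum (Suc n))" for n
    by (simp add: real_sqrt_divide powr_half_sqrt[symmetric] powr_powr)
  ultimately have mu: "(\<lambda>n. real (Suc n) powr (- \<alpha>) / sqrt (weight_sum (Suc n))) \<longlonglongrightarrow> 0" by simp
  show "(\<lambda>n. (\<Sum>j<n. real (Suc j) powr (- 2 * \<alpha>) * (real (Suc j) powr (- \<alpha>) / sqrt (weight_sum (Suc j)))) / weight_sum n) \<longlonglongrightarrow> 0"
    by (rule stolz_cesaro[OF top]) (use mu in \<open>simp_all add: weight_sum_Suc\<close>)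
  show "(\<lambda>n. (\<Sum>j<n. real (Suc j) powr (- \<alpha> - 1)) / sqrt (weight_sum n)) \<longlonglongrightarrow> 0"
  proof (rule stolz_cesaro)
    show "filterlim (\<lambda>n. sqrt (weight_sum n)) at_top sequentially"
      using filterlim_compose[OF sqrt_at_top top] .
    show "\<forall>\<^sub>F n in sequentially. sqrt (weight_sum n) < sqrt (weight_sum (Suc n))"
      using weight_sum_less by simp
    have "(\<lambda>n. sqrt (real (Suc n) powr (2 * \<alpha> - 2) * weight_sum (Suc n))) \<longlonglongrightarrow> sqrt 0"
      using LIMSEQ_Suc[OF weight_sum_ratio_tendsto_0(2)[OF assms]] by (rule tendsto_real_sqrt)
    then have up: "(\<lambda>n. 2 * sqrt (real (Suc n) powr (2 * \<alpha> - 2) * weight_sum (Suc n))) \<longlonglongrightarrow> 0"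
      by (auto intro!: tendsto_eq_intros)
    have le: "((\<Sum>j<Suc n. real (Suc j) powr (- \<alpha> - 1)) - (\<Sum>j<n. real (Suc j) powr (- \<alpha> - 1)))
            / (sqrt (weight_sum (Suc n)) - sqrt (weight_sum n)) \<le> 2 * sqrt (real (Suc n) powr (2 * \<alpha> - 2) * weight_sum (Suc n))" for n
    proof -
      let ?x = "real (Suc n)"
      have pos: "0 < sqrt (weight_sum (Suc n)) - sqrt (weight_sum n)" using weight_sum_less[of n] by simp
      have "?x powr (- 2 * \<alpha>) = (sqrt (weight_sum (Suc n)) - sqrt (weight_sum n)) * (sqrt (weight_sum (Suc n)) + sqrt (weight_sum n))"
        using weight_sum_nonneg by (simp add: algebra_simps weight_sum_Suc)
      also have "\<dots> \<le> (sqrt (weight_sum (Suc n)) - sqrt (weight_sum n)) * (2 * sqrt (weight_sum (Suc n)))"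
        using pos by (intro mult_left_mono) auto
      finally have "?x powr (\<alpha> - 1) * ?x powr (- 2 * \<alpha>)
          \<le> ?x powr (\<alpha> - 1) * ((sqrt (weight_sum (Suc n)) - sqrt (weight_sum n)) * (2 * sqrt (weight_sum (Suc n))))"
        by (intro mult_left_mono) auto
      moreover have "?x powr (\<alpha> - 1) * ?x powr (- 2 * \<alpha>) = ?x powr (- \<alpha> - 1)"
        by (simp add: powr_add[symmetric])
      moreover have "sqrt (?x powr (2 * \<alpha> - 2) * weight_sum (Suc n)) = ?x powr (\<alpha> - 1) * sqrt (weight_sum (Suc n))"
        by (simp add: real_sqrt_mult powr_half_sqrt[symmetric] powr_powr diff_divide_distrib)
      ultimately have "?x powr (- \<alpha> - 1)
          \<le> 2 * sqrt (?x powr (2 * \<alpha> - 2) * weight_sum (Suc n)) * (sqrt (weight_sum (Suc n)) - sqrt (weight_sum n))"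
        by (simp only: mult_ac)
      moreover have "(\<Sum>j<Suc n. real (Suc j) powr (- \<alpha> - 1)) - (\<Sum>j<n. real (Suc j) powr (- \<alpha> - 1))
          = ?x powr (- \<alpha> - 1)"
        by simp
      ultimately show ?thesis
        by (simp only: pos_divide_le_eq[OF pos])
    qed
    show "(\<lambda>n. ((\<Sum>j<Suc n. real (Suc j) powr (- \<alpha> - 1)) - (\<Sum>j<n. real (Suc j) powr (- \<alpha> - 1)))
            / (sqrt (weight_sum (Suc n)) - sqrt (weight_sum n))) \<longlonglongrightarrow> 0"
    proof (rule tendsto_sandwich[OF always_eventually always_eventually tendsto_const up]; intro allI)
      fix n
      show "0 \<le> ((\<Sum>j<Suc n. real (Suc j) powr (- \<alpha> - 1)) - (\<Sum>j<n. real (Suc j) powr (- \<alpha> - 1)))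
            / (sqrt (weight_sum (Suc n)) - sqrt (weight_sum n))"
        using weight_sum_less[of n] by simp
    qed (rule le)
  qed
qed

text \<open>The argument \<open>\<tau> n\<close> is allowed to vary, since in the application it contains the factor
  \<open>g + \<alpha> * (1 - g)\<close>, which depends on \<open>n\<close>.\<close>

lemma walk_clt_le_half:
  assumes a: "\<alpha> \<le> 1/2" and mm: "filterlim mm at_top sequentially" and \<tau>: "\<tau> \<longlonglongrightarrow> \<tau>0"
  shows "(\<lambda>n. \<integral>\<omega>. iexp (\<tau> n * (real (mm n) powr (- \<alpha>) * erw_W X (mm n) \<omega> / sqrt (weight_sum (mm n)))) \<partial>P)
    \<longlonglongrightarrow> of_real (exp (- \<tau>0\<^sup>2 / 2))"
proof -
  \<comment> \<open>The common factor of the weights; it makes the accumulated variance \<open>(\<tau> n)\<^sup>2\<close>.\<close>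
  define \<kappa> where "\<kappa> n = \<tau> n / sqrt (weight_sum (mm n))" for n
  let ?R1 = "\<lambda>m. (\<Sum>j<m. real (Suc j) powr (- 2 * \<alpha>) * msq_ratio j) / weight_sum m"
  let ?R2 = "\<lambda>m. (\<Sum>j<m. real (Suc j) powr (- 2 * \<alpha>) * (real (Suc j) powr (- \<alpha>) / sqrt (weight_sum (Suc j)))) / weight_sum m"
  let ?R3 = "\<lambda>m. (\<Sum>j<m. real (Suc j) powr (- \<alpha> - 1)) / sqrt (weight_sum m)"
  let ?E = "\<lambda>n. \<integral>\<omega>. iexp (\<tau> n * (real (mm n) powr (- \<alpha>) * erw_W X (mm n) \<omega> / sqrt (weight_sum (mm n)))) \<partial>P"
  let ?F = "\<lambda>n. (\<integral>\<omega>. iexp (\<kappa> n * erw_W X 1 \<omega>) \<partial>P)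
      * of_real (exp (- ((\<kappa> n)\<^sup>2 * (weight_sum (mm n) - 1)) / 2))"
  let ?err = "\<lambda>n. (\<tau> n)\<^sup>2 * ?R1 (mm n) + 2 * \<bar>\<tau> n\<bar> ^ 3 * ?R2 (mm n) + 2 * \<bar>\<tau> n\<bar> * ?R3 (mm n)"
  have ev: "\<forall>\<^sub>F n in sequentially. mm n \<ge> 1"
    using mm by (simp add: filterlim_at_top)
  have s_top: "filterlim (\<lambda>n. weight_sum (mm n)) at_top sequentially"
    using filterlim_compose[OF weight_sum_at_top[OF a] mm] .
  have s_sqrt: "filterlim (\<lambda>n. sqrt (weight_sum (mm n))) at_top sequentially"
    using filterlim_compose[OF sqrt_at_top s_top] .
  have \<kappa>0: "\<kappa> \<longlonglongrightarrow> 0"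
    unfolding \<kappa>_def by (rule real_tendsto_divide_at_top[OF \<tau> s_sqrt])
  have bound: "cmod (?E n - ?F n) \<le> ?err n" if n: "mm n \<ge> 1" for n
  proof -
    let ?m = "mm n"
    have s: "weight_sum ?m \<ge> 1" using weight_sum_ge_1[OF n] .
    have k2: "(\<kappa> n)\<^sup>2 = (\<tau> n)\<^sup>2 / weight_sum ?m" using s by (simp add: \<kappa>_def power_divide)
    have ksum: "(\<Sum>j=1..<?m. real (Suc j) powr (- 2 * \<alpha>)) = weight_sum ?m - 1"
    proof -
      have "{..<?m} = insert 0 {1..<?m}" using n by auto
      then show ?thesis unfolding weight_sum_def by (simp only:) simp
    qed
    \<comment> \<open>The sums start at \<open>j = 1\<close>, the normalized error sums at \<open>j = 0\<close>; all terms are nonnegative.\<close>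
    have extend: "(\<Sum>j=1..<?m. f j) \<le> (\<Sum>j<?m. f j)" if "\<And>j. 0 \<le> f j" for f :: "nat \<Rightarrow> real"
      by (rule sum_mono2) (use that in auto)
    have "cmod (?E n - ?F n) \<le> (\<Sum>j=1..<?m. (\<kappa> n)\<^sup>2 * (real (Suc j) powr (- 2 * \<alpha>) * msq_ratio j)
             + 2 * \<bar>\<kappa> n\<bar> ^ 3 * (real (Suc j) powr (- 2 * \<alpha>) * real (Suc j) powr (- \<alpha>))
             + 2 * \<bar>\<kappa> n\<bar> * real (Suc j) powr (- \<alpha> - 1))"
      using walk_char_power[OF order_refl n, of "\<lambda>_. 1" "\<kappa> n"] unfolding ksum
      by (simp add: \<kappa>_def mult_ac)
    also have "\<dots> \<le> (\<Sum>j<?m. (\<kappa> n)\<^sup>2 * (real (Suc j) powr (- 2 * \<alpha>) * msq_ratio j)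
             + 2 * \<bar>\<kappa> n\<bar> ^ 3 * (real (Suc j) powr (- 2 * \<alpha>) * real (Suc j) powr (- \<alpha>))
             + 2 * \<bar>\<kappa> n\<bar> * real (Suc j) powr (- \<alpha> - 1))"
      by (rule extend) (auto simp: msq_ratio_nonneg)
    also have "\<dots> \<le> (\<Sum>j<?m. (\<kappa> n)\<^sup>2 * (real (Suc j) powr (- 2 * \<alpha>) * msq_ratio j)
             + 2 * (\<bar>\<tau> n\<bar> ^ 3 / weight_sum ?m) * (real (Suc j) powr (- 2 * \<alpha>) * (real (Suc j) powr (- \<alpha>) / sqrt (weight_sum (Suc j))))
             + 2 * \<bar>\<kappa> n\<bar> * real (Suc j) powr (- \<alpha> - 1))"
    \<comment> \<open>In the cubic term one factor \<open>sqrt (weight_sum (mm n))\<close> is lowered to its value at \<open>Suc j\<close>, to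
         match the sum in \<open>walk_error_limits\<close>.\<close>
    proof (intro sum_mono add_mono order_refl)
      fix j assume j: "j \<in> {..<?m}"
      have sj: "1 \<le> weight_sum (Suc j)" by (rule weight_sum_ge_1) simp
      have "\<bar>\<kappa> n\<bar> ^ 3 = \<bar>\<kappa> n\<bar>\<^sup>2 * \<bar>\<kappa> n\<bar>" by (simp add: power3_eq_cube power2_eq_square)
      also have "\<dots> = \<bar>\<tau> n\<bar> ^ 3 / weight_sum ?m / sqrt (weight_sum ?m)"
        unfolding power2_abs k2 using s by (simp add: \<kappa>_def power3_eq_cube power2_eq_square)
      also have "\<dots> \<le> \<bar>\<tau> n\<bar> ^ 3 / weight_sum ?m / sqrt (weight_sum (Suc j))"
        using s sj j by (intro divide_left_mono real_sqrt_le_mono weight_sum_mono) auto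
      finally have "\<bar>\<kappa> n\<bar> ^ 3 * (real (Suc j) powr (- 2 * \<alpha>) * real (Suc j) powr (- \<alpha>))
          \<le> \<bar>\<tau> n\<bar> ^ 3 / weight_sum ?m / sqrt (weight_sum (Suc j)) * (real (Suc j) powr (- 2 * \<alpha>) * real (Suc j) powr (- \<alpha>))"
        by (intro mult_right_mono) auto
      then show "2 * \<bar>\<kappa> n\<bar> ^ 3 * (real (Suc j) powr (- 2 * \<alpha>) * real (Suc j) powr (- \<alpha>))
          \<le> 2 * (\<bar>\<tau> n\<bar> ^ 3 / weight_sum ?m) * (real (Suc j) powr (- 2 * \<alpha>) * (real (Suc j) powr (- \<alpha>) / sqrt (weight_sum (Suc j))))"
        by (simp add: mult_ac)
    qed
    also have "\<dots> = ?err n"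
      unfolding sum.distrib sum_distrib_left[symmetric] k2
      using s by (simp add: \<kappa>_def)
    finally show ?thesis .
  qed
  have "?err \<longlonglongrightarrow> \<tau>0\<^sup>2 * 0 + 2 * \<bar>\<tau>0\<bar> ^ 3 * 0 + 2 * \<bar>\<tau>0\<bar> * 0"
    using \<tau> filterlim_compose[OF walk_error_limits(1)[OF a] mm]
      filterlim_compose[OF walk_error_limits(2)[OF a] mm] filterlim_compose[OF walk_error_limits(3)[OF a] mm]
    by (intro tendsto_intros)
  then have err: "?err \<longlonglongrightarrow> 0" by simp
  have diff: "(\<lambda>n. ?E n - ?F n) \<longlonglongrightarrow> 0"
    by (rule Lim_null_comparison[OF _ err]) (use ev bound in \<open>auto elim!: eventually_mono\<close>)
  have "cmod ((\<integral>\<omega>. iexp (\<kappa> n * erw_W X 1 \<omega>) \<partial>P) - 1) \<le> \<bar>\<kappa> n\<bar>" for n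
  proof -
    have int: "integrable P (\<lambda>\<omega>. iexp (\<kappa> n * erw_W X 1 \<omega>))"
      by (rule integrable_const_bound[where B=1]) auto
    have "(\<integral>\<omega>. iexp (\<kappa> n * erw_W X 1 \<omega>) \<partial>P) - 1 = (\<integral>\<omega>. iexp (\<kappa> n * erw_W X 1 \<omega>) - 1 \<partial>P)"
      using int by (simp add: prob_space)
    also have "cmod \<dots> \<le> (\<integral>\<omega>. \<bar>\<kappa> n\<bar> \<partial>P)"
    proof (rule order_trans[OF integral_norm_bound integral_mono])
      show "cmod (iexp (\<kappa> n * erw_W X 1 \<omega>) - 1) \<le> \<bar>\<kappa> n\<bar>" if "\<omega> \<in> space P" for \<omega>
        using cmod_iexp_diff_le[of "\<kappa> n * erw_W X 1 \<omega>" 0] abs_X[of 1 \<omega>] that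
        by (simp add: erw_W_def abs_mult)
    qed (use int in auto)
    finally show ?thesis by (simp add: prob_space)
  qed
  then have "(\<lambda>n. (\<integral>\<omega>. iexp (\<kappa> n * erw_W X 1 \<omega>) \<partial>P) - 1) \<longlonglongrightarrow> 0"
    by (intro Lim_null_comparison[OF _ tendsto_rabs_zero[OF \<kappa>0]]) auto
  then have one: "(\<lambda>n. (\<integral>\<omega>. iexp (\<kappa> n * erw_W X 1 \<omega>) \<partial>P)) \<longlonglongrightarrow> 1"
    by (simp add: LIM_zero_iff)
  have "(\<lambda>n. (\<tau> n)\<^sup>2 - (\<kappa> n)\<^sup>2) \<longlonglongrightarrow> \<tau>0\<^sup>2 - 0\<^sup>2"
    by (intro tendsto_intros \<tau> \<kappa>0)
  moreover have "\<forall>\<^sub>F n in sequentially. (\<tau> n)\<^sup>2 - (\<kappa> n)\<^sup>2 = (\<kappa> n)\<^sup>2 * (weight_sum (mm n) - 1)"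
    using ev
  proof eventually_elim
    case (elim n)
    then show ?case using weight_sum_ge_1[OF elim] by (simp add: \<kappa>_def power_divide field_simps)
  qed
  ultimately have "(\<lambda>n. (\<kappa> n)\<^sup>2 * (weight_sum (mm n) - 1)) \<longlonglongrightarrow> \<tau>0\<^sup>2"
    by (simp add: tendsto_cong)
  then have "?F \<longlonglongrightarrow> 1 * of_real (exp (- \<tau>0\<^sup>2 / 2))"
    by (intro tendsto_mult one tendsto_of_real tendsto_exp tendsto_divide tendsto_minus tendsto_const) auto
  from tendsto_add[OF diff this] show ?thesis by simp
qed

section \<open>The walk above the critical memory\<close>

text \<open>Sum of the squared weights after time \<open>k\<close>; meaningful for \<open>\<alpha> > 1/2\<close>.\<close>

definition weight_tail :: "nat \<Rightarrow> real" where
  "weight_tail k = (\<Sum>j. real (Suc j) powr (- 2 * \<alpha>)) - weight_sum k"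

lemma weight_tail:
  assumes a: "1/2 < \<alpha>" and k: "k \<ge> 1"
  shows "(\<lambda>N. \<Sum>j=k..<N. real (Suc j) powr (- 2 * \<alpha>)) \<longlonglongrightarrow> weight_tail k"
    and "weight_tail k \<le> real k powr (- (2 * \<alpha> - 1)) / (2 * \<alpha> - 1)"
    and "real (Suc k) powr (- (2 * \<alpha> - 1)) / (2 * \<alpha> - 1) \<le> weight_tail k"
proof -
  define \<delta> where "\<delta> = 2 * \<alpha> - 1"
  have \<delta>: "\<delta> > 0" "- 2 * \<alpha> = - \<delta> - 1" using a by (auto simp: \<delta>_def)
  have "summable (\<lambda>n. real n powr (- 2 * \<alpha>))"
    using a by (subst summable_real_powr_iff) auto
  then have sm: "summable (\<lambda>n. real (Suc n) powr (- 2 * \<alpha>))"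
    by (subst (asm) summable_Suc_iff[symmetric])
  have eq: "(\<Sum>j=k..<N. real (Suc j) powr (- 2 * \<alpha>)) = weight_sum N - weight_sum k" if "k \<le> N" for N
    using sum_diff_nat_ivl[of 0 k N "\<lambda>j. real (Suc j) powr (- 2 * \<alpha>)"] that
    by (simp add: weight_sum_def lessThan_atLeast0)
  have "(\<lambda>N. weight_sum N - weight_sum k) \<longlonglongrightarrow> weight_tail k"
    unfolding weight_tail_def using summable_LIMSEQ[OF sm] by (intro tendsto_diff tendsto_const) (simp add: weight_sum_def[abs_def])
  then show L: "(\<lambda>N. \<Sum>j=k..<N. real (Suc j) powr (- 2 * \<alpha>)) \<longlonglongrightarrow> weight_tail k"
    by (rule Lim_transform_eventually) (use eq in \<open>auto intro!: eventually_sequentiallyI[of k]\<close>)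
  have N0: "(\<lambda>N. real N powr (- \<delta>)) \<longlonglongrightarrow> 0"
    using \<delta>(1) by real_asymp
  have "(\<lambda>N. (real k powr (- \<delta>) - real N powr (- \<delta>)) / \<delta>) \<longlonglongrightarrow> (real k powr (- \<delta>) - 0) / \<delta>"
    using \<delta> by (intro tendsto_intros N0) auto
  then show "weight_tail k \<le> real k powr (- (2 * \<alpha> - 1)) / (2 * \<alpha> - 1)"
    using sum_powr_tail_bounds(1)[OF k _ \<delta>(1)] LIMSEQ_le[OF L]
    unfolding \<delta>(2) \<delta>_def[symmetric] by fastforce
  have "(\<lambda>N. (real (Suc k) powr (- \<delta>) - real (Suc N) powr (- \<delta>)) / \<delta>) \<longlonglongrightarrow> (real (Suc k) powr (- \<delta>) - 0) / \<delta>"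
    using \<delta> by (intro tendsto_intros LIMSEQ_Suc[OF N0]) auto
  then show "real (Suc k) powr (- (2 * \<alpha> - 1)) / (2 * \<alpha> - 1) \<le> weight_tail k"
    using sum_powr_tail_bounds(2)[OF k _ \<delta>(1)] LIMSEQ_le[OF _ L]
    unfolding \<delta>(2) \<delta>_def[symmetric] by fastforce
qed

text \<open>With \<open>\<kappa> = - t * k powr (\<alpha> - 1/2)\<close> the weight \<open>\<kappa> * k powr (- \<alpha>)\<close> of \<open>W k\<close> is exactly \<open>- t / sqrt k\<close>,
  so it cancels the factor \<open>Z = exp (\<i> * t * W k / sqrt k)\<close> at the starting time. At a late time \<open>N\<close> the weighted
  walk is \<open>\<kappa> * W N / N powr \<alpha>\<close>, close to \<open>\<kappa> * M\<close>. The bound is uniform in \<open>N\<close>, so it passes to the limit by dominated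
  convergence.\<close>

lemma walk_remainder_char_bound:
  assumes a: "1/2 < \<alpha>" and k: "k \<ge> 1"
    and M: "M \<in> borel_measurable P" "AE \<omega> in P. (\<lambda>N. erw_W X N \<omega> / real N powr \<alpha>) \<longlonglongrightarrow> M \<omega>"
  shows "cmod ((\<integral>\<omega>. iexp (t * ((erw_W X k \<omega> - M \<omega> * real k powr \<alpha>) / sqrt k)) \<partial>P)
      - of_real (exp (- (t\<^sup>2 * (real k powr (2 * \<alpha> - 1) * weight_tail k)) / 2)))
    \<le> t\<^sup>2 * (real k powr (\<bar>\<alpha>\<bar> - 1) / (1 - \<bar>\<alpha>\<bar>)) / (2 * \<alpha> - 1)
      + 2 * \<bar>t\<bar> ^ 3 * (1 / sqrt k) / (2 * \<alpha> - 1) + 2 * \<bar>t\<bar> * (1 / sqrt k) / \<alpha>"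
proof -
  let ?rb = "real k powr (\<bar>\<alpha>\<bar> - 1) / (1 - \<bar>\<alpha>\<bar>)"
  let ?w = "\<lambda>j. real (Suc j) powr (- 2 * \<alpha>)"
  define \<kappa> where "\<kappa> = - t * real k powr (\<alpha> - 1/2)"
  define Z where "Z \<omega> = iexp (t / sqrt k * erw_W X k \<omega>)" for \<omega>
  define \<delta> where "\<delta> = 2 * \<alpha> - 1"
  have \<delta>: "\<delta> > 0" "- 2 * \<alpha> = - \<delta> - 1" using a by (auto simp: \<delta>_def)
  have k0: "real k > 0" using k by simp
  have sqrtk: "sqrt (real k) = real k powr (1/2)" using k0 by (simp add: powr_half_sqrt)
  have \<kappa>k: "\<kappa> * real k powr (- \<alpha>) = - t / sqrt k"
    unfolding \<kappa>_def sqrtk using k0 by (simp add: powr_diff powr_minus_divide)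
  have \<kappa>': "\<kappa> = - (t / sqrt k) * real k powr \<alpha>"
    unfolding \<kappa>_def sqrtk by (simp add: powr_diff)
  have \<kappa>2: "\<kappa>\<^sup>2 = t\<^sup>2 * real k powr \<delta>"
    by (simp add: \<kappa>_def \<delta>_def power_mult_distrib power2_eq_square powr_add[symmetric])
  have \<kappa>2': "\<kappa>\<^sup>2 * (real k powr (- \<delta>) / \<delta>) = t\<^sup>2 / \<delta>"
    unfolding \<kappa>2 using k0 by (simp add: powr_minus_divide)
  have \<kappa>1: "\<bar>\<kappa>\<bar> * real k powr (- \<alpha>) = \<bar>t\<bar> / sqrt k"
    using arg_cong[OF \<kappa>k, of abs] by (simp add: abs_mult)
  have Zm: "Z \<in> borel_measurable (info (walk_sources k))"
    unfolding Z_def using measurable_W_info[OF order_refl, of k] by measurable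
  have Z1: "cmod (Z \<omega>) \<le> 1" for \<omega> by (simp add: Z_def)
  have [measurable]: "Z \<in> borel_measurable P" unfolding Z_def by measurable
  let ?D = "\<lambda>N. \<integral>\<omega>. Z \<omega> * iexp (\<kappa> * real N powr (- \<alpha>) * erw_W X N \<omega>) \<partial>P"
  let ?L = "\<integral>\<omega>. iexp (t * ((erw_W X k \<omega> - M \<omega> * real k powr \<alpha>) / sqrt k)) \<partial>P"
  let ?err = "t\<^sup>2 * ?rb / \<delta> + 2 * \<bar>t\<bar> ^ 3 * (1 / sqrt k) / \<delta> + 2 * \<bar>t\<bar> * (1 / sqrt k) / \<alpha>"
  have base: "?D k = 1"
  proof -
    have "Z \<omega> * iexp (\<kappa> * real k powr (- \<alpha>) * erw_W X k \<omega>) = 1" for \<omega>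
      unfolding \<kappa>k Z_def by (simp add: exp_add[symmetric])
    then show ?thesis by (simp add: prob_space)
  qed
  have b: "cmod (?D N - of_real (exp (- (\<kappa>\<^sup>2 * (\<Sum>j=k..<N. ?w j)) / 2))) \<le> ?err" if N: "k \<le> N" for N
  proof -
    have w: "(\<Sum>j=k..<N. ?w j) \<le> real k powr (- \<delta>) / \<delta>"
      unfolding \<delta>(2)
      by (rule order_trans[OF sum_powr_tail_bounds(1)[OF k N \<delta>(1)]])
         (use \<delta>(1) in \<open>simp add: divide_right_mono\<close>)
    have w3: "(\<Sum>j=k..<N. real (Suc j) powr (- \<alpha> - 1)) \<le> real k powr (- \<alpha>) / \<alpha>"
      by (rule order_trans[OF sum_powr_tail_bounds(1)[OF k N]])
         (use a in \<open>simp_all add: divide_right_mono\<close>)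
    have "cmod (?D N - 1 * of_real (exp (- (\<kappa>\<^sup>2 * (\<Sum>j=k..<N. ?w j)) / 2)))
      \<le> (\<Sum>j=k..<N. \<kappa>\<^sup>2 * (?w j * msq_ratio j) + 2 * \<bar>\<kappa>\<bar> ^ 3 * (?w j * real (Suc j) powr (- \<alpha>))
          + 2 * \<bar>\<kappa>\<bar> * real (Suc j) powr (- \<alpha> - 1))"
      using walk_char_power[OF k N Zm Z1, of \<kappa>] unfolding base .
    also have "\<dots> \<le> (\<Sum>j=k..<N. \<kappa>\<^sup>2 * (?w j * ?rb) + 2 * \<bar>\<kappa>\<bar> ^ 3 * (?w j * real k powr (- \<alpha>))
          + 2 * \<bar>\<kappa>\<bar> * real (Suc j) powr (- \<alpha> - 1))"
    proof (intro sum_mono add_mono mult_left_mono order_refl)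
      fix j assume j: "j \<in> {k..<N}"
      then have j1: "j \<ge> 1" using k by auto
      have "real j powr (\<bar>\<alpha>\<bar> - 1) \<le> real k powr (\<bar>\<alpha>\<bar> - 1)"
        using j k0 abs_alpha_less_1 by (intro powr_mono2') auto
      then show "msq_ratio j \<le> ?rb"
        by (rule order_trans[OF msq_ratio_le[OF j1] divide_right_mono]) (use abs_alpha_less_1 in simp)
      show "real (Suc j) powr (- \<alpha>) \<le> real k powr (- \<alpha>)"
        using j k0 a by (intro powr_mono2') auto
    qed auto
    also have "\<dots> = \<kappa>\<^sup>2 * ?rb * (\<Sum>j=k..<N. ?w j) + 2 * \<bar>\<kappa>\<bar> ^ 3 * real k powr (- \<alpha>) * (\<Sum>j=k..<N. ?w j)
          + 2 * \<bar>\<kappa>\<bar> * (\<Sum>j=k..<N. real (Suc j) powr (- \<alpha> - 1))"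
      unfolding sum.distrib sum_distrib_left by (simp add: mult_ac)
    also have "\<dots> \<le> \<kappa>\<^sup>2 * ?rb * (real k powr (- \<delta>) / \<delta>) + 2 * \<bar>\<kappa>\<bar> ^ 3 * real k powr (- \<alpha>) * (real k powr (- \<delta>) / \<delta>)
          + 2 * \<bar>\<kappa>\<bar> * (real k powr (- \<alpha>) / \<alpha>)"
      using abs_alpha_less_1 by (intro add_mono mult_left_mono w w3) auto
    also have "\<dots> = (\<kappa>\<^sup>2 * (real k powr (- \<delta>) / \<delta>)) * ?rb
        + 2 * (\<bar>\<kappa>\<bar> * real k powr (- \<alpha>)) * (\<kappa>\<^sup>2 * (real k powr (- \<delta>) / \<delta>))
        + 2 * (\<bar>\<kappa>\<bar> * real k powr (- \<alpha>)) / \<alpha>"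
      by (simp add: power3_eq_cube power2_eq_square mult_ac)
    also have "\<dots> = ?err"
      unfolding \<kappa>2' \<kappa>1 by (simp add: power3_eq_cube power2_eq_square mult_ac)
    finally show ?thesis by simp
  qed
  have DL: "?D \<longlonglongrightarrow> ?L"
  proof (rule integral_dominated_convergence[where w="\<lambda>_. 1"])
    show "AE \<omega> in P. (\<lambda>N. Z \<omega> * iexp (\<kappa> * real N powr (- \<alpha>) * erw_W X N \<omega>))
        \<longlonglongrightarrow> iexp (t * ((erw_W X k \<omega> - M \<omega> * real k powr \<alpha>) / sqrt k))"
      using M(2)
    proof eventually_elim
      case (elim \<omega>)
      have "t / sqrt k * erw_W X k \<omega> + \<kappa> * M \<omega> = t * ((erw_W X k \<omega> - M \<omega> * real k powr \<alpha>) / sqrt k)"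
        unfolding \<kappa>' by (simp add: algebra_simps diff_divide_distrib)
      moreover have "(\<lambda>N. iexp (t / sqrt k * erw_W X k \<omega> + \<kappa> * (erw_W X N \<omega> / real N powr \<alpha>)))
          \<longlonglongrightarrow> iexp (t / sqrt k * erw_W X k \<omega> + \<kappa> * M \<omega>)"
        by (intro tendsto_intros elim)
      ultimately show ?case
        by (simp add: Z_def exp_add[symmetric] powr_minus_divide distrib_left)
    qed
  qed (use M(1) Z1 in \<open>auto simp: norm_mult\<close>)
  have "(\<lambda>N. cmod (?D N - of_real (exp (- (\<kappa>\<^sup>2 * (\<Sum>j=k..<N. ?w j)) / 2))))
      \<longlonglongrightarrow> cmod (?L - of_real (exp (- (\<kappa>\<^sup>2 * weight_tail k) / 2)))"
    by (intro tendsto_intros DL weight_tail[OF a k]) simp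
  then have "cmod (?L - of_real (exp (- (\<kappa>\<^sup>2 * weight_tail k) / 2))) \<le> ?err"
    by (rule LIMSEQ_le_const2) (use b in blast)
  then show ?thesis
    unfolding \<kappa>2 unfolding \<delta>_def by (simp only: mult.assoc)
qed

lemma walk_clt_gt_half:
  assumes a: "1/2 < \<alpha>" and mm: "filterlim mm at_top sequentially" and \<tau>: "\<tau> \<longlonglongrightarrow> \<tau>0"
    and M: "M \<in> borel_measurable P" "AE \<omega> in P. (\<lambda>N. erw_W X N \<omega> / real N powr \<alpha>) \<longlonglongrightarrow> M \<omega>"
  shows "(\<lambda>n. \<integral>\<omega>. iexp (\<tau> n * ((erw_W X (mm n) \<omega> - M \<omega> * real (mm n) powr \<alpha>) / sqrt (mm n))) \<partial>P)
    \<longlonglongrightarrow> of_real (exp (- (\<tau>0\<^sup>2 / (2 * \<alpha> - 1)) / 2))"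
proof -
  let ?E = "\<lambda>n. \<integral>\<omega>. iexp (\<tau> n * ((erw_W X (mm n) \<omega> - M \<omega> * real (mm n) powr \<alpha>) / sqrt (mm n))) \<partial>P"
  let ?F = "\<lambda>n. complex_of_real (exp (- ((\<tau> n)\<^sup>2 * (real (mm n) powr (2 * \<alpha> - 1) * weight_tail (mm n))) / 2))"
  let ?err = "\<lambda>n. (\<tau> n)\<^sup>2 * (real (mm n) powr (\<bar>\<alpha>\<bar> - 1) / (1 - \<bar>\<alpha>\<bar>)) / (2 * \<alpha> - 1)
      + 2 * \<bar>\<tau> n\<bar> ^ 3 * (1 / sqrt (mm n)) / (2 * \<alpha> - 1) + 2 * \<bar>\<tau> n\<bar> * (1 / sqrt (mm n)) / \<alpha>"
  define \<delta> where "\<delta> = 2 * \<alpha> - 1"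
  have \<delta>: "\<delta> > 0" using a by (simp add: \<delta>_def)
  have ev: "\<forall>\<^sub>F n in sequentially. mm n \<ge> 1"
    using mm by (simp add: filterlim_at_top)
  have "(\<lambda>m. 1 / sqrt (real m)) \<longlonglongrightarrow> 0" by real_asymp
  from filterlim_compose[OF this mm] have q: "(\<lambda>n. 1 / sqrt (real (mm n))) \<longlonglongrightarrow> 0" .
  have "?err \<longlonglongrightarrow> \<tau>0\<^sup>2 * 0 / (2 * \<alpha> - 1) + 2 * \<bar>\<tau>0\<bar> ^ 3 * 0 / (2 * \<alpha> - 1) + 2 * \<bar>\<tau>0\<bar> * 0 / \<alpha>"
    using a \<tau> q filterlim_compose[OF msq_ratio_bound_tendsto_0 mm] by (intro tendsto_intros) auto
  then have err: "?err \<longlonglongrightarrow> 0" by simp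
  have diff: "(\<lambda>n. ?E n - ?F n) \<longlonglongrightarrow> 0"
    by (rule Lim_null_comparison[OF _ err])
       (use ev walk_remainder_char_bound[OF a _ M] in \<open>auto elim!: eventually_mono\<close>)
  have "(\<lambda>m. real m powr \<delta> * weight_tail m) \<longlonglongrightarrow> 1 / \<delta>"
  proof (rule tendsto_sandwich)
    have "(\<lambda>m. real m powr \<delta> * (real (Suc m) powr (- \<delta>))) \<longlonglongrightarrow> 1"
      using \<delta> by real_asymp
    then show "(\<lambda>m. real m powr \<delta> * (real (Suc m) powr (- \<delta>)) / \<delta>) \<longlonglongrightarrow> 1 / \<delta>"
      using \<delta> by (intro tendsto_divide) auto
    show "\<forall>\<^sub>F m in sequentially. real m powr \<delta> * (real (Suc m) powr (- \<delta>)) / \<delta> \<le> real m powr \<delta> * weight_tail m"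
      using eventually_ge_at_top[of 1]
    proof eventually_elim
      case (elim m)
      show ?case
        using mult_left_mono[OF weight_tail(3)[OF a elim], of "real m powr \<delta>"] by (simp add: \<delta>_def)
    qed
    show "\<forall>\<^sub>F m in sequentially. real m powr \<delta> * weight_tail m \<le> 1 / \<delta>"
      using eventually_ge_at_top[of 1]
    proof eventually_elim
      case (elim m)
      have "real m powr \<delta> * weight_tail m \<le> real m powr \<delta> * (real m powr (- \<delta>) / \<delta>)"
        using weight_tail(2)[OF a elim] unfolding \<delta>_def by (intro mult_left_mono) auto
      also have "\<dots> = 1 / \<delta>" using elim by (simp add: powr_minus_divide)
      finally show ?case .
    qed
  qed simp
  from filterlim_compose[OF this mm]
  have "?F \<longlonglongrightarrow> of_real (exp (- (\<tau>0\<^sup>2 * (1 / \<delta>)) / 2))"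
    unfolding \<delta>_def by (intro tendsto_intros \<tau>) auto
  from tendsto_add[OF diff this] show ?thesis by (simp add: \<delta>_def)
qed

section \<open>The rows of the array\<close>

lemma measurable_Y_row:
  assumes "m n < j" "j \<le> k" "k \<le> n"
  shows "(\<lambda>\<omega>. \<eta> n j \<omega> * X (V n j \<omega>) \<omega>) \<in> borel_measurable (info (row_sources n k))"
proof -
  let ?Q = "info (row_sources n k)"
  have sub: "all_walk_sources \<subseteq> row_sources n k" by (auto simp: row_sources_def)
  have [measurable]: "\<eta> n j \<in> borel_measurable ?Q" and R: "(\<lambda>\<omega>. real (V n j \<omega>)) \<in> borel_measurable ?Q"
    using measurable_info_source[of "Array_Sign n j" "row_sources n k"]
      measurable_info_source[of "Array_Time n j" "row_sources n k"] assms
    by (auto simp: source_def row_sources_def)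
  have [measurable]: "(\<lambda>\<omega>. X (V n j \<omega>) \<omega>) \<in> borel_measurable ?Q"
    by (rule measurable_X_recall[OF _ R array_time])
       (use assms measurable_info_mono[OF sub measurable_X_info_all] in auto)
  show ?thesis by measurable
qed

lemma Y_values:
  assumes "m n < j" "j \<le> n" "\<omega> \<in> space P"
  shows "\<eta> n j \<omega> * X (V n j \<omega>) \<omega> \<in> {1, -1}"
proof -
  have "V n j \<omega> \<in> {1..m n}" "\<eta> n j \<omega> \<in> {1, -1}"
    using array_time[OF assms(1,2)] array_sign[OF assms(1,2)] assms(3)
    by (auto simp: uniform_upto_def random_sign_def)
  then show ?thesis using X_values[of "V n j \<omega>" \<omega>] assms(3) by auto
qed

text \<open>The new steps of a row are conditionally independent given the walk. Instead of introducing
  conditional expectations, the last step is averaged out and the resulting factor, a function of the walk,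
  is absorbed into \<open>Z\<close>; this is why the induction is over all \<open>Z\<close>.\<close>

lemma expectation_array_exp:
  fixes Z :: "'a \<Rightarrow> 'b::{real_normed_field, banach, second_countable_topology}"
  assumes n: "n \<ge> 1" and k: "m n + d \<le> n"
    and Z: "Z \<in> borel_measurable (info all_walk_sources)" "\<And>\<omega>. \<omega> \<in> space P \<Longrightarrow> norm (Z \<omega>) \<le> B"
  shows "(\<integral>\<omega>. Z \<omega> * exp (z * of_real (\<Sum>j\<in>{m n<..m n + d}. \<eta> n j \<omega> * X (V n j \<omega>) \<omega>)) \<partial>P)
       = (\<integral>\<omega>. Z \<omega> * (cosh z + of_real (\<alpha> * erw_W X (m n) \<omega> / m n) * sinh z) ^ d \<partial>P)"
  using k Z
proof (induction d arbitrary: Z B)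
  case 0
  then show ?case by simp
next
  case (Suc d)
  let ?Y = "\<lambda>j \<omega>. \<eta> n j \<omega> * X (V n j \<omega>) \<omega>"
  let ?S = "\<lambda>\<omega>. \<Sum>j\<in>{m n<..m n + d}. ?Y j \<omega>"
  let ?A = "row_sources n (m n + d)"
  let ?h = "\<lambda>\<omega>. cosh z + of_real (\<alpha> * erw_W X (m n) \<omega> / m n) * sinh z"
  have m1: "m n \<ge> 1" using m_bounds[OF n] by simp
  have A: "?A \<subseteq> sources" using Suc.prems by (intro row_sources_subset) auto
  have sub: "all_walk_sources \<subseteq> ?A" by (auto simp: row_sources_def)
  have [measurable]: "Z \<in> borel_measurable (info ?A)"
    by (rule measurable_info_mono[OF sub Suc.prems(2)])
  have [measurable]: "?S \<in> borel_measurable (info ?A)"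
    using Suc.prems by (intro borel_measurable_sum measurable_Y_row) auto
  have Wall [measurable]: "erw_W X (m n) \<in> borel_measurable (info all_walk_sources)"
    by (rule measurable_W_info_all)
  have S: "\<bar>?S \<omega>\<bar> \<le> d" if "\<omega> \<in> space P" for \<omega>
  proof -
    have "\<bar>?S \<omega>\<bar> \<le> (\<Sum>j\<in>{m n<..m n + d}. \<bar>?Y j \<omega>\<bar>)" by (rule sum_abs)
    also have "\<dots> \<le> (\<Sum>j\<in>{m n<..m n + d}. 1)"
      by (rule sum_mono) (use Y_values[of n _ \<omega>] that Suc.prems in fastforce)
    finally show ?thesis by simp
  qed
  have eq: "{m n<..m n + Suc d} = insert (m n + Suc d) {m n<..m n + d}" by auto
  have "(\<integral>\<omega>. Z \<omega> * exp (z * of_real (\<Sum>j\<in>{m n<..m n + Suc d}. ?Y j \<omega>)) \<partial>P)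
      = (\<integral>\<omega>. (Z \<omega> * exp (z * of_real (?S \<omega>))) * exp (z * of_real (?Y (m n + Suc d) \<omega>)) \<partial>P)"
    unfolding eq by (subst sum.insert) (auto simp: distrib_left exp_add mult_ac)
  also have "\<dots> = (\<integral>\<omega>. (Z \<omega> * exp (z * of_real (?S \<omega>))) * ?h \<omega> \<partial>P)"
  proof (rule expectation_recall_exp[where A="?A" and i="Array_Time n (m n + Suc d)" and j="Array_Sign n (m n + Suc d)"
        and B="B * exp (norm z * d)"])
    show "(\<lambda>\<omega>. Z \<omega> * exp (z * of_real (?S \<omega>))) \<in> borel_measurable (info ?A)" by measurable
    show "norm (Z \<omega> * exp (z * of_real (?S \<omega>))) \<le> B * exp (norm z * d)" if w: "\<omega> \<in> space P" for \<omega>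
    proof -
      have "norm (exp (z * of_real (?S \<omega>))) \<le> exp (norm (z * of_real (?S \<omega>)))" by (rule norm_exp)
      also have "\<dots> \<le> exp (norm z * d)"
        unfolding norm_mult norm_of_real using S[OF w] by (intro exp_mono mult_left_mono) auto
      finally show ?thesis
        unfolding norm_mult by (intro mult_mono Suc.prems(3)[OF w] order_trans[OF norm_ge_zero Suc.prems(3)[OF w]] norm_ge_zero)
    qed
    show "Array_Time n (m n + Suc d) \<in> sources - ?A" "Array_Sign n (m n + Suc d) \<in> sources - ?A"
      using Suc.prems(1)
      by (auto simp: sources_def row_sources_def all_walk_sources_def walk_sources_def)
    show "uniform_upto P (m n) (V n (m n + Suc d))" "random_sign P p (\<eta> n (m n + Suc d))"
      using Suc.prems(1) by (auto intro!: array_time array_sign)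
    show "X k \<in> borel_measurable (info ?A)" if "k \<in> {1..m n}" for k
      using that by (intro measurable_info_mono[OF sub measurable_X_info_all]) auto
  qed (use A m1 in \<open>auto simp: source_def\<close>)
  also have "\<dots> = (\<integral>\<omega>. (Z \<omega> * ?h \<omega>) * exp (z * of_real (?S \<omega>)) \<partial>P)"
    by (simp add: mult_ac)
  also have "\<dots> = (\<integral>\<omega>. (Z \<omega> * ?h \<omega>) * ?h \<omega> ^ d \<partial>P)"
  proof (rule Suc.IH)
    show "(\<lambda>\<omega>. Z \<omega> * ?h \<omega>) \<in> borel_measurable (info all_walk_sources)"
      using Suc.prems(2) by measurable
    show "norm (Z \<omega> * ?h \<omega>) \<le> B * (norm (cosh z) + norm (sinh z))" if w: "\<omega> \<in> space P" for \<omega>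
    proof -
      have "norm (?h \<omega>) \<le> norm (cosh z) + 1 * norm (sinh z)"
        using abs_bias_le[OF w m1]
        by (intro norm_triangle_le add_left_mono, unfold norm_mult norm_of_real, intro mult_right_mono) auto
      then have "norm (?h \<omega>) \<le> norm (cosh z) + norm (sinh z)"
        by (simp only: mult_1_left)
      then show ?thesis
        unfolding norm_mult by (intro mult_mono Suc.prems(3)[OF w] order_trans[OF norm_ge_zero Suc.prems(3)[OF w]] norm_ge_zero)
    qed
  qed (use Suc.prems in auto)
  finally show ?case by (simp add: mult.assoc)
qed

text \<open>The steps of row \<open>n\<close> that are not taken from the walk, minus their conditional mean given the walk.\<close>

definition noise :: "nat \<Rightarrow> 'a \<Rightarrow> real" where
  "noise n \<omega> = (\<Sum>j\<in>{m n<..n}. \<eta> n j \<omega> * X (V n j \<omega>) \<omega>) - real (n - m n) * (\<alpha> * erw_W X (m n) \<omega> / m n)"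

lemma erw_T_decomp:
  assumes n: "n \<ge> 1"
  shows "real (m n) / real n * erw_T X m V \<eta> n \<omega>
    = (real (m n) / n + \<alpha> * (1 - real (m n) / n)) * erw_W X (m n) \<omega> + real (m n) / n * noise n \<omega>"
proof -
  have mn: "1 \<le> m n" "m n \<le> n" using m_bounds[OF n] by auto
  have "{1..n} = {1..m n} \<union> {m n<..n}" using mn by auto
  then have "erw_T X m V \<eta> n \<omega> = (\<Sum>k\<in>{1..m n}. erw_Y X m V \<eta> n k \<omega>) + (\<Sum>k\<in>{m n<..n}. erw_Y X m V \<eta> n k \<omega>)"
    unfolding erw_T_def by (simp only:) (rule sum.union_disjoint, auto)
  also have "\<dots> = erw_W X (m n) \<omega> + (\<Sum>j\<in>{m n<..n}. \<eta> n j \<omega> * X (V n j \<omega>) \<omega>)"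
    by (intro arg_cong2[where f="(+)"]) (auto simp: erw_Y_def erw_W_def intro!: sum.cong)
  also have "\<dots> = erw_W X (m n) \<omega> + (noise n \<omega> + real (n - m n) * (\<alpha> * erw_W X (m n) \<omega> / m n))"
    by (simp add: noise_def)
  finally show ?thesis
    using mn n by (simp add: of_nat_diff field_simps)
qed

lemma noise_measurable [measurable]: "noise n \<in> borel_measurable P"
proof -
  have "(\<lambda>\<omega>. \<eta> n j \<omega> * X (V n j \<omega>) \<omega>) \<in> borel_measurable P" if "j \<in> {m n<..n}" for j
    by (rule measurable_info_P[OF row_sources_subset[OF order_refl] measurable_Y_row]) (use that in auto)
  then show ?thesis
    unfolding noise_def[abs_def] by (intro borel_measurable_diff borel_measurable_sum) auto
qed

lemma expectation_array_exp_centered: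
  fixes Z :: "'a \<Rightarrow> 'b::{real_normed_field, banach, second_countable_topology}"
  assumes n: "n \<ge> 1"
    and Z: "Z \<in> borel_measurable (info all_walk_sources)" "\<And>\<omega>. \<omega> \<in> space P \<Longrightarrow> norm (Z \<omega>) \<le> B"
  shows "(\<integral>\<omega>. Z \<omega> * exp (z * of_real (noise n \<omega>)) \<partial>P)
       = (\<integral>\<omega>. Z \<omega> * (exp (- z * of_real (\<alpha> * erw_W X (m n) \<omega> / m n))
           * (cosh z + of_real (\<alpha> * erw_W X (m n) \<omega> / m n) * sinh z)) ^ (n - m n) \<partial>P)"
proof -
  let ?x = "\<lambda>\<omega>. \<alpha> * erw_W X (m n) \<omega> / m n"
  let ?d = "n - m n"
  have mn: "1 \<le> m n" "m n \<le> n" "m n + ?d = n" using m_bounds[OF n] by auto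
  note [measurable] = measurable_W_info_all Z(1)
  have alg: "exp (z * of_real (noise n \<omega>))
      = exp (- z * of_real (?x \<omega>)) ^ ?d * exp (z * of_real (\<Sum>j\<in>{m n<..n}. \<eta> n j \<omega> * X (V n j \<omega>) \<omega>))" for \<omega>
    unfolding exp_of_nat_mult[symmetric] exp_add[symmetric] noise_def
    by (simp add: algebra_simps)
  have "(\<integral>\<omega>. Z \<omega> * exp (z * of_real (noise n \<omega>)) \<partial>P)
      = (\<integral>\<omega>. (Z \<omega> * exp (- z * of_real (?x \<omega>)) ^ ?d)
          * exp (z * of_real (\<Sum>j\<in>{m n<..m n + ?d}. \<eta> n j \<omega> * X (V n j \<omega>) \<omega>)) \<partial>P)"
    unfolding alg mn by (simp only: mult.assoc)
  also have "\<dots> = (\<integral>\<omega>. (Z \<omega> * exp (- z * of_real (?x \<omega>)) ^ ?d)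
       * (cosh z + of_real (?x \<omega>) * sinh z) ^ ?d \<partial>P)"
  proof (rule expectation_array_exp[OF n])
    show "(\<lambda>\<omega>. Z \<omega> * exp (- z * of_real (?x \<omega>)) ^ ?d) \<in> borel_measurable (info all_walk_sources)"
      by measurable
    show "norm (Z \<omega> * exp (- z * of_real (?x \<omega>)) ^ ?d) \<le> B * exp (norm z) ^ ?d" if w: "\<omega> \<in> space P" for \<omega>
    proof -
      have "norm (exp (- z * of_real (?x \<omega>))) \<le> exp (norm (- z * of_real (?x \<omega>)))" by (rule norm_exp)
      also have "norm (- z * of_real (?x \<omega>)) = norm z * \<bar>?x \<omega>\<bar>"
        by (simp only: norm_mult norm_minus_cancel norm_of_real)
      also have "exp \<dots> \<le> exp (norm z)"
        using mult_left_le[OF abs_bias_le[OF w mn(1)] norm_ge_zero] by simp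
      finally have e: "norm (exp (- z * of_real (?x \<omega>))) \<le> exp (norm z)" .
      show ?thesis
        unfolding norm_mult norm_power
        by (intro mult_mono power_mono e Z(2)[OF w] order_trans[OF norm_ge_zero Z(2)[OF w]] norm_ge_zero zero_le_power)
    qed
  qed (use mn in auto)
  finally show ?thesis by (simp only: mult.assoc power_mult_distrib)
qed

text \<open>Both \<open>n - m n\<close>-fold powers are powers of numbers in the unit disc, so their distance is at most
  \<open>n - m n\<close> times the distance of the bases, which \<open>biased_cos_approx\<close> bounds.\<close>

lemma array_char_bound:
  assumes n: "n \<ge> 1"
    and Z: "Z \<in> borel_measurable (info all_walk_sources)" "\<And>\<omega>. \<omega> \<in> space P \<Longrightarrow> cmod (Z \<omega>) \<le> 1"
  shows "cmod ((\<integral>\<omega>. Z \<omega> * iexp (\<theta> * noise n \<omega>) \<partial>P)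
      - (\<integral>\<omega>. Z \<omega> \<partial>P) * of_real (exp (- (real (n - m n) * \<theta>\<^sup>2) / 2)))
    \<le> real (n - m n) * \<theta>\<^sup>2 * (msq_ratio (m n) + 2 * \<bar>\<theta>\<bar>)"
proof -
  let ?x = "\<lambda>\<omega>. \<alpha> * erw_W X (m n) \<omega> / m n"
  let ?d = "n - m n"
  let ?z = "\<i> * complex_of_real \<theta>"
  let ?h = "\<lambda>\<omega>. exp (- ?z * of_real (?x \<omega>)) * (cosh ?z + of_real (?x \<omega>) * sinh ?z)"
  let ?e = "complex_of_real (exp (- \<theta>\<^sup>2 / 2))"
  have mn: "1 \<le> m n" "m n \<le> n" using m_bounds[OF n] by auto
  have [measurable]: "Z \<in> borel_measurable P"
    by (rule measurable_info_P[OF all_walk_sources_subset Z(1)])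
  have unit: "cmod (exp (- ?z * of_real y)) = 1" for y :: real by simp
  have h1: "cmod (?h \<omega>) \<le> 1" if w: "\<omega> \<in> space P" for \<omega>
    using cmod_biased_cos_le[OF abs_bias_le[OF w mn(1)], of \<theta>] by (simp only: norm_mult[of "exp _"] unit mult_1_left)
  have he: "cmod (?h \<omega> - ?e) \<le> \<theta>\<^sup>2 * (?x \<omega>)\<^sup>2 + 2 * \<bar>\<theta>\<bar> ^ 3" if w: "\<omega> \<in> space P" for \<omega>
  proof -
    have "exp (- ?z * of_real (?x \<omega>)) * iexp (\<theta> * ?x \<omega>) = 1"
      unfolding exp_add[symmetric] by simp
    then have "?h \<omega> - ?e = exp (- ?z * of_real (?x \<omega>))
        * (cosh ?z + of_real (?x \<omega>) * sinh ?z - iexp (\<theta> * ?x \<omega>) * ?e)"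
      by (simp only: right_diff_distrib mult.assoc[symmetric] mult_1_left)
    then show ?thesis
      using biased_cos_approx[OF abs_bias_le[OF w mn(1)], of \<theta>] by (simp only: norm_mult[of "exp _"] unit mult_1_left)
  qed
  have e1: "cmod ?e \<le> 1" by (simp only: norm_of_real) simp
  have pw: "cmod (Z \<omega> * ?h \<omega> ^ ?d - Z \<omega> * ?e ^ ?d) \<le> real ?d * \<theta>\<^sup>2 / (real (m n))\<^sup>2 * (erw_W X (m n) \<omega>)\<^sup>2 + real ?d * 2 * \<bar>\<theta>\<bar> ^ 3"
    if w: "\<omega> \<in> space P" for \<omega>
  proof -
    have "cmod (Z \<omega> * ?h \<omega> ^ ?d - Z \<omega> * ?e ^ ?d) = cmod (Z \<omega>) * cmod (?h \<omega> ^ ?d - ?e ^ ?d)"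
      by (simp only: right_diff_distrib[symmetric] norm_mult)
    also have "\<dots> \<le> 1 * (?d * cmod (?h \<omega> - ?e))"
      by (intro mult_mono norm_power_diff h1 e1 Z(2) w) auto
    also have "\<dots> \<le> 1 * (?d * (\<theta>\<^sup>2 * (?x \<omega>)\<^sup>2 + 2 * \<bar>\<theta>\<bar> ^ 3))"
      by (intro mult_left_mono he w) auto
    also have "\<dots> \<le> 1 * (?d * (\<theta>\<^sup>2 * ((erw_W X (m n) \<omega>)\<^sup>2 / (real (m n))\<^sup>2) + 2 * \<bar>\<theta>\<bar> ^ 3))"
      by (intro mult_left_mono add_right_mono bias_square_le) auto
    also have "\<dots> = real ?d * \<theta>\<^sup>2 / (real (m n))\<^sup>2 * (erw_W X (m n) \<omega>)\<^sup>2 + real ?d * 2 * \<bar>\<theta>\<bar> ^ 3"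
      by (simp add: distrib_left)
    finally show ?thesis .
  qed
  have int1: "integrable P (\<lambda>\<omega>. Z \<omega> * ?h \<omega> ^ ?d)"
  proof (rule integrable_const_bound[where B=1])
    have "cmod (Z \<omega> * ?h \<omega> ^ ?d) \<le> 1" if "\<omega> \<in> space P" for \<omega>
      unfolding norm_mult[of "Z \<omega>"] norm_power
      by (intro mult_le_one Z(2) power_le_one h1 that zero_le_power norm_ge_zero)
    then show "AE \<omega> in P. cmod (Z \<omega> * ?h \<omega> ^ ?d) \<le> 1" by (rule AE_I2)
  qed measurable
  have int2: "integrable P (\<lambda>\<omega>. Z \<omega> * ?e ^ ?d)"
    by (rule integrable_mult_left, rule integrable_const_bound[where B=1]) (use Z(2) in auto)
  have ed: "?e ^ ?d = of_real (exp (- (real ?d * \<theta>\<^sup>2) / 2))"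
    unfolding of_real_power[symmetric] exp_of_nat_mult[symmetric] by simp
  have lhs: "(\<integral>\<omega>. Z \<omega> * iexp (\<theta> * noise n \<omega>) \<partial>P) = (\<integral>\<omega>. Z \<omega> * ?h \<omega> ^ ?d \<partial>P)"
    using expectation_array_exp_centered[OF n Z, of ?z]
    by (simp only: of_real_mult mult.assoc)
  have eq: "(\<integral>\<omega>. Z \<omega> * iexp (\<theta> * noise n \<omega>) \<partial>P) - (\<integral>\<omega>. Z \<omega> \<partial>P) * of_real (exp (- (real ?d * \<theta>\<^sup>2) / 2))
      = (\<integral>\<omega>. Z \<omega> * ?h \<omega> ^ ?d - Z \<omega> * ?e ^ ?d \<partial>P)"
    unfolding lhs ed[symmetric] Bochner_Integration.integral_diff[OF int1 int2] integral_mult_left_zero ..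
  have "cmod (\<integral>\<omega>. Z \<omega> * ?h \<omega> ^ ?d - Z \<omega> * ?e ^ ?d \<partial>P)
     \<le> (\<integral>\<omega>. real ?d * \<theta>\<^sup>2 / (real (m n))\<^sup>2 * (erw_W X (m n) \<omega>)\<^sup>2 + real ?d * 2 * \<bar>\<theta>\<bar> ^ 3 \<partial>P)"
  proof (rule order_trans[OF integral_norm_bound integral_mono])
    show "integrable P (\<lambda>\<omega>. cmod (Z \<omega> * ?h \<omega> ^ ?d - Z \<omega> * ?e ^ ?d))"
      by (intro integrable_norm Bochner_Integration.integrable_diff int1 int2)
    show "integrable P (\<lambda>\<omega>. real ?d * \<theta>\<^sup>2 / (real (m n))\<^sup>2 * (erw_W X (m n) \<omega>)\<^sup>2 + real ?d * 2 * \<bar>\<theta>\<bar> ^ 3)"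
      using integrable_W_square[of "m n"] by auto
  qed (rule pw)
  also have "\<dots> = real ?d * \<theta>\<^sup>2 / (real (m n))\<^sup>2 * second_moment (m n) + real ?d * 2 * \<bar>\<theta>\<bar> ^ 3"
    using integrable_W_square[of "m n"] by (simp add: prob_space second_moment_def)
  also have "\<dots> = ?d * \<theta>\<^sup>2 * (msq_ratio (m n) + 2 * \<bar>\<theta>\<bar>)"
    by (simp add: msq_ratio_def distrib_left power3_eq_cube power2_eq_square)
  finally show ?thesis unfolding eq .
qed

text \<open>Asymptotic independence: the Gaussian factor coming from the row multiplies the limit of any bounded
  test variables that depend on the walk.\<close>

lemma array_char_limit:
  assumes m_lim: "filterlim m at_top sequentially"
    and Z: "\<And>n. Z n \<in> borel_measurable (info all_walk_sources)" "\<And>n \<omega>. \<omega> \<in> space P \<Longrightarrow> cmod (Z n \<omega>) \<le> 1"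
    and \<zeta>: "(\<lambda>n. \<integral>\<omega>. Z n \<omega> \<partial>P) \<longlonglongrightarrow> \<zeta>"
    and \<theta>: "\<theta> \<longlonglongrightarrow> 0" and v: "(\<lambda>n. real (n - m n) * (\<theta> n)\<^sup>2) \<longlonglongrightarrow> v"
  shows "(\<lambda>n. \<integral>\<omega>. Z n \<omega> * iexp (\<theta> n * noise n \<omega>) \<partial>P) \<longlonglongrightarrow> \<zeta> * of_real (exp (- v / 2))"
proof -
  let ?E = "\<lambda>n. \<integral>\<omega>. Z n \<omega> * iexp (\<theta> n * noise n \<omega>) \<partial>P"
  let ?F = "\<lambda>n. (\<integral>\<omega>. Z n \<omega> \<partial>P) * of_real (exp (- (real (n - m n) * (\<theta> n)\<^sup>2) / 2))"
  have "(\<lambda>n. real (n - m n) * (\<theta> n)\<^sup>2 * (msq_ratio (m n) + 2 * \<bar>\<theta> n\<bar>)) \<longlonglongrightarrow> v * (0 + 2 * \<bar>0\<bar>)"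
    by (intro tendsto_intros v \<theta> filterlim_compose[OF msq_ratio_tendsto_0 m_lim])
  then have err: "(\<lambda>n. real (n - m n) * (\<theta> n)\<^sup>2 * (msq_ratio (m n) + 2 * \<bar>\<theta> n\<bar>)) \<longlonglongrightarrow> 0" by simp
  have "(\<lambda>n. ?E n - ?F n) \<longlonglongrightarrow> 0"
    by (rule Lim_null_comparison[OF _ err])
       (intro eventually_sequentiallyI[of 1] array_char_bound Z)
  moreover have "?F \<longlonglongrightarrow> \<zeta> * of_real (exp (- v / 2))"
    by (intro tendsto_intros \<zeta> v) auto
  ultimately have "(\<lambda>n. (?E n - ?F n) + ?F n) \<longlonglongrightarrow> 0 + \<zeta> * of_real (exp (- v / 2))"
    by (rule tendsto_add)
  then show ?thesis by simp
qed

section \<open>Deviations of the rows\<close>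

lemma array_mgf_le:
  assumes n: "n \<ge> 1"
  shows "integrable P (\<lambda>\<omega>. exp (l * noise n \<omega>))" "(\<integral>\<omega>. exp (l * noise n \<omega>) \<partial>P) \<le> exp (real n * l\<^sup>2 / 2)"
proof -
  let ?x = "\<lambda>\<omega>. \<alpha> * erw_W X (m n) \<omega> / m n"
  let ?d = "n - m n"
  have mn: "1 \<le> m n" "m n \<le> n" using m_bounds[OF n] by auto
  have Sle: "\<bar>noise n \<omega>\<bar> \<le> 2 * ?d" if w: "\<omega> \<in> space P" for \<omega>
  proof -
    have "\<bar>\<Sum>j\<in>{m n<..n}. \<eta> n j \<omega> * X (V n j \<omega>) \<omega>\<bar> \<le> (\<Sum>j\<in>{m n<..n}. 1)"
      by (rule order_trans[OF sum_abs sum_mono]) (use Y_values[of n _ \<omega>] w in fastforce)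
    then have "\<bar>\<Sum>j\<in>{m n<..n}. \<eta> n j \<omega> * X (V n j \<omega>) \<omega>\<bar> \<le> real ?d" by simp
    moreover have "\<bar>real ?d * ?x \<omega>\<bar> \<le> real ?d * 1"
      unfolding abs_mult by (intro mult_mono abs_bias_le w mn) auto
    ultimately show ?thesis
      unfolding noise_def by (intro order_trans[OF abs_triangle_ineq4]) linarith
  qed
  have "l * noise n \<omega> \<le> \<bar>l\<bar> * (2 * ?d)" if "\<omega> \<in> space P" for \<omega>
  proof -
    have "l * noise n \<omega> \<le> \<bar>l\<bar> * \<bar>noise n \<omega>\<bar>"
      unfolding abs_mult[symmetric] by (rule abs_ge_self)
    also have "\<dots> \<le> \<bar>l\<bar> * (2 * ?d)"
      by (rule mult_left_mono[OF Sle[OF that]]) simp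
    finally show ?thesis .
  qed
  then show "integrable P (\<lambda>\<omega>. exp (l * noise n \<omega>))"
    by (intro integrable_const_bound[where B="exp (\<bar>l\<bar> * (2 * ?d))"] AE_I2) auto
  have "(\<integral>\<omega>. exp (l * noise n \<omega>) \<partial>P) = (\<integral>\<omega>. (exp (- l * ?x \<omega>) * (cosh l + ?x \<omega> * sinh l)) ^ ?d \<partial>P)"
    using expectation_array_exp_centered[OF n, of "\<lambda>_. 1 :: real" 1 l] by simp
  also have "\<dots> \<le> (\<integral>\<omega>. exp (l\<^sup>2 / 2) ^ ?d \<partial>P)"
  proof (rule integral_mono_AE')
    have "0 \<le> cosh l + ?x \<omega> * sinh l" if w: "\<omega> \<in> space P" for \<omega>
    proof -
      have "\<bar>?x \<omega> * sinh l\<bar> \<le> 1 * \<bar>sinh l\<bar>"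
        unfolding abs_mult by (intro mult_right_mono abs_bias_le w mn) auto
      moreover have "\<bar>sinh l\<bar> \<le> cosh l"
        by (simp add: abs_le_iff cosh_def sinh_def)
      ultimately show ?thesis by linarith
    qed
    then have nn: "0 \<le> exp (- l * ?x \<omega>) * (cosh l + ?x \<omega> * sinh l)" if "\<omega> \<in> space P" for \<omega>
      using that by simp
    show "AE \<omega> in P. (exp (- l * ?x \<omega>) * (cosh l + ?x \<omega> * sinh l)) ^ ?d \<le> exp (l\<^sup>2 / 2) ^ ?d"
      by (intro AE_I2 power_mono biased_cosh_le abs_bias_le nn) (use mn in auto)
  qed auto
  also have "\<dots> = exp (real ?d * l\<^sup>2 / 2)"
    by (simp add: prob_space exp_of_nat_mult[symmetric])
  also have "\<dots> \<le> exp (real n * l\<^sup>2 / 2)"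
    by (simp add: mult_right_mono divide_right_mono)
  finally show "(\<integral>\<omega>. exp (l * noise n \<omega>) \<partial>P) \<le> exp (real n * l\<^sup>2 / 2)" .
qed

lemma array_tail:
  assumes n: "n \<ge> 1" and u: "u \<ge> 0"
  shows "\<P>(\<omega> in P. u \<le> \<bar>noise n \<omega>\<bar>) \<le> 2 * exp (- (u\<^sup>2 / (2 * n)))"
proof -
  let ?l = "u / n"
  note int = array_mgf_le(1)[OF n, of ?l] array_mgf_le(1)[OF n, of "- ?l"]
  have "\<P>(\<omega> in P. u \<le> \<bar>noise n \<omega>\<bar>) = (\<integral>\<omega>. indicator {\<omega>\<in>space P. u \<le> \<bar>noise n \<omega>\<bar>} \<omega> \<partial>P)"
    by simp
  also have "\<dots> \<le> (\<integral>\<omega>. exp (- ?l * u) * (exp (?l * noise n \<omega>) + exp (- ?l * noise n \<omega>)) \<partial>P)"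
  proof (rule integral_mono)
    fix \<omega> assume "\<omega> \<in> space P"
    show "indicator {\<omega>\<in>space P. u \<le> \<bar>noise n \<omega>\<bar>} \<omega> \<le> exp (- ?l * u) * (exp (?l * noise n \<omega>) + exp (- ?l * noise n \<omega>))"
    proof (cases "u \<le> \<bar>noise n \<omega>\<bar>")
      case True
      have "exp (?l * u) \<le> exp (?l * \<bar>noise n \<omega>\<bar>)"
        using True u by (simp add: divide_right_mono mult_left_mono)
      also have "\<dots> \<le> exp (?l * noise n \<omega>) + exp (- ?l * noise n \<omega>)"
        by (cases "noise n \<omega> \<ge> 0") (auto simp: abs_of_nonneg abs_of_neg)
      finally have "exp (- ?l * u) * exp (?l * u) \<le> exp (- ?l * u) * (exp (?l * noise n \<omega>) + exp (- ?l * noise n \<omega>))"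
        by (intro mult_left_mono) auto
      then show ?thesis by (simp add: exp_add[symmetric] indicator_def)
    qed (auto simp: indicator_def intro!: mult_nonneg_nonneg add_nonneg_nonneg)
  qed (use int in \<open>auto intro!: integrable_real_indicator simp: less_top[symmetric]\<close>)
  also have "\<dots> = exp (- ?l * u) * ((\<integral>\<omega>. exp (?l * noise n \<omega>) \<partial>P) + (\<integral>\<omega>. exp (- ?l * noise n \<omega>) \<partial>P))"
    using int by simp
  also have "\<dots> \<le> exp (- ?l * u) * (exp (real n * ?l\<^sup>2 / 2) + exp (real n * (- ?l)\<^sup>2 / 2))"
    by (intro mult_left_mono add_mono array_mgf_le n) auto
  also have "\<dots> = 2 * (exp (- ?l * u) * exp (real n * ?l\<^sup>2 / 2))" by simp
  also have "exp (- ?l * u) * exp (real n * ?l\<^sup>2 / 2) = exp (- (u\<^sup>2 / (2 * n)))"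
    using n by (simp add: exp_add[symmetric] power2_eq_square field_simps)
  finally show ?thesis .
qed

text \<open>Read off from the exponential moments at \<open>1 / sqrt n\<close> and \<open>- 1 / sqrt n\<close>.\<close>

lemma array_second_moment:
  assumes n: "n \<ge> 1"
  shows "integrable P (\<lambda>\<omega>. (noise n \<omega>)\<^sup>2)" "(\<integral>\<omega>. (noise n \<omega>)\<^sup>2 \<partial>P) \<le> 4 * exp (1/2) * real n"
proof -
  let ?l = "1 / sqrt n"
  note int = array_mgf_le(1)[OF n, of ?l] array_mgf_le(1)[OF n, of "- ?l"]
  have sq: "y\<^sup>2 \<le> 2 * (exp y + exp (- y))" for y :: real
  proof -
    have *: "y\<^sup>2 \<le> 2 * (exp y + exp (- y))" if "y \<ge> 0" for y :: real
    proof -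
      have "1 + y + y\<^sup>2 / 2 \<le> exp y" by (rule exp_lower_Taylor_quadratic[OF that])
      then show ?thesis using that exp_gt_zero[of "-y"] unfolding distrib_left by linarith
    qed
    show ?thesis using *[of y] *[of "-y"] by (cases "y \<ge> 0") (auto simp: add.commute)
  qed
  have b: "(noise n \<omega>)\<^sup>2 \<le> 2 * real n * (exp (?l * noise n \<omega>) + exp (- ?l * noise n \<omega>))" for \<omega>
  proof -
    have "(noise n \<omega>)\<^sup>2 = real n * (?l * noise n \<omega>)\<^sup>2"
      using n by (simp add: power_mult_distrib power_divide)
    also have "\<dots> \<le> real n * (2 * (exp (?l * noise n \<omega>) + exp (- (?l * noise n \<omega>))))"
      by (intro mult_left_mono sq) auto
    finally show ?thesis by (simp add: algebra_simps)
  qed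
  show i: "integrable P (\<lambda>\<omega>. (noise n \<omega>)\<^sup>2)"
    by (rule Bochner_Integration.integrable_bound[where f="\<lambda>\<omega>. 2 * real n * (exp (?l * noise n \<omega>) + exp (- ?l * noise n \<omega>))"])
       (use int b in \<open>auto intro!: AE_I2 order_trans[OF b]\<close>)
  have "(\<integral>\<omega>. (noise n \<omega>)\<^sup>2 \<partial>P) \<le> (\<integral>\<omega>. 2 * real n * (exp (?l * noise n \<omega>) + exp (- ?l * noise n \<omega>)) \<partial>P)"
    by (rule integral_mono) (use i int b in auto)
  also have "\<dots> = 2 * real n * ((\<integral>\<omega>. exp (?l * noise n \<omega>) \<partial>P) + (\<integral>\<omega>. exp (- ?l * noise n \<omega>) \<partial>P))"
    using int by simp
  also have "\<dots> \<le> 2 * real n * (exp (real n * ?l\<^sup>2 / 2) + exp (real n * (- ?l)\<^sup>2 / 2))"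
    by (intro mult_left_mono add_mono array_mgf_le n) auto
  also have "\<dots> = 4 * exp (1/2) * real n"
    using n by (simp add: power_divide)
  finally show "(\<integral>\<omega>. (noise n \<omega>)\<^sup>2 \<partial>P) \<le> 4 * exp (1/2) * real n" .
qed

section \<open>Central limit theorems for the triangular array\<close>

definition gam :: "nat \<Rightarrow> real" where
  "gam n = real (m n) / real n"

text \<open>The coefficient of \<open>W (m n)\<close> in \<open>gam n * T n\<close>.\<close>

definition drift :: "nat \<Rightarrow> real" where
  "drift n = gam n + \<alpha> * (1 - gam n)"

lemma gam_T:
  assumes "n \<ge> 1"
  shows "gam n * erw_T X m V \<eta> n \<omega> = drift n * erw_W X (m n) \<omega> + gam n * noise n \<omega>"
  using erw_T_decomp[OF assms] unfolding drift_def gam_def .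

lemma gam_bounds:
  assumes "n \<ge> 1"
  shows "0 < gam n" "gam n \<le> 1"
  using m_bounds[OF assms] assms by (auto simp: gam_def)

lemma gam_variance_nonneg: "n \<ge> 1 \<Longrightarrow> 0 \<le> gam n * (1 - gam n)"
  using gam_bounds[of n] by (intro mult_nonneg_nonneg) auto

lemma gam_T_measurable: "(\<lambda>\<omega>. gam n * erw_T X m V \<eta> n \<omega>) \<in> borel_measurable P"
proof (cases "n \<ge> 1")
  case True
  then show ?thesis unfolding gam_T[OF True] by measurable
next
  case False
  then have "n = 0" by simp
  then show ?thesis by (simp add: gam_def)
qed

text \<open>The conditional variance contributed by the row is governed by \<open>gam n * (1 - gam n)\<close>, which is
  the source of the term \<open>\<gamma> * (1 - \<gamma>)\<close> in the limit laws.\<close>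

lemma residual_variance:
  assumes "n \<ge> 1"
  shows "real (n - m n) * (t * gam n / L)\<^sup>2 = t\<^sup>2 * (gam n * (1 - gam n)) * (real (m n) / L\<^sup>2)"
  using m_bounds[OF assms] assms
  by (simp add: gam_def of_nat_diff power2_eq_square field_simps)

text \<open>The critical and the subcritical case differ only in the normalization \<open>L\<close>, which is left open here.\<close>

lemma clt_le_half:
  assumes a: "\<alpha> \<le> 1/2" and m_lim: "filterlim m at_top sequentially"
    and A: "(\<lambda>n. drift n * (real (m n) powr \<alpha> * sqrt (weight_sum (m n)) / L n)) \<longlonglongrightarrow> A"
    and G: "(\<lambda>n. gam n / L n) \<longlonglongrightarrow> 0"
    and v: "(\<lambda>n. gam n * (1 - gam n) * (real (m n) / (L n)\<^sup>2)) \<longlonglongrightarrow> v"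
  shows "conv_in_law P (\<lambda>n \<omega>. gam n * erw_T X m V \<eta> n \<omega> / L n) (centered_normal (A\<^sup>2 + v))"
proof (rule conv_in_law_normalI)
  show "(\<lambda>\<omega>. gam n * erw_T X m V \<eta> n \<omega> / L n) \<in> borel_measurable P" for n
    using gam_T_measurable[of n] by measurable
  have "0 \<le> v"
  proof (rule LIMSEQ_le_const[OF v], intro exI[of _ 1] allI impI)
    fix n :: nat assume "1 \<le> n"
    then show "0 \<le> gam n * (1 - gam n) * (real (m n) / (L n)\<^sup>2)"
      by (intro mult_nonneg_nonneg[OF gam_variance_nonneg]) auto
  qed
  then show "0 \<le> A\<^sup>2 + v" by simp
  fix t :: real
  define \<tau> where "\<tau> n = t * (drift n * (real (m n) powr \<alpha> * sqrt (weight_sum (m n)) / L n))" for n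
  define \<theta> where "\<theta> n = t * gam n / L n" for n
  define Z where "Z n \<omega> = iexp (\<tau> n * (real (m n) powr (- \<alpha>) * erw_W X (m n) \<omega> / sqrt (weight_sum (m n))))" for n \<omega>
  have "\<tau> \<longlonglongrightarrow> t * A" unfolding \<tau>_def by (intro tendsto_intros A)
  then have Z_lim: "(\<lambda>n. \<integral>\<omega>. Z n \<omega> \<partial>P) \<longlonglongrightarrow> of_real (exp (- (t * A)\<^sup>2 / 2))"
    unfolding Z_def by (rule walk_clt_le_half[OF a m_lim])
  have "(\<lambda>n. \<integral>\<omega>. Z n \<omega> * iexp (\<theta> n * noise n \<omega>) \<partial>P)
      \<longlonglongrightarrow> of_real (exp (- (t * A)\<^sup>2 / 2)) * of_real (exp (- (t\<^sup>2 * v) / 2))"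
  proof (rule array_char_limit[OF m_lim _ _ Z_lim])
    show "Z n \<in> borel_measurable (info all_walk_sources)" for n
      unfolding Z_def using measurable_W_info_all[of "m n"] by measurable
    show "cmod (Z n \<omega>) \<le> 1" for n \<omega> by (simp add: Z_def)
    show "\<theta> \<longlonglongrightarrow> 0" using tendsto_mult[OF tendsto_const[of t] G] by (simp add: \<theta>_def[abs_def])
    have "(\<lambda>n. t\<^sup>2 * (gam n * (1 - gam n) * (real (m n) / (L n)\<^sup>2))) \<longlonglongrightarrow> t\<^sup>2 * v"
      by (intro tendsto_intros v)
    then show "(\<lambda>n. real (n - m n) * (\<theta> n)\<^sup>2) \<longlonglongrightarrow> t\<^sup>2 * v"
      by (rule Lim_transform_eventually)
         (auto simp: \<theta>_def residual_variance mult.assoc intro!: eventually_sequentiallyI[of 1])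
  qed
  moreover have "of_real (exp (- (t * A)\<^sup>2 / 2)) * complex_of_real (exp (- (t\<^sup>2 * v) / 2))
      = of_real (exp (- ((A\<^sup>2 + v) * t\<^sup>2) / 2))"
    unfolding of_real_mult[symmetric] exp_add[symmetric]
    by (simp add: power_mult_distrib algebra_simps add_divide_distrib)
  ultimately have lim: "(\<lambda>n. \<integral>\<omega>. Z n \<omega> * iexp (\<theta> n * noise n \<omega>) \<partial>P) \<longlonglongrightarrow> of_real (exp (- ((A\<^sup>2 + v) * t\<^sup>2) / 2))"
    by (simp only:)
  have "(\<integral>\<omega>. Z n \<omega> * iexp (\<theta> n * noise n \<omega>) \<partial>P) = (\<integral>\<omega>. iexp (t * (gam n * erw_T X m V \<eta> n \<omega> / L n)) \<partial>P)"
    if n: "n \<ge> 1" for n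
  proof -
    have mn: "m n \<ge> 1" using m_bounds[OF n] by simp
    then have s: "sqrt (weight_sum (m n)) > 0" using weight_sum_ge_1[OF mn] by simp
    have "\<tau> n * (real (m n) powr (- \<alpha>) * w / sqrt (weight_sum (m n))) + \<theta> n * noise n \<omega>
        = t * ((drift n * w + gam n * noise n \<omega>) / L n)" for w \<omega>
      using s mn by (simp add: \<tau>_def \<theta>_def powr_minus_divide add_divide_distrib algebra_simps)
    then show ?thesis
      unfolding Z_def exp_add[symmetric] distrib_left[symmetric] of_real_add[symmetric] gam_T[OF n]
      by (simp only:)
  qed
  then show "(\<lambda>n. \<integral>\<omega>. iexp (t * (gam n * erw_T X m V \<eta> n \<omega> / L n)) \<partial>P) \<longlonglongrightarrow> of_real (exp (- ((A\<^sup>2 + v) * t\<^sup>2) / 2))"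
    by (intro Lim_transform_eventually[OF lim] eventually_sequentiallyI[of 1])
qed

text \<open>The limit \<open>M\<close> is only known to be a random variable on the whole space. It is replaced by the pointwise
  limit \<open>M'\<close> of the walk, which agrees with it almost surely and is a function of the walk alone, so that
  \<open>array_char_limit\<close> applies.\<close>

lemma clt_gt_half:
  assumes a: "1/2 < \<alpha>" and m_lim: "filterlim m at_top sequentially" and g: "gam \<longlonglongrightarrow> \<gamma>"
    and M: "M \<in> borel_measurable P" "AE \<omega> in P. (\<lambda>N. erw_W X N \<omega> / real N powr \<alpha>) \<longlonglongrightarrow> M \<omega>"
  shows "conv_in_law P (\<lambda>n \<omega>. (gam n * erw_T X m V \<eta> n \<omega> - M \<omega> * drift n * real (m n) powr \<alpha>) / sqrt (m n))
     (centered_normal ((\<gamma> + \<alpha> * (1 - \<gamma>))\<^sup>2 / (2 * \<alpha> - 1) + \<gamma> * (1 - \<gamma>)))"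
proof (rule conv_in_law_normalI)
  show meas: "(\<lambda>\<omega>. (gam n * erw_T X m V \<eta> n \<omega> - M \<omega> * drift n * real (m n) powr \<alpha>) / sqrt (m n)) \<in> borel_measurable P" for n
    using gam_T_measurable[of n] M(1) by measurable
  have v: "(\<lambda>n. gam n * (1 - gam n)) \<longlonglongrightarrow> \<gamma> * (1 - \<gamma>)"
    by (intro tendsto_intros g)
  have "0 \<le> \<gamma> * (1 - \<gamma>)"
    by (rule LIMSEQ_le_const[OF v]) (use gam_variance_nonneg in blast)
  then show "0 \<le> (\<gamma> + \<alpha> * (1 - \<gamma>))\<^sup>2 / (2 * \<alpha> - 1) + \<gamma> * (1 - \<gamma>)"
    using a by simp
  fix t :: real
  define M' where "M' \<omega> = lim (\<lambda>N. erw_W X N \<omega> / real N powr \<alpha>)" for \<omega>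
  have M'_info: "M' \<in> borel_measurable (info all_walk_sources)"
    unfolding M'_def
    by (intro borel_measurable_lim_metric borel_measurable_divide borel_measurable_const measurable_W_info_all)
  have [measurable]: "M' \<in> borel_measurable P"
    by (rule measurable_info_P[OF all_walk_sources_subset M'_info])
  have MM': "AE \<omega> in P. M \<omega> = M' \<omega>"
    using M(2) by eventually_elim (simp add: M'_def limI)
  have M'_lim: "AE \<omega> in P. (\<lambda>N. erw_W X N \<omega> / real N powr \<alpha>) \<longlonglongrightarrow> M' \<omega>"
    using M(2) MM' by eventually_elim simp
  define \<tau> where "\<tau> n = t * drift n" for n
  define \<theta> where "\<theta> n = t * gam n / sqrt (m n)" for n
  define Z where "Z n \<omega> = iexp (\<tau> n * ((erw_W X (m n) \<omega> - M' \<omega> * real (m n) powr \<alpha>) / sqrt (m n)))" for n \<omega>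
  let ?c = "\<gamma> + \<alpha> * (1 - \<gamma>)"
  have "\<tau> \<longlonglongrightarrow> t * ?c" unfolding \<tau>_def drift_def by (intro tendsto_intros g)
  then have Z_lim: "(\<lambda>n. \<integral>\<omega>. Z n \<omega> \<partial>P) \<longlonglongrightarrow> of_real (exp (- ((t * ?c)\<^sup>2 / (2 * \<alpha> - 1)) / 2))"
    unfolding Z_def by (rule walk_clt_gt_half[OF a m_lim]) (use M'_lim in auto)
  have "(\<lambda>n. \<integral>\<omega>. Z n \<omega> * iexp (\<theta> n * noise n \<omega>) \<partial>P)
      \<longlonglongrightarrow> of_real (exp (- ((t * ?c)\<^sup>2 / (2 * \<alpha> - 1)) / 2)) * of_real (exp (- (t\<^sup>2 * (\<gamma> * (1 - \<gamma>))) / 2))"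
  proof (rule array_char_limit[OF m_lim _ _ Z_lim])
    show "Z n \<in> borel_measurable (info all_walk_sources)" for n
      unfolding Z_def using measurable_W_info_all[of "m n"] M'_info by measurable
    show "cmod (Z n \<omega>) \<le> 1" for n \<omega> by (simp add: Z_def)
    have "(\<lambda>k. 1 / sqrt (real k)) \<longlonglongrightarrow> 0" by real_asymp
    from filterlim_compose[OF this m_lim]
    have "(\<lambda>n. t * gam n * (1 / sqrt (m n))) \<longlonglongrightarrow> t * \<gamma> * 0"
      by (intro tendsto_intros g)
    then show "\<theta> \<longlonglongrightarrow> 0" by (simp add: \<theta>_def[abs_def])
    have "(\<lambda>n. t\<^sup>2 * (gam n * (1 - gam n))) \<longlonglongrightarrow> t\<^sup>2 * (\<gamma> * (1 - \<gamma>))"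
      by (intro tendsto_intros v)
    then show "(\<lambda>n. real (n - m n) * (\<theta> n)\<^sup>2) \<longlonglongrightarrow> t\<^sup>2 * (\<gamma> * (1 - \<gamma>))"
    proof (rule Lim_transform_eventually, intro eventually_sequentiallyI[of 1])
      fix n :: nat assume n: "n \<ge> 1"
      show "t\<^sup>2 * (gam n * (1 - gam n)) = real (n - m n) * (\<theta> n)\<^sup>2"
        unfolding \<theta>_def residual_variance[OF n] using m_bounds[OF n] by simp
    qed
  qed
  moreover have "of_real (exp (- ((t * ?c)\<^sup>2 / (2 * \<alpha> - 1)) / 2)) * complex_of_real (exp (- (t\<^sup>2 * (\<gamma> * (1 - \<gamma>))) / 2))
      = of_real (exp (- ((?c\<^sup>2 / (2 * \<alpha> - 1) + \<gamma> * (1 - \<gamma>)) * t\<^sup>2) / 2))"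
  proof -
    have "- ((t * ?c)\<^sup>2 / (2 * \<alpha> - 1)) / 2 + - (t\<^sup>2 * (\<gamma> * (1 - \<gamma>))) / 2
       = - ((?c\<^sup>2 / (2 * \<alpha> - 1) + \<gamma> * (1 - \<gamma>)) * t\<^sup>2) / 2"
      unfolding power_mult_distrib by (simp add: ring_distribs mult_ac add_divide_distrib diff_divide_distrib)
    then show ?thesis
      unfolding of_real_mult[symmetric] exp_add[symmetric] by (simp only:)
  qed
  ultimately have lim: "(\<lambda>n. \<integral>\<omega>. Z n \<omega> * iexp (\<theta> n * noise n \<omega>) \<partial>P)
      \<longlonglongrightarrow> of_real (exp (- ((?c\<^sup>2 / (2 * \<alpha> - 1) + \<gamma> * (1 - \<gamma>)) * t\<^sup>2) / 2))"
    by (simp only:)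
  have "(\<integral>\<omega>. Z n \<omega> * iexp (\<theta> n * noise n \<omega>) \<partial>P)
      = (\<integral>\<omega>. iexp (t * ((gam n * erw_T X m V \<eta> n \<omega> - M \<omega> * drift n * real (m n) powr \<alpha>) / sqrt (m n))) \<partial>P)"
    if n: "n \<ge> 1" for n
  proof (rule integral_cong_AE)
    show "(\<lambda>\<omega>. Z n \<omega> * iexp (\<theta> n * noise n \<omega>)) \<in> borel_measurable P"
      unfolding Z_def by measurable
    show "(\<lambda>\<omega>. iexp (t * ((gam n * erw_T X m V \<eta> n \<omega> - M \<omega> * drift n * real (m n) powr \<alpha>) / sqrt (m n)))) \<in> borel_measurable P"
      using meas[of n] by measurable
    show "AE \<omega> in P. Z n \<omega> * iexp (\<theta> n * noise n \<omega>)
        = iexp (t * ((gam n * erw_T X m V \<eta> n \<omega> - M \<omega> * drift n * real (m n) powr \<alpha>) / sqrt (m n)))"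
      using MM'
    proof eventually_elim
      case (elim \<omega>)
      have "\<tau> n * ((w - M \<omega> * real (m n) powr \<alpha>) / sqrt (m n)) + \<theta> n * noise n \<omega>
        = t * ((drift n * w + gam n * noise n \<omega> - M \<omega> * drift n * real (m n) powr \<alpha>) / sqrt (m n))" for w
        by (simp add: \<tau>_def \<theta>_def add_divide_distrib diff_divide_distrib algebra_simps)
      then show ?case
        unfolding Z_def exp_add[symmetric] distrib_left[symmetric] of_real_add[symmetric] gam_T[OF n] elim[symmetric]
        by (simp only:)
    qed
  qed
  then show "(\<lambda>n. \<integral>\<omega>. iexp (t * ((gam n * erw_T X m V \<eta> n \<omega> - M \<omega> * drift n * real (m n) powr \<alpha>) / sqrt (m n))) \<partial>P)
      \<longlonglongrightarrow> of_real (exp (- ((?c\<^sup>2 / (2 * \<alpha> - 1) + \<gamma> * (1 - \<gamma>)) * t\<^sup>2) / 2))"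
    by (intro Lim_transform_eventually[OF lim] eventually_sequentiallyI[of 1])
qed

lemma clt_subcritical:
  assumes a: "\<alpha> < 1/2" and m_lim: "filterlim m at_top sequentially" and g: "gam \<longlonglongrightarrow> \<gamma>"
  shows "conv_in_law P (\<lambda>n \<omega>. gam n * erw_T X m V \<eta> n \<omega> / sqrt (m n))
    (centered_normal ((\<gamma> + \<alpha> * (1 - \<gamma>))\<^sup>2 / (1 - 2 * \<alpha>) + \<gamma> * (1 - \<gamma>)))"
proof -
  let ?c = "\<gamma> + \<alpha> * (1 - \<gamma>)"
  have d: "drift \<longlonglongrightarrow> ?c" unfolding drift_def by (intro tendsto_intros g)
  have ev: "\<forall>\<^sub>F n in sequentially. n \<ge> 1" by (rule eventually_ge_at_top)
  have "conv_in_law P (\<lambda>n \<omega>. gam n * erw_T X m V \<eta> n \<omega> / sqrt (m n))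
    (centered_normal ((?c * sqrt (1 / (1 - 2 * \<alpha>)))\<^sup>2 + \<gamma> * (1 - \<gamma>)))"
  proof (rule clt_le_half[OF less_imp_le[OF a] m_lim])
    have "(\<lambda>n. drift n * sqrt (weight_sum (m n) / real (m n) powr (1 - 2 * \<alpha>))) \<longlonglongrightarrow> ?c * sqrt (1 / (1 - 2 * \<alpha>))"
      by (intro tendsto_mult d tendsto_real_sqrt filterlim_compose[OF weight_sum_asymp_less_half[OF a] m_lim])
    then show "(\<lambda>n. drift n * (real (m n) powr \<alpha> * sqrt (weight_sum (m n)) / sqrt (m n))) \<longlonglongrightarrow> ?c * sqrt (1 / (1 - 2 * \<alpha>))"
    proof (rule Lim_transform_eventually, use ev in eventually_elim)
      case (elim n)
      have mn: "real (m n) > 0" using m_bounds[OF elim] by simp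
      have "sqrt (real (m n) powr (1 - 2 * \<alpha>)) = real (m n) powr ((1 - 2 * \<alpha>) / 2)"
        by (simp add: powr_half_sqrt_powr)
      also have "(1 - 2 * \<alpha>) / 2 = 1 / 2 - \<alpha>" by simp
      also have "real (m n) powr (1 / 2 - \<alpha>) = sqrt (m n) / real (m n) powr \<alpha>"
        using mn by (simp add: powr_diff powr_half_sqrt)
      finally have "sqrt (real (m n) powr (1 - 2 * \<alpha>)) = sqrt (m n) / real (m n) powr \<alpha>" .
      then show ?case by (simp add: real_sqrt_divide)
    qed
    have "(\<lambda>k. 1 / sqrt (real k)) \<longlonglongrightarrow> 0" by real_asymp
    from filterlim_compose[OF this m_lim] have "(\<lambda>n. gam n * (1 / sqrt (m n))) \<longlonglongrightarrow> \<gamma> * 0"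
      by (intro tendsto_intros g)
    then show "(\<lambda>n. gam n / sqrt (m n)) \<longlonglongrightarrow> 0" by simp
    have "(\<lambda>n. gam n * (1 - gam n)) \<longlonglongrightarrow> \<gamma> * (1 - \<gamma>)" by (intro tendsto_intros g)
    then show "(\<lambda>n. gam n * (1 - gam n) * (real (m n) / (sqrt (m n))\<^sup>2)) \<longlonglongrightarrow> \<gamma> * (1 - \<gamma>)"
    proof (rule Lim_transform_eventually, use ev in eventually_elim)
      case (elim n)
      then show ?case using m_bounds[OF elim] by simp
    qed
  qed
  moreover have "(?c * sqrt (1 / (1 - 2 * \<alpha>)))\<^sup>2 = ?c\<^sup>2 / (1 - 2 * \<alpha>)"
    using a unfolding power_mult_distrib by (subst real_sqrt_pow2) auto
  ultimately show ?thesis by simp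
qed

lemma clt_critical:
  assumes a: "\<alpha> = 1/2" and m_lim: "filterlim m at_top sequentially" and g: "gam \<longlonglongrightarrow> \<gamma>"
  shows "conv_in_law P (\<lambda>n \<omega>. gam n * erw_T X m V \<eta> n \<omega> / sqrt (real (m n) * ln (m n)))
    (centered_normal ((1 + \<gamma>)\<^sup>2 / 4))"
proof -
  have d: "drift \<longlonglongrightarrow> \<gamma> + \<alpha> * (1 - \<gamma>)" unfolding drift_def by (intro tendsto_intros g)
  have ev: "\<forall>\<^sub>F n in sequentially. m n > 1"
    by (rule eventually_compose_filterlim[OF eventually_gt_at_top m_lim])
  have "conv_in_law P (\<lambda>n \<omega>. gam n * erw_T X m V \<eta> n \<omega> / sqrt (real (m n) * ln (m n)))
    (centered_normal (((\<gamma> + \<alpha> * (1 - \<gamma>)) * sqrt 1)\<^sup>2 + 0))"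
  proof (rule clt_le_half[OF eq_refl[OF a] m_lim])
    have "(\<lambda>n. drift n * sqrt (weight_sum (m n) / ln (m n))) \<longlonglongrightarrow> (\<gamma> + \<alpha> * (1 - \<gamma>)) * sqrt 1"
      by (intro tendsto_mult d tendsto_real_sqrt filterlim_compose[OF weight_sum_asymp_half[OF a] m_lim])
    then show "(\<lambda>n. drift n * (real (m n) powr \<alpha> * sqrt (weight_sum (m n)) / sqrt (real (m n) * ln (m n))))
        \<longlonglongrightarrow> (\<gamma> + \<alpha> * (1 - \<gamma>)) * sqrt 1"
    proof (rule Lim_transform_eventually, use ev in eventually_elim)
      case (elim n)
      have "real (m n) powr \<alpha> = sqrt (m n)" using elim by (simp add: a powr_half_sqrt)
      then show ?case using elim by (simp add: real_sqrt_divide real_sqrt_mult)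
    qed
    have "(\<lambda>k. 1 / sqrt (real k * ln (real k))) \<longlonglongrightarrow> 0" by real_asymp
    from filterlim_compose[OF this m_lim]
    have "(\<lambda>n. gam n * (1 / sqrt (real (m n) * ln (m n)))) \<longlonglongrightarrow> \<gamma> * 0"
      by (intro tendsto_intros g)
    then show "(\<lambda>n. gam n / sqrt (real (m n) * ln (m n))) \<longlonglongrightarrow> 0" by simp
    have "(\<lambda>k. 1 / ln (real k)) \<longlonglongrightarrow> 0" by real_asymp
    from filterlim_compose[OF this m_lim]
    have "(\<lambda>n. gam n * (1 - gam n) * (1 / ln (m n))) \<longlonglongrightarrow> \<gamma> * (1 - \<gamma>) * 0"
      by (intro tendsto_intros g)
    then have "(\<lambda>n. gam n * (1 - gam n) * (1 / ln (m n))) \<longlonglongrightarrow> 0" by simp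
    then show "(\<lambda>n. gam n * (1 - gam n) * (real (m n) / (sqrt (real (m n) * ln (m n)))\<^sup>2)) \<longlonglongrightarrow> 0"
    proof (rule Lim_transform_eventually, use ev in eventually_elim)
      case (elim n)
      then show ?case by simp
    qed
  qed
  moreover have "((\<gamma> + \<alpha> * (1 - \<gamma>)) * sqrt 1)\<^sup>2 + 0 = (1 + \<gamma>)\<^sup>2 / 4"
    unfolding a by (simp add: power2_eq_square field_simps)
  ultimately show ?thesis by (simp only:)
qed

section \<open>Strong and mean-square convergence\<close>

text \<open>By \<open>array_tail\<close> the probability that the normalized fluctuation exceeds \<open>n powr (- b)\<close> is at most
  \<open>2 * exp (- n powr (2 * \<alpha> - 1 - 2 * b) / 2)\<close>, since \<open>m n \<le> n\<close>. With \<open>b = (2 * \<alpha> - 1) / 4\<close> this is summable while the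
  thresholds still tend to \<open>0\<close>. An exponential bound is used because moments of a fixed order give a
  summable bound only for \<open>\<alpha>\<close> away from \<open>1/2\<close>.\<close>

lemma array_fluctuation_as:
  assumes a: "1/2 < \<alpha>"
  shows "AE \<omega> in P. (\<lambda>n. gam n * noise n \<omega> / real (m n) powr \<alpha>) \<longlonglongrightarrow> 0"
proof -
  define b where "b = (2 * \<alpha> - 1) / 4"
  have b: "b > 0" using a by (simp add: b_def)
  define u where "u n = real n powr (- b) * (real n * real (m n) powr (\<alpha> - 1))" for n
  define A where "A n = {\<omega>\<in>space P. u n \<le> \<bar>noise n \<omega>\<bar>}" for n
  have A: "A n \<in> sets P" for n unfolding A_def by measurable
  have pA: "measure P (A n) \<le> 2 * exp (- (real n powr (2 * b) / 2))" if n: "n \<ge> 1" for n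
  proof -
    have mn: "1 \<le> m n" "m n \<le> n" using m_bounds[OF n] by auto
    have "measure P (A n) \<le> 2 * exp (- ((u n)\<^sup>2 / (2 * n)))"
      unfolding A_def by (rule array_tail[OF n]) (simp add: u_def)
    also have "\<dots> \<le> 2 * exp (- (real n powr (2 * b) / 2))"
    proof -
      have "real n powr (\<alpha> - 1) \<le> real (m n) powr (\<alpha> - 1)"
        using mn abs_alpha_less_1 by (intro powr_mono2') auto
      then have "real n powr (- b) * (real n * real n powr (\<alpha> - 1)) \<le> u n"
        unfolding u_def by (intro mult_left_mono) auto
      moreover have "real n powr (- b) * (real n * real n powr (\<alpha> - 1)) = real n powr (\<alpha> - b)"
        using n by (simp add: powr_mult_base powr_add[symmetric])
      ultimately have "(real n powr (\<alpha> - b))\<^sup>2 \<le> (u n)\<^sup>2"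
        by (intro power_mono) auto
      moreover have "(real n powr (\<alpha> - b))\<^sup>2 = real n powr (2 * b) * real n"
      proof -
        have "(real n powr (\<alpha> - b))\<^sup>2 = real n powr ((\<alpha> - b) + (\<alpha> - b))"
          by (simp only: powr_add power2_eq_square)
        also have "(\<alpha> - b) + (\<alpha> - b) = 2 * b + 1" by (simp add: b_def field_simps)
        finally show ?thesis using n by (simp add: powr_add)
      qed
      ultimately show ?thesis using n by (simp add: field_simps)
    qed
    finally show ?thesis .
  qed
  have "summable (\<lambda>n. measure P (A n))"
  proof (rule summable_comparison_test_ev)
    show "summable (\<lambda>n. 2 * real n powr (-2))"
      by (intro summable_mult) (simp add: summable_real_powr_iff)
    have "\<forall>\<^sub>F n in sequentially. exp (- (real n powr (2 * b) / 2)) \<le> real n powr (-2)"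
      using b by real_asymp
    then show "\<forall>\<^sub>F n in sequentially. norm (measure P (A n)) \<le> 2 * real n powr (-2)"
      using eventually_ge_at_top[of 1]
    proof eventually_elim
      case (elim n)
      show ?case using pA[OF elim(2)] elim(1) by simp
    qed
  qed
  then have "AE \<omega> in P. \<forall>\<^sub>F n in sequentially. \<omega> \<in> space P - A n"
    by (intro borel_cantelli_AE1 A) (auto simp: less_top[symmetric])
  then show ?thesis
  proof eventually_elim
    case (elim \<omega>)
    have lim: "(\<lambda>n. real n powr (- b)) \<longlonglongrightarrow> 0" using b by real_asymp
    show ?case
    proof (rule Lim_null_comparison[OF _ lim])
      show "\<forall>\<^sub>F n in sequentially. norm (gam n * noise n \<omega> / real (m n) powr \<alpha>) \<le> real n powr (- b)"
        using elim eventually_ge_at_top[of 1]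
      proof eventually_elim
        case (elim n)
        have mn: "real (m n) > 0" "real n > 0" using m_bounds[of n] elim by auto
        have "\<bar>noise n \<omega>\<bar> \<le> u n" using elim by (auto simp: A_def)
        then have "gam n / real (m n) powr \<alpha> * \<bar>noise n \<omega>\<bar> \<le> gam n / real (m n) powr \<alpha> * u n"
          using gam_bounds[of n] elim by (intro mult_left_mono) auto
        also have "\<dots> = real n powr (- b)"
          using mn by (simp add: gam_def u_def powr_diff)
        finally show ?case using gam_bounds[of n] elim by (simp add: abs_mult)
      qed
    qed
  qed
qed

lemma scaled_T_as:
  assumes a: "1/2 < \<alpha>" and m_lim: "filterlim m at_top sequentially" and g: "gam \<longlonglongrightarrow> \<gamma>"
    and M: "AE \<omega> in P. (\<lambda>N. erw_W X N \<omega> / real N powr \<alpha>) \<longlonglongrightarrow> M \<omega>"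
  shows "AE \<omega> in P. (\<lambda>n. gam n * erw_T X m V \<eta> n \<omega> / real (m n) powr \<alpha>) \<longlonglongrightarrow> (\<gamma> + \<alpha> * (1 - \<gamma>)) * M \<omega>"
  using M array_fluctuation_as[OF a]
proof eventually_elim
  case (elim \<omega>)
  have "(\<lambda>n. drift n * (erw_W X (m n) \<omega> / real (m n) powr \<alpha>) + gam n * noise n \<omega> / real (m n) powr \<alpha>)
      \<longlonglongrightarrow> (\<gamma> + \<alpha> * (1 - \<gamma>)) * M \<omega> + 0"
    unfolding drift_def by (intro tendsto_intros g elim filterlim_compose[OF elim(1) m_lim])
  then show ?case
    unfolding add_0_right
    by (rule Lim_transform_eventually)
       (auto simp: gam_T add_divide_distrib intro!: eventually_sequentiallyI[of 1])
qed

lemma square_integrable_W: "square_integrable P (erw_W X k)"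
  using integrable_W_square by (simp add: square_integrable_def)

lemma square_integrable_noise: "n \<ge> 1 \<Longrightarrow> square_integrable P (noise n)"
  using array_second_moment(1) by (simp add: square_integrable_def)

text \<open>The error splits into the error of the walk, the error \<open>drift n - c\<close> of the coefficient, and the
  row, whose second moment is at most of order \<open>gam n * m n powr (1 - 2 * \<alpha>)\<close>.\<close>

lemma scaled_T_L2:
  assumes a: "1/2 < \<alpha>" and m_lim: "filterlim m at_top sequentially" and g: "gam \<longlonglongrightarrow> \<gamma>"
    and M: "conv_L2 P (\<lambda>n \<omega>. erw_W X n \<omega> / real n powr \<alpha>) M"
  shows "conv_L2 P (\<lambda>n \<omega>. gam n * erw_T X m V \<eta> n \<omega> / real (m n) powr \<alpha>) (\<lambda>\<omega>. (\<gamma> + \<alpha> * (1 - \<gamma>)) * M \<omega>)"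
  unfolding conv_L2_def
proof (intro conjI allI)
  let ?c = "\<gamma> + \<alpha> * (1 - \<gamma>)"
  have Msq: "square_integrable P M" and M_lim: "(\<lambda>n. \<integral>\<omega>. (erw_W X n \<omega> / real n powr \<alpha> - M \<omega>)\<^sup>2 \<partial>P) \<longlonglongrightarrow> 0"
    using M by (auto simp: conv_L2_def)
  show "square_integrable P (\<lambda>\<omega>. ?c * M \<omega>)"
    by (rule square_integrable_mult[OF Msq])
  show sqT: "square_integrable P (\<lambda>\<omega>. gam n * erw_T X m V \<eta> n \<omega> / real (m n) powr \<alpha>)" for n
  proof (cases "n \<ge> 1")
    case True
    have "square_integrable P (\<lambda>\<omega>. (1 / real (m n) powr \<alpha>) * (drift n * erw_W X (m n) \<omega> + gam n * noise n \<omega>))"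
      by (intro square_integrable_mult square_integrable_add square_integrable_W square_integrable_noise True)
    then show ?thesis unfolding gam_T[OF True] by simp
  next
    case False
    then have "n = 0" by simp
    then show ?thesis by (simp add: gam_def square_integrable_def)
  qed
  let ?D = "\<lambda>n \<omega>. erw_W X (m n) \<omega> / real (m n) powr \<alpha> - M \<omega>"
  have sqD: "square_integrable P (?D n)" for n
    using square_integrable_add[OF square_integrable_mult[OF square_integrable_W, of "1 / real (m n) powr \<alpha>"]
        square_integrable_mult[OF Msq, of "-1"]] by simp
  let ?B = "\<lambda>n. 3 * ((drift n)\<^sup>2 * (\<integral>\<omega>. (?D n \<omega>)\<^sup>2 \<partial>P) + (drift n - ?c)\<^sup>2 * (\<integral>\<omega>. (M \<omega>)\<^sup>2 \<partial>P)
      + 4 * exp (1/2) * (gam n * real (m n) powr (1 - 2 * \<alpha>)))"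
  have "(\<integral>\<omega>. (gam n * erw_T X m V \<eta> n \<omega> / real (m n) powr \<alpha> - ?c * M \<omega>)\<^sup>2 \<partial>P) \<le> ?B n" if n: "n \<ge> 1" for n
  proof -
    let ?f = "gam n / real (m n) powr \<alpha>"
    have mn: "real (m n) > 0" "real n > 0" using m_bounds[OF n] n by auto
    have iD: "integrable P (\<lambda>\<omega>. (?D n \<omega>)\<^sup>2)" and iM: "integrable P (\<lambda>\<omega>. (M \<omega>)\<^sup>2)"
      using sqD[of n] Msq unfolding square_integrable_def by blast+
    note iS = array_second_moment[OF n]
    have sq3: "(x + y + z)\<^sup>2 \<le> 3 * (x\<^sup>2 + y\<^sup>2 + z\<^sup>2)" for x y z :: real
      using sum_squares_bound[of x y] sum_squares_bound[of y z] sum_squares_bound[of x z]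
      by (simp add: power2_eq_square algebra_simps)
    have eq: "gam n * erw_T X m V \<eta> n \<omega> / real (m n) powr \<alpha> - ?c * M \<omega>
        = drift n * ?D n \<omega> + (drift n - ?c) * M \<omega> + ?f * noise n \<omega>" for \<omega>
      unfolding gam_T[OF n] by (simp add: add_divide_distrib algebra_simps)
    have "(\<integral>\<omega>. (gam n * erw_T X m V \<eta> n \<omega> / real (m n) powr \<alpha> - ?c * M \<omega>)\<^sup>2 \<partial>P)
        \<le> (\<integral>\<omega>. 3 * ((drift n)\<^sup>2 * (?D n \<omega>)\<^sup>2 + (drift n - ?c)\<^sup>2 * (M \<omega>)\<^sup>2 + ?f\<^sup>2 * (noise n \<omega>)\<^sup>2) \<partial>P)"
    proof (rule integral_mono)
      show "integrable P (\<lambda>\<omega>. (gam n * erw_T X m V \<eta> n \<omega> / real (m n) powr \<alpha> - ?c * M \<omega>)\<^sup>2)"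
        using square_integrable_add[OF sqT square_integrable_mult[OF Msq, of "- ?c"], of n]
        unfolding square_integrable_def mult_minus_left add_uminus_conv_diff by blast
      show "integrable P (\<lambda>\<omega>. 3 * ((drift n)\<^sup>2 * (?D n \<omega>)\<^sup>2 + (drift n - ?c)\<^sup>2 * (M \<omega>)\<^sup>2 + ?f\<^sup>2 * (noise n \<omega>)\<^sup>2))"
        by (intro integrable_mult_right Bochner_Integration.integrable_add iD iM iS(1))
      show "(gam n * erw_T X m V \<eta> n \<omega> / real (m n) powr \<alpha> - ?c * M \<omega>)\<^sup>2
          \<le> 3 * ((drift n)\<^sup>2 * (?D n \<omega>)\<^sup>2 + (drift n - ?c)\<^sup>2 * (M \<omega>)\<^sup>2 + ?f\<^sup>2 * (noise n \<omega>)\<^sup>2)" for \<omega>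
        unfolding eq power_mult_distrib[symmetric] by (rule sq3)
    qed
    also have "\<dots> = 3 * ((drift n)\<^sup>2 * (\<integral>\<omega>. (?D n \<omega>)\<^sup>2 \<partial>P) + (drift n - ?c)\<^sup>2 * (\<integral>\<omega>. (M \<omega>)\<^sup>2 \<partial>P)
       + ?f\<^sup>2 * (\<integral>\<omega>. (noise n \<omega>)\<^sup>2 \<partial>P))"
      by (rule integral_lincomb3[OF iD iM iS(1)])
    also have "\<dots> \<le> 3 * ((drift n)\<^sup>2 * (\<integral>\<omega>. (?D n \<omega>)\<^sup>2 \<partial>P) + (drift n - ?c)\<^sup>2 * (\<integral>\<omega>. (M \<omega>)\<^sup>2 \<partial>P)
       + ?f\<^sup>2 * (4 * exp (1/2) * real n))"
      by (intro mult_left_mono add_left_mono iS(2)) auto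
    also have "?f\<^sup>2 * (4 * exp (1/2) * real n) = 4 * exp (1/2) * (gam n * real (m n) powr (1 - 2 * \<alpha>))"
    proof -
      have "real (m n) powr (1 - 2 * \<alpha>) = real (m n) / (real (m n) powr \<alpha>)\<^sup>2"
        using mn by (simp add: powr_diff power2_eq_square powr_add[symmetric])
      then show ?thesis
        using mn by (simp add: gam_def power2_eq_square mult_ac)
    qed
    finally show ?thesis .
  qed
  moreover have "?B \<longlonglongrightarrow> 3 * (?c\<^sup>2 * 0 + (?c - ?c)\<^sup>2 * (\<integral>\<omega>. (M \<omega>)\<^sup>2 \<partial>P) + 4 * exp (1/2) * (\<gamma> * 0))"
  proof -
    have "(\<lambda>k. real k powr (1 - 2 * \<alpha>)) \<longlonglongrightarrow> 0"
      using a by (intro tendsto_neg_powr filterlim_real_sequentially) auto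
    from filterlim_compose[OF this m_lim] filterlim_compose[OF M_lim m_lim] g show ?thesis
      unfolding drift_def by (intro tendsto_intros)
  qed
  then have "?B \<longlonglongrightarrow> 0" by simp
  ultimately show "(\<lambda>n. \<integral>\<omega>. (gam n * erw_T X m V \<eta> n \<omega> / real (m n) powr \<alpha> - ?c * M \<omega>)\<^sup>2 \<partial>P) \<longlonglongrightarrow> 0"
    by (intro tendsto_sandwich[OF _ _ tendsto_const \<open>?B \<longlonglongrightarrow> 0\<close>])
       (auto intro!: eventually_sequentiallyI[of 1])
qed

end

theorem theorem2p1:
  fixes P :: "'a measure"
    and p s \<alpha> \<gamma> :: real
    and X :: "nat \<Rightarrow> 'a \<Rightarrow> real"
    and U :: "nat \<Rightarrow> 'a \<Rightarrow> nat"
    and \<epsilon> :: "nat \<Rightarrow> 'a \<Rightarrow> real"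
    and m :: "nat \<Rightarrow> nat"
    and V :: "nat \<Rightarrow> nat \<Rightarrow> 'a \<Rightarrow> nat"
    and \<eta> :: "nat \<Rightarrow> nat \<Rightarrow> 'a \<Rightarrow> real"
    and g :: "nat \<Rightarrow> real"
    and W T :: "nat \<Rightarrow> 'a \<Rightarrow> real"
  assumes p: "p \<in> {0<..<1}"
    and s: "s \<in> {0..1}"
    and alpha: "\<alpha> = 2 * p - 1"
    and m_bounds: "\<And>n. n \<ge> 1 \<Longrightarrow> 1 \<le> m n \<and> m n \<le> n"
    and m_lim: "filterlim m at_top sequentially"
    and g: "\<And>n. g n = real (m n) / real n"
    and gamma: "\<gamma> \<in> {0..1}"
    and g_lim: "g \<longlonglongrightarrow> \<gamma>"
    and erw: "erw_triangular_array P p s X U \<epsilon> m V \<eta>"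
    and W: "W = erw_W X"
    and T: "T = erw_T X m V \<eta>"
  shows
    "(\<alpha> \<in> {-1<..<1/2} \<longrightarrow>
        conv_in_law P (\<lambda>n \<omega>. g n * T n \<omega> / sqrt (real (m n)))
          (centered_normal ((\<gamma> + \<alpha> * (1 - \<gamma>))\<^sup>2 / (1 - 2 * \<alpha>) + \<gamma> * (1 - \<gamma>))))
     \<and> (\<alpha> = 1/2 \<longrightarrow>
        conv_in_law P (\<lambda>n \<omega>. g n * T n \<omega> / sqrt (real (m n) * ln (real (m n))))
          (centered_normal ((1 + \<gamma>)\<^sup>2 / 4)))
     \<and> (\<alpha> \<in> {1/2<..<1} \<longrightarrow>
        (\<forall>M :: 'a \<Rightarrow> real.
           conv_as P (\<lambda>n \<omega>. W n \<omega> / real n powr \<alpha>) M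
           \<and> conv_L2 P (\<lambda>n \<omega>. W n \<omega> / real n powr \<alpha>) M \<longrightarrow>
           conv_as P (\<lambda>n \<omega>. g n * T n \<omega> / real (m n) powr \<alpha>)
             (\<lambda>\<omega>. (\<gamma> + \<alpha> * (1 - \<gamma>)) * M \<omega>)
           \<and> conv_L2 P (\<lambda>n \<omega>. g n * T n \<omega> / real (m n) powr \<alpha>)
             (\<lambda>\<omega>. (\<gamma> + \<alpha> * (1 - \<gamma>)) * M \<omega>)
           \<and> conv_in_law P
             (\<lambda>n \<omega>. (g n * T n \<omega> - M \<omega> * (g n + \<alpha> * (1 - g n)) * real (m n) powr \<alpha>)
                     / sqrt (real (m n)))
             (centered_normal ((\<gamma> + \<alpha> * (1 - \<gamma>))\<^sup>2 / (2 * \<alpha> - 1) + \<gamma> * (1 - \<gamma>)))))"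
proof -
  interpret elephant_array P p s X U \<epsilon> m V \<eta> \<alpha>
    unfolding elephant_array_def elephant_array_axioms_def using erw p alpha m_bounds by blast
  have gam: "gam = g" unfolding gam_def[abs_def] using g by auto
  have dr: "drift n = g n + \<alpha> * (1 - g n)" for n by (simp add: drift_def gam)
  have g_lim': "gam \<longlonglongrightarrow> \<gamma>" using g_lim by (simp add: gam)
  show ?thesis
  proof (intro conjI impI allI)
    assume "\<alpha> \<in> {-1<..<1/2}"
    then show "conv_in_law P (\<lambda>n \<omega>. g n * T n \<omega> / sqrt (real (m n)))
          (centered_normal ((\<gamma> + \<alpha> * (1 - \<gamma>))\<^sup>2 / (1 - 2 * \<alpha>) + \<gamma> * (1 - \<gamma>)))"
      using clt_subcritical[OF _ m_lim g_lim'] by (simp add: gam T)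
  next
    assume "\<alpha> = 1/2"
    then show "conv_in_law P (\<lambda>n \<omega>. g n * T n \<omega> / sqrt (real (m n) * ln (real (m n))))
          (centered_normal ((1 + \<gamma>)\<^sup>2 / 4))"
      using clt_critical[OF _ m_lim g_lim'] by (simp add: gam T)
  next
    fix M :: "'a \<Rightarrow> real"
    assume "\<alpha> \<in> {1/2<..<1}"
    then have a: "1/2 < \<alpha>" by simp
    assume "conv_as P (\<lambda>n \<omega>. W n \<omega> / real n powr \<alpha>) M \<and> conv_L2 P (\<lambda>n \<omega>. W n \<omega> / real n powr \<alpha>) M"
    then have M: "AE \<omega> in P. (\<lambda>N. erw_W X N \<omega> / real N powr \<alpha>) \<longlonglongrightarrow> M \<omega>"
        "conv_L2 P (\<lambda>n \<omega>. erw_W X n \<omega> / real n powr \<alpha>) M" "M \<in> borel_measurable P"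
      by (auto simp: W conv_as_def conv_L2_def square_integrable_def)
    show "conv_as P (\<lambda>n \<omega>. g n * T n \<omega> / real (m n) powr \<alpha>) (\<lambda>\<omega>. (\<gamma> + \<alpha> * (1 - \<gamma>)) * M \<omega>)"
      using scaled_T_as[OF a m_lim g_lim' M(1)] by (simp add: conv_as_def gam T)
    show "conv_L2 P (\<lambda>n \<omega>. g n * T n \<omega> / real (m n) powr \<alpha>) (\<lambda>\<omega>. (\<gamma> + \<alpha> * (1 - \<gamma>)) * M \<omega>)"
      using scaled_T_L2[OF a m_lim g_lim' M(2)] by (simp add: gam T)
    show "conv_in_law P
             (\<lambda>n \<omega>. (g n * T n \<omega> - M \<omega> * (g n + \<alpha> * (1 - g n)) * real (m n) powr \<alpha>)
                     / sqrt (real (m n)))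
             (centered_normal ((\<gamma> + \<alpha> * (1 - \<gamma>))\<^sup>2 / (2 * \<alpha> - 1) + \<gamma> * (1 - \<gamma>)))"
      using clt_gt_half[OF a m_lim g_lim' M(3,1)] by (simp add: gam dr T)
  qed
qed

end
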